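(* Given $\boldsymbol f\in L^1(0,T;L^2(\Omega)^d)$ and $\boldsymbol u_0\in\boldsymbol{\mathcal Z}$, there exists at least one solution $\boldsymbol u_{h,\tau}\in\boldsymbol{\mathcal Z}_{h,\tau}$ of the semi-implicit space–time formulation $$m_{h,\tau}(\boldsymbol u_{h,\tau},\boldsymbol z)+\nu\, a_{h,\tau}(\boldsymbol u_{h,\tau},\boldsymbol z)+c_{h,\tau}(\widetilde{\boldsymbol u}_{h,\tau};\boldsymbol u_{h,\tau},\boldsymbol z)=(\boldsymbol f,\boldsymbol z)_{Q_T}+(\boldsymbol u_0,\boldsymbol z(\cdot,0))_\Omega\qquad\forall \boldsymbol z\in\boldsymbol{\mathcal Z}_{h,\tau},$$ which satisfies $$|||\boldsymbol u_{h,\tau}|||_{\mathcal E;\widetilde{\boldsymbol u}_{h,\tau}}^2\le C_{\mathrm{stab}}^{\mathrm{lin}}\big(\|\boldsymbol f\|_{L^1(0,T;L^2(\Omega)^d)}^2+\|\boldsymbol u_0\|_{L^2(\Omega)^d}^2\big).$$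
   Context: Domain and meshes. $\Omega\subset\mathbb R^d$ ($d\in\{2,3\}$) is an open bounded Lipschitz domain, $T>0$, $\nu>0$, $Q_T=\Omega\times(0,T)$. $\{\mathcal T_h\}_{h>0}$ is a family of shape-regular conforming simplicial meshes of $\Omega$ (shape-regularity parameter $\rho$), $h_K=\mathrm{diam}(K)$, $h=\max_K h_K$. $\mathcal F_h=\mathcal F_{h,\circ}\cup\mathcal F_{h,\mathcal D}$ is the set of facets (interior and boundary), $h_F$ the diameter of $F$, $\mathbf n_F$ a fixed unit normal to $F$ (outward to $\Omega$ on boundary facets). $0=t_0<\dots<t_N=T$, $I_n=(t_{n-1},t_n)$, $\tau_n=t_n-t_{n-1}$, $\tau=\max_n\tau_n$, $Q_n=\Omega\times I_n$. Time jumps: $[\![z]\!]_n=z(\cdot,t_n^-)-z(\cdot,t_n^+)$, $1\le n\le N-1$, with one-sided limits; values at $t=0$ and $t=T$ are traces from inside $(0,T)$. Spatial averages and jumps: on an interior facet shared by $K_\pm$ ($\mathbf n_F$ pointing out of $K_+$), $\{\!\{\boldsymbol v\}\!\}=\frac12(\boldsymbol v|_{K_+}+\boldsymbol v|_{K_-})$, $[\![\boldsymbol v]\!]=\boldsymbol v|_{K_+}-\boldsymbol v|_{K_-}$; on boundary facets both equal $\boldsymbol v$. $\boldsymbol\nabla_h$ is the elementwise gradient (rows are gradients of components). $(\cdot,\cdot)_D$ is the $L^2(D)$ inner product. Spaces. $\boldsymbol{\mathcal Z}=\{\boldsymbol v\in H(\mathrm{div},\Omega):\mathrm{div}\,\boldsymbol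 v=0,\ \boldsymbol v\cdot\mathbf n_\Omega=0\text{ on }\partial\Omega\}$. For integers $k\ge1$, $\ell\ge0$, $\boldsymbol{\mathcal V}_h\subset H(\mathrm{div},\Omega)$ is either the Raviart–Thomas space $\mathrm{RT}_k(\mathcal T_h)$ or the Brezzi–Douglas–Marini space $\mathrm{BDM}_k(\mathcal T_h)$ of order $k$. $\boldsymbol{\mathcal V}_{h,\tau}$ is the set of $\boldsymbol v\in L^2(0,T;H(\mathrm{div},\Omega))$ with $\boldsymbol v\cdot\mathbf n_\Omega=0$ on $\partial\Omega\times(0,T)$ and $\boldsymbol v|_{Q_n}\in\mathbb P_\ell(I_n)\otimes\boldsymbol{\mathcal V}_h$ for all $n$. $\boldsymbol{\mathcal Z}_{h,\tau}=\{\boldsymbol v\in\boldsymbol{\mathcal V}_{h,\tau}:\mathrm{div}\,\boldsymbol v=0 \text{ in each } Q_n\}$. Tilde operator. For $\boldsymbol v_{h,\tau}\in\boldsymbol{\mathcal V}_{h,\tau}$, let $\boldsymbol v_{h,\tau}^{(n)}=\boldsymbol v_{h,\tau}|_{Q_n}$, extended to all of $Q_T$ as a polynomial in time. Then $\widetilde{\boldsymbol v}_{h,\tau}\in\boldsymbol{\mathcal V}_{h,\tau}$ is defined by $\widetilde{\boldsymbol v}_{h,\tau}|_{Q_1}=\boldsymbol v_{h,\tau}^{(1)}|_{Q_1}$ and $\widetilde{\boldsymbol v}_{h,\tau}|_{Q_n}=\boldsymbol v_{h,\tau}^{(n-1)}|_{Q_n}$ for $n>1$. Quadrature. $\{(\omega_i^{(n)},s_i^{(n)})\}_{i=1}^{\ell+1}$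 is the left-sided Gauss–Radau rule on $I_n$ ($s_1^{(n)}=t_{n-1}$, positive weights, exact for degree $\le2\ell$); $\mathsf Q_\tau^{\mathcal R,(n)}(u)=\sum_i\omega_i^{(n)}u(s_i^{(n)})$ (node values taken from inside $I_n$), $\mathsf Q_\tau^{\mathcal R}=\sum_n\mathsf Q_\tau^{\mathcal R,(n)}$; $\mathcal I_\tau^{\mathcal R}$ is the piecewise (in time, on each $I_n$) Lagrange interpolant of degree $\ell$ at these nodes, also applied pointwise in space. Forms. $\sigma>0$ is a fixed interior-penalty parameter, assumed sufficiently large as usual for interior-penalty DG methods (above a threshold depending only on $k,d,\rho$), and $c_S>0$ a fixed small constant; $\gamma_F(\boldsymbol w)=\max\{c_S,\|\boldsymbol w\cdot\mathbf n_F\|_{L^\infty(F)}\}$ (pointwise in time), $\gamma(\boldsymbol w)|_F=\gamma_F(\boldsymbol w)$. For $\boldsymbol w,\boldsymbol u,\boldsymbol v\in\boldsymbol{\mathcal V}_{h,\tau}$: $m_{h,\tau}(\boldsymbol u,\boldsymbol v)=\sum_{n=1}^N(\partial_t\boldsymbol u,\boldsymbol v)_{Q_n}-\sum_{n=1}^{N-1}([\![\boldsymbol u]\!]_n,\boldsymbol v(\cdot,t_n^+))_\Omega+(\boldsymbol u(\cdot,0),\boldsymbol v(\cdot,0))_\Omega$; $a_{h,\tau}(\boldsymbol u,\boldsymbol v)=\sum_{n=1}^N\big[(\boldsymbol\nabla_h\boldsymbol u,\boldsymbol\nabla_h\boldsymbol v)_{Q_n}+\sum_{F\in\mathcal F_h}\{-(\{\!\{\boldsymbol\nabla_h\boldsymbol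 u\}\!\}\mathbf n_F,[\![\boldsymbol v]\!])_{F\times I_n}-([\![\boldsymbol u]\!],\{\!\{\boldsymbol\nabla_h\boldsymbol v\}\!\}\mathbf n_F)_{F\times I_n}+(\sigma h_F^{-1}[\![\boldsymbol u]\!],[\![\boldsymbol v]\!])_{F\times I_n}\}\big]$; $c_{h,\tau}(\boldsymbol w;\boldsymbol u,\boldsymbol v)=\sum_{n=1}^N\big[(\mathcal I_\tau^{\mathcal R}((\boldsymbol\nabla_h\boldsymbol u)\boldsymbol w),\boldsymbol v)_{Q_n}+\sum_{F\in\mathcal F_{h,\circ}}\{-(\mathcal I_\tau^{\mathcal R}((\boldsymbol w\cdot\mathbf n_F)[\![\boldsymbol u]\!]),\{\!\{\boldsymbol v\}\!\})_{F\times I_n}+\frac12(\mathcal I_\tau^{\mathcal R}(\gamma(\boldsymbol w)[\![\boldsymbol u]\!]),[\![\boldsymbol v]\!])_{F\times I_n}\}\big]$. Norms. $\|\boldsymbol v_h\|_{\mathcal A,h}^2=\|\boldsymbol\nabla_h\boldsymbol v_h\|_{L^2(\Omega)^{d\times d}}^2+\sum_{F\in\mathcal F_h}\int_F\sigma h_F^{-1}|[\![\boldsymbol v_h]\!]|^2\,dS$, $\|\boldsymbol v\|_{\mathcal A}^2=\sum_n\int_{I_n}\|\boldsymbol v(\cdot,t)\|_{\mathcal A,h}^2dt$, $|\boldsymbol v|_{\mathsf J}^2=\frac12\big(\|\boldsymbol v(\cdot,T)\|_{L^2(\Omega)^d}^2+\sum_{n=1}^{N-1}\|[\![\boldsymbol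 v]\!]_n\|_{L^2(\Omega)^d}^2+\|\boldsymbol v(\cdot,0)\|_{L^2(\Omega)^d}^2\big)$, $|\boldsymbol v|_{\gamma,\boldsymbol w}^2=\frac12\sum_{F\in\mathcal F_{h,\circ}}\mathsf Q_\tau^{\mathcal R}\big(\gamma_F(\boldsymbol w)\|[\![\boldsymbol v]\!]\|_{L^2(F)^d}^2\big)$, $|||\boldsymbol v|||_{\mathcal E;\boldsymbol w}^2=\|\boldsymbol v\|_{L^\infty(0,T;L^2(\Omega)^d)}^2+\nu\|\boldsymbol v\|_{\mathcal A}^2+|\boldsymbol v|_{\mathsf J}^2+|\boldsymbol v|_{\gamma,\boldsymbol w}^2$. Constant. $C_{\mathrm{stab}}^{\mathrm{lin}}>0$ denotes the constant, depending only on $\ell$ (hence independent of $h,\tau,\nu,T,\boldsymbol w$), of the linear stability estimate: for every $\boldsymbol w\in\boldsymbol{\mathcal Z}_{h,\tau}$, every $\boldsymbol u\in\boldsymbol{\mathcal Z}_{h,\tau}$ with $m_{h,\tau}(\boldsymbol u,\boldsymbol z)+\nu a_{h,\tau}(\boldsymbol u,\boldsymbol z)+c_{h,\tau}(\boldsymbol w;\boldsymbol u,\boldsymbol z)=(\boldsymbol f,\boldsymbol z)_{Q_T}+(\boldsymbol u_0,\boldsymbol z(\cdot,0))_\Omega$ for all $\boldsymbol z\in\boldsymbol{\mathcal Z}_{h,\tau}$ satisfies $|||\boldsymbol u|||_{\mathcal E;\boldsymbol w}^2\le C_{\mathrm{stab}}^{\mathrm{lin}}(\|\boldsymbol f\|_{L^1(0,T;L^2(\Omega)^d)}^2+\|\boldsymbol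 u_0\|_{L^2(\Omega)^d}^2)$. *)

theory Defs
  imports "HOL-Analysis.Analysis" "HOL-Probability.Essential_Supremum"
begin

section \<open>Lebesgue and Sobolev-type spaces\<close>

definition L2_space :: "'a measure \<Rightarrow> ('a \<Rightarrow> 'b::euclidean_space) set" where
  "L2_space M = {v \<in> borel_measurable M. integrable M (\<lambda>x. (norm (v x))\<^sup>2)}"

definition L2_inner :: "'a measure \<Rightarrow> ('a \<Rightarrow> 'b::euclidean_space) \<Rightarrow> ('a \<Rightarrow> 'b) \<Rightarrow> real" where
  "L2_inner M v w = (LINT x|M. v x \<bullet> w x)"

definition L2_norm :: "'a measure \<Rightarrow> ('a \<Rightarrow> 'b::euclidean_space) \<Rightarrow> real" where
  "L2_norm M v = sqrt (LINT x|M. (norm (v x))\<^sup>2)"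

definition Linf_norm :: "'a measure \<Rightarrow> ('a \<Rightarrow> 'b::real_normed_vector) \<Rightarrow> real" where
  "Linf_norm M v = real_of_ereal (esssup M (\<lambda>x. ereal (norm (v x))))"

text \<open>\<open>L\<^sup>1(0,T;L\<^sup>2(\<Omega>)\<^sup>d)\<close>.  Since \<open>L\<^sup>2(\<Omega>)\<^sup>d\<close> is separable, Bochner
  measurability amounts to joint measurability on the space-time cylinder.\<close>

definition L1L2_space :: "real \<Rightarrow> (real^'d) set \<Rightarrow> (real \<Rightarrow> real^'d \<Rightarrow> real^'d) set" where
  "L1L2_space T \<Omega> = {f.
     (\<lambda>(t, x). f t x) \<in> borel_measurable (lebesgue_on ({0<..<T} \<times> \<Omega>)) \<and>
     (AE t in lebesgue_on {0<..<T}. f t \<in> L2_space (lebesgue_on \<Omega>)) \<and>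
     integrable (lebesgue_on {0<..<T}) (\<lambda>t. L2_norm (lebesgue_on \<Omega>) (f t))}"

definition L1L2_norm :: "real \<Rightarrow> (real^'d) set \<Rightarrow> (real \<Rightarrow> real^'d \<Rightarrow> real^'d) \<Rightarrow> real" where
  "L1L2_norm T \<Omega> f = (LINT t|lebesgue_on {0<..<T}. L2_norm (lebesgue_on \<Omega>) (f t))"

primrec continuously_diff :: "nat \<Rightarrow> (real^'d \<Rightarrow> real) \<Rightarrow> bool" where
  "continuously_diff 0 \<phi> \<longleftrightarrow> continuous_on UNIV \<phi>"
| "continuously_diff (Suc m) \<phi> \<longleftrightarrow> \<phi> differentiable_on UNIV \<and>
     (\<forall>i. continuously_diff m (\<lambda>x. frechet_derivative \<phi> (at x) (axis i 1)))"

definition smooth :: "(real^'d \<Rightarrow> real) \<Rightarrow> bool" where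
  "smooth \<phi> \<longleftrightarrow> (\<forall>m. continuously_diff m \<phi>)"

definition grad :: "(real^'d \<Rightarrow> real) \<Rightarrow> real^'d \<Rightarrow> real^'d" where
  "grad \<phi> x = (\<chi> i. frechet_derivative \<phi> (at x) (axis i 1))"

definition has_weak_div :: "(real^'d) set \<Rightarrow> (real^'d \<Rightarrow> real^'d) \<Rightarrow> (real^'d \<Rightarrow> real) \<Rightarrow> bool" where
  "has_weak_div \<Omega> v g \<longleftrightarrow>
     v \<in> L2_space (lebesgue_on \<Omega>) \<and> g \<in> L2_space (lebesgue_on \<Omega>) \<and>
     (\<forall>\<phi>. smooth \<phi> \<and> compact (closure {x. \<phi> x \<noteq> 0}) \<and> closure {x. \<phi> x \<noteq> 0} \<subseteq> \<Omega> \<longrightarrow>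
        L2_inner (lebesgue_on \<Omega>) v (grad \<phi>) = - L2_inner (lebesgue_on \<Omega>) g \<phi>)"

definition Hdiv :: "(real^'d) set \<Rightarrow> (real^'d \<Rightarrow> real^'d) set" where
  "Hdiv \<Omega> = {v. \<exists>g. has_weak_div \<Omega> v g}"

text \<open>The normal trace on the boundary of \<open>v \<in> H(div,\<Omega>)\<close> is the functional
  \<open>\<phi> \<mapsto> (v, \<nabla>\<phi>) + (div v, \<phi>)\<close>; restrictions to \<open>\<Omega>\<close> of smooth functions on the whole
  space are dense in \<open>H\<^sup>1(\<Omega>)\<close> for Lipschitz \<open>\<Omega>\<close>.\<close>

definition zero_normal_trace :: "(real^'d) set \<Rightarrow> (real^'d \<Rightarrow> real^'d) \<Rightarrow> bool" where
  "zero_normal_trace \<Omega> v \<longleftrightarrow>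
     (\<exists>g. has_weak_div \<Omega> v g \<and>
        (\<forall>\<phi>. smooth \<phi> \<longrightarrow>
           L2_inner (lebesgue_on \<Omega>) v (grad \<phi>) + L2_inner (lebesgue_on \<Omega>) g \<phi> = 0))"

definition Z_space :: "(real^'d) set \<Rightarrow> (real^'d \<Rightarrow> real^'d) set" where
  "Z_space \<Omega> = {v \<in> Hdiv \<Omega>. has_weak_div \<Omega> v (\<lambda>_. 0) \<and> zero_normal_trace \<Omega> v}"

definition lipschitz_domain :: "(real^'d) set \<Rightarrow> bool" where
  "lipschitz_domain \<Omega> \<longleftrightarrow> open \<Omega> \<and> connected \<Omega> \<and> bounded \<Omega> \<and> \<Omega> \<noteq> {} \<and>
     (\<forall>x0 \<in> frontier \<Omega>. \<exists>e \<psi> L r. norm e = 1 \<and> 0 < r \<and> L-lipschitz_on UNIV \<psi> \<and>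
        \<Omega> \<inter> ball x0 r = {x \<in> ball x0 r. \<psi> (x - (x \<bullet> e) *\<^sub>R e) < x \<bullet> e})"


section \<open>Discretizations\<close>

datatype element_family = RT | BDM

text \<open>\<open>facet_normal F\<close> is the fixed unit normal of the facet \<open>F\<close>.  The time mesh is
  \<open>time_pt 0 < \<dots> < time_pt num_steps\<close>; \<open>radau_weight n i\<close> and \<open>radau_node n i\<close>, with
  \<open>1 \<le> i \<le> time_degree + 1\<close>, form the quadrature rule on the \<open>n\<close>-th time interval.\<close>

record ('d::finite) discretization =
  domain_of :: "(real^'d) set"
  mesh :: "(real^'d) set set"
  facet_normal :: "(real^'d) set \<Rightarrow> real^'d"
  num_steps :: nat
  time_pt :: "nat \<Rightarrow> real"
  family :: element_family
  space_degree :: nat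
  time_degree :: nat
  radau_weight :: "nat \<Rightarrow> nat \<Rightarrow> real"
  radau_node :: "nat \<Rightarrow> nat \<Rightarrow> real"
  penalty :: real
  c_S :: real

definition facets :: "'d::finite discretization \<Rightarrow> (real^'d) set set" where
  "facets D = {F. \<exists>K\<in>mesh D. F facet_of K}"

definition interior_facets :: "'d::finite discretization \<Rightarrow> (real^'d) set set" where
  "interior_facets D =
     {F. \<exists>K\<in>mesh D. \<exists>K'\<in>mesh D. K \<noteq> K' \<and> F facet_of K \<and> F facet_of K'}"

text \<open>For a full-dimensional simplex \<open>K\<close> with facet \<open>F\<close>: \<open>e\<close> is the unit normal to \<open>F\<close>
  pointing out of \<open>K\<close>.  Orthogonality to \<open>F\<close> is included, since \<open>F \<subseteq> K\<close>.\<close>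

definition outward_unit_normal :: "(real^'d) set \<Rightarrow> (real^'d) set \<Rightarrow> real^'d \<Rightarrow> bool" where
  "outward_unit_normal K F e \<longleftrightarrow> norm e = 1 \<and> (\<forall>x\<in>F. \<forall>y\<in>K. e \<bullet> (y - x) \<le> 0)"

definition shape_regular :: "real \<Rightarrow> (real^'d) set set \<Rightarrow> bool" where
  "shape_regular \<rho> \<T> \<longleftrightarrow> 0 < \<rho> \<and> (\<forall>K\<in>\<T>. \<exists>x r. ball x r \<subseteq> K \<and> diameter K \<le> \<rho> * r)"

definition left_gauss_radau ::
  "real \<Rightarrow> real \<Rightarrow> nat \<Rightarrow> (nat \<Rightarrow> real) \<Rightarrow> (nat \<Rightarrow> real) \<Rightarrow> bool" where
  "left_gauss_radau a b l \<omega> s \<longleftrightarrow>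
     s 1 = a \<and> strict_mono_on {1..l+1} s \<and> s ` {1..l+1} \<subseteq> {a..b} \<and>
     (\<forall>i\<in>{1..l+1}. 0 < \<omega> i) \<and>
     (\<forall>p::real poly. degree p \<le> 2 * l \<longrightarrow>
        (\<Sum>i=1..l+1. \<omega> i * poly p (s i)) = integral {a..b} (poly p))"

text \<open>The conjunct on normals orients them outward of \<open>\<Omega>\<close> on boundary facets, because
  such a facet belongs to one element only.\<close>

definition valid_discretization :: "real \<Rightarrow> 'd::finite discretization \<Rightarrow> bool" where
  "valid_discretization \<rho> D \<longleftrightarrow>
     lipschitz_domain (domain_of D) \<and>
     triangulation (mesh D) \<and> (\<forall>K\<in>mesh D. int CARD('d) simplex K) \<and>
     \<Union>(mesh D) = closure (domain_of D) \<and> shape_regular \<rho> (mesh D) \<and>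
     (\<forall>F\<in>facets D. \<exists>K\<in>mesh D. F facet_of K \<and> outward_unit_normal K F (facet_normal D F)) \<and>
     1 \<le> num_steps D \<and> time_pt D 0 = 0 \<and>
     (\<forall>n<num_steps D. time_pt D n < time_pt D (Suc n)) \<and>
     (\<forall>n\<in>{1..num_steps D}. left_gauss_radau (time_pt D (n - 1)) (time_pt D n) (time_degree D)
        (radau_weight D n) (radau_node D n)) \<and>
     1 \<le> space_degree D \<and> 0 < penalty D \<and> 0 < c_S D"

definition final_time :: "'d::finite discretization \<Rightarrow> real" where
  "final_time D = time_pt D (num_steps D)"

definition slab :: "'d::finite discretization \<Rightarrow> nat \<Rightarrow> real set" where
  "slab D n = {time_pt D (n - 1)<..<time_pt D n}"

abbreviation vol :: "'d::finite discretization \<Rightarrow> (real^'d) measure" where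
  "vol D \<equiv> lebesgue_on (domain_of D)"

text \<open>Surface measure on a flat facet: the area of a subset of \<open>F\<close> is the volume of the right
  prism of height one over it (the nearest-point map projects the prism onto its base).\<close>

definition surface_measure :: "'d::finite discretization \<Rightarrow> (real^'d) set \<Rightarrow> (real^'d) measure" where
  "surface_measure D F =
     distr (restrict_space lborel {x + s *\<^sub>R facet_normal D F | x s. x \<in> F \<and> 0 \<le> s \<and> s \<le> 1})
       (restrict_space borel F) (closest_point F)"


section \<open>Discrete spaces\<close>

definition monomial :: "('d::finite \<Rightarrow> nat) \<Rightarrow> real^'d \<Rightarrow> real" where
  "monomial \<alpha> x = (\<Prod>i\<in>UNIV. x $ i ^ \<alpha> i)"

definition poly_space :: "nat \<Rightarrow> (real^'d::finite \<Rightarrow> real) set" where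
  "poly_space k = {p. \<exists>c. p = (\<lambda>x. \<Sum>\<alpha> | (\<Sum>i\<in>UNIV. \<alpha> i) \<le> k. c \<alpha> * monomial \<alpha> x)}"

definition homogeneous_poly_space :: "nat \<Rightarrow> (real^'d::finite \<Rightarrow> real) set" where
  "homogeneous_poly_space k = {p. \<exists>c. p = (\<lambda>x. \<Sum>\<alpha> | (\<Sum>i\<in>UNIV. \<alpha> i) = k. c \<alpha> * monomial \<alpha> x)}"

definition vector_poly_space :: "nat \<Rightarrow> (real^'d::finite \<Rightarrow> real^'d) set" where
  "vector_poly_space k = {q. \<forall>i. (\<lambda>x. q x $ i) \<in> poly_space k}"

fun local_space :: "element_family \<Rightarrow> nat \<Rightarrow> (real^'d::finite \<Rightarrow> real^'d) set" where
  "local_space RT k = {v. \<exists>q\<in>vector_poly_space k. \<exists>r\<in>homogeneous_poly_space k.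
     v = (\<lambda>x. q x + r x *\<^sub>R x)}"
| "local_space BDM k = vector_poly_space k"

definition V_h :: "'d::finite discretization \<Rightarrow> (real^'d \<Rightarrow> real^'d) set" where
  "V_h D = {v \<in> Hdiv (domain_of D). \<forall>K\<in>mesh D. \<exists>p\<in>local_space (family D) (space_degree D).
     \<forall>x\<in>interior K. v x = p x}"

text \<open>Discrete functions are written \<open>u t x\<close>.  Their values at the nodes of the time mesh and
  on the skeleton of the spatial mesh are immaterial: only one-sided limits are used there.
  Membership in \<open>L\<^sup>2(0,T;H(div,\<Omega>))\<close> is implied by the piecewise polynomial structure.\<close>

definition V_ht :: "'d::finite discretization \<Rightarrow> (real \<Rightarrow> real^'d \<Rightarrow> real^'d) set" where
  "V_ht D = {u. \<forall>n\<in>{1..num_steps D}.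
     (\<exists>c. (\<forall>i\<le>time_degree D. c i \<in> V_h D) \<and>
        (\<forall>t\<in>slab D n. \<forall>x\<in>domain_of D. u t x = (\<Sum>i\<le>time_degree D. t ^ i *\<^sub>R c i x))) \<and>
     (\<forall>t\<in>slab D n. zero_normal_trace (domain_of D) (u t))}"

definition Z_ht :: "'d::finite discretization \<Rightarrow> (real \<Rightarrow> real^'d \<Rightarrow> real^'d) set" where
  "Z_ht D = {u \<in> V_ht D. \<forall>n\<in>{1..num_steps D}. \<forall>t\<in>slab D n.
     has_weak_div (domain_of D) (u t) (\<lambda>_. 0)}"

text \<open>The polynomial in time, of degree at most \<open>time_degree D\<close>, that agrees with \<open>g\<close> on the
  \<open>n\<close>-th time interval.\<close>

definition slab_extension ::
  "'d::finite discretization \<Rightarrow> nat \<Rightarrow> (real \<Rightarrow> 'b::real_vector) \<Rightarrow> real \<Rightarrow> 'b" where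
  "slab_extension D n g =
     (THE q. (\<exists>c. q = (\<lambda>t. \<Sum>i\<le>time_degree D. t ^ i *\<^sub>R c i)) \<and> (\<forall>t\<in>slab D n. q t = g t))"

text \<open>For \<open>t\<close> in the \<open>n\<close>-th time interval, \<open>LEAST n. t \<le> time_pt D n\<close> is \<open>n\<close>.\<close>

definition tilde ::
  "'d::finite discretization \<Rightarrow> (real \<Rightarrow> real^'d \<Rightarrow> real^'d) \<Rightarrow> real \<Rightarrow> real^'d \<Rightarrow> real^'d" where
  "tilde D u t x =
     (let n = (LEAST n. t \<le> time_pt D n) in
      if 1 < n \<and> n \<le> num_steps D then slab_extension D (n - 1) (\<lambda>s. u s x) t else u t x)"


section \<open>Traces, jumps and time quadrature\<close>

definition left_lim :: "(real \<Rightarrow> 'a \<Rightarrow> 'b::t2_space) \<Rightarrow> real \<Rightarrow> 'a \<Rightarrow> 'b" where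
  "left_lim u t x = Lim (at_left t) (\<lambda>s. u s x)"

definition right_lim :: "(real \<Rightarrow> 'a \<Rightarrow> 'b::t2_space) \<Rightarrow> real \<Rightarrow> 'a \<Rightarrow> 'b" where
  "right_lim u t x = Lim (at_right t) (\<lambda>s. u s x)"

definition time_jump ::
  "'d::finite discretization \<Rightarrow> (real \<Rightarrow> real^'d \<Rightarrow> real^'d) \<Rightarrow> nat \<Rightarrow> real^'d \<Rightarrow> real^'d" where
  "time_jump D u n x = left_lim u (time_pt D n) x - right_lim u (time_pt D n) x"

definition inside_value ::
  "'d::finite discretization \<Rightarrow> nat \<Rightarrow> (real \<Rightarrow> 'b::t2_space) \<Rightarrow> real \<Rightarrow> 'b" where
  "inside_value D n g s = Lim (at s within slab D n) g"

definition quadrature :: "'d::finite discretization \<Rightarrow> (real \<Rightarrow> real) \<Rightarrow> real" where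
  "quadrature D g = (\<Sum>n=1..num_steps D. \<Sum>i=1..time_degree D + 1.
     radau_weight D n i * inside_value D n g (radau_node D n i))"

definition lagrange_basis :: "'d::finite discretization \<Rightarrow> nat \<Rightarrow> nat \<Rightarrow> real \<Rightarrow> real" where
  "lagrange_basis D n i t = (\<Prod>j\<in>{1..time_degree D + 1} - {i}.
     (t - radau_node D n j) / (radau_node D n i - radau_node D n j))"

definition interpolant ::
  "'d::finite discretization \<Rightarrow> nat \<Rightarrow> (real \<Rightarrow> 'b::real_normed_vector) \<Rightarrow> real \<Rightarrow> 'b" where
  "interpolant D n g t = (\<Sum>i=1..time_degree D + 1.
     lagrange_basis D n i t *\<^sub>R inside_value D n g (radau_node D n i))"

definition plus_element :: "'d::finite discretization \<Rightarrow> (real^'d) set \<Rightarrow> (real^'d) set" where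
  "plus_element D F =
     (SOME K. K \<in> mesh D \<and> F facet_of K \<and> outward_unit_normal K F (facet_normal D F))"

definition minus_element :: "'d::finite discretization \<Rightarrow> (real^'d) set \<Rightarrow> (real^'d) set" where
  "minus_element D F = (SOME K. K \<in> mesh D \<and> F facet_of K \<and> K \<noteq> plus_element D F)"

definition trace_from :: "(real^'d) set \<Rightarrow> (real^'d \<Rightarrow> 'b::t2_space) \<Rightarrow> real^'d \<Rightarrow> 'b" where
  "trace_from K v x = Lim (at x within interior K) v"

definition avg ::
  "'d::finite discretization \<Rightarrow> (real^'d) set \<Rightarrow> (real^'d \<Rightarrow> 'b::real_normed_vector) \<Rightarrow> real^'d \<Rightarrow> 'b"
where
  "avg D F v x =
     (if F \<in> interior_facets D
      then (1/2) *\<^sub>R (trace_from (plus_element D F) v x + trace_from (minus_element D F) v x)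
      else trace_from (plus_element D F) v x)"

definition jump ::
  "'d::finite discretization \<Rightarrow> (real^'d) set \<Rightarrow> (real^'d \<Rightarrow> 'b::real_normed_vector) \<Rightarrow> real^'d \<Rightarrow> 'b"
where
  "jump D F v x =
     (if F \<in> interior_facets D
      then trace_from (plus_element D F) v x - trace_from (minus_element D F) v x
      else trace_from (plus_element D F) v x)"

text \<open>Elementwise gradient: for discrete functions the Jacobian at a point of an open element is
  that of the polynomial on this element; the skeleton is a null set.\<close>

definition broken_grad :: "(real^'d::finite \<Rightarrow> real^'d) \<Rightarrow> real^'d \<Rightarrow> real^'d^'d" where
  "broken_grad v x = jacobian v (at x)"

text \<open>On interior facets the normal component of a function in \<open>V_h\<close> is single-valued, so that
  it may be evaluated from the average.\<close>

definition normal_component ::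
  "'d::finite discretization \<Rightarrow> (real^'d) set \<Rightarrow> (real^'d \<Rightarrow> real^'d) \<Rightarrow> real^'d \<Rightarrow> real" where
  "normal_component D F w x = avg D F w x \<bullet> facet_normal D F"

definition gamma_F ::
  "'d::finite discretization \<Rightarrow> (real^'d) set \<Rightarrow> (real^'d \<Rightarrow> real^'d) \<Rightarrow> real" where
  "gamma_F D F w = max (c_S D) (Linf_norm (surface_measure D F) (normal_component D F w))"


section \<open>Forms and norms\<close>

definition m_form ::
  "'d::finite discretization \<Rightarrow> (real \<Rightarrow> real^'d \<Rightarrow> real^'d) \<Rightarrow> (real \<Rightarrow> real^'d \<Rightarrow> real^'d) \<Rightarrow> real"
where
  "m_form D u v =
     (\<Sum>n=1..num_steps D. LINT t|lebesgue_on (slab D n).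
        L2_inner (vol D) (\<lambda>x. vector_derivative (\<lambda>s. u s x) (at t)) (v t))
     - (\<Sum>n=1..num_steps D - 1. L2_inner (vol D) (time_jump D u n) (right_lim v (time_pt D n)))
     + L2_inner (vol D) (right_lim u 0) (right_lim v 0)"

definition a_form ::
  "'d::finite discretization \<Rightarrow> (real \<Rightarrow> real^'d \<Rightarrow> real^'d) \<Rightarrow> (real \<Rightarrow> real^'d \<Rightarrow> real^'d) \<Rightarrow> real"
where
  "a_form D u v = (\<Sum>n=1..num_steps D.
     (LINT t|lebesgue_on (slab D n).
        L2_inner (vol D) (broken_grad (u t)) (broken_grad (v t)))
     + (\<Sum>F\<in>facets D.
          - (LINT t|lebesgue_on (slab D n). L2_inner (surface_measure D F)
               (\<lambda>x. avg D F (broken_grad (u t)) x *v facet_normal D F) (jump D F (v t)))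
          - (LINT t|lebesgue_on (slab D n). L2_inner (surface_measure D F)
               (jump D F (u t)) (\<lambda>x. avg D F (broken_grad (v t)) x *v facet_normal D F))
          + (LINT t|lebesgue_on (slab D n). L2_inner (surface_measure D F)
               (\<lambda>x. (penalty D / diameter F) *\<^sub>R jump D F (u t) x) (jump D F (v t)))))"

definition c_form ::
  "'d::finite discretization \<Rightarrow> (real \<Rightarrow> real^'d \<Rightarrow> real^'d) \<Rightarrow> (real \<Rightarrow> real^'d \<Rightarrow> real^'d) \<Rightarrow>
     (real \<Rightarrow> real^'d \<Rightarrow> real^'d) \<Rightarrow> real"
where
  "c_form D w u v = (\<Sum>n=1..num_steps D.
     (LINT t|lebesgue_on (slab D n).
        L2_inner (vol D) (\<lambda>x. interpolant D n (\<lambda>s. broken_grad (u s) x *v w s x) t) (v t))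
     + (\<Sum>F\<in>interior_facets D.
          - (LINT t|lebesgue_on (slab D n). L2_inner (surface_measure D F)
               (\<lambda>x. interpolant D n (\<lambda>s. normal_component D F (w s) x *\<^sub>R jump D F (u s) x) t)
               (avg D F (v t)))
          + 1/2 * (LINT t|lebesgue_on (slab D n). L2_inner (surface_measure D F)
               (\<lambda>x. interpolant D n (\<lambda>s. gamma_F D F (w s) *\<^sub>R jump D F (u s) x) t)
               (jump D F (v t)))))"

definition rhs_form ::
  "'d::finite discretization \<Rightarrow> (real \<Rightarrow> real^'d \<Rightarrow> real^'d) \<Rightarrow> (real^'d \<Rightarrow> real^'d) \<Rightarrow>
     (real \<Rightarrow> real^'d \<Rightarrow> real^'d) \<Rightarrow> real"
where
  "rhs_form D f u0 z =
     (LINT t|lebesgue_on {0<..<final_time D}. L2_inner (vol D) (f t) (z t))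
     + L2_inner (vol D) u0 (right_lim z 0)"

definition A_h_norm :: "'d::finite discretization \<Rightarrow> (real^'d \<Rightarrow> real^'d) \<Rightarrow> real" where
  "A_h_norm D v = sqrt ((L2_norm (vol D) (broken_grad v))\<^sup>2
     + (\<Sum>F\<in>facets D. LINT x|surface_measure D F.
          penalty D / diameter F * (norm (jump D F v x))\<^sup>2))"

definition A_norm :: "'d::finite discretization \<Rightarrow> (real \<Rightarrow> real^'d \<Rightarrow> real^'d) \<Rightarrow> real" where
  "A_norm D v = sqrt (\<Sum>n=1..num_steps D. LINT t|lebesgue_on (slab D n). (A_h_norm D (v t))\<^sup>2)"

definition J_seminorm :: "'d::finite discretization \<Rightarrow> (real \<Rightarrow> real^'d \<Rightarrow> real^'d) \<Rightarrow> real" where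
  "J_seminorm D v = sqrt (1/2 * (
     (L2_norm (vol D) (left_lim v (final_time D)))\<^sup>2
     + (\<Sum>n=1..num_steps D - 1. (L2_norm (vol D) (time_jump D v n))\<^sup>2)
     + (L2_norm (vol D) (right_lim v 0))\<^sup>2))"

definition gamma_seminorm ::
  "'d::finite discretization \<Rightarrow> (real \<Rightarrow> real^'d \<Rightarrow> real^'d) \<Rightarrow> (real \<Rightarrow> real^'d \<Rightarrow> real^'d) \<Rightarrow> real"
where
  "gamma_seminorm D w v = sqrt (1/2 * (\<Sum>F\<in>interior_facets D.
     quadrature D (\<lambda>t. gamma_F D F (w t) * (L2_norm (surface_measure D F) (jump D F (v t)))\<^sup>2)))"

definition energy_norm ::
  "'d::finite discretization \<Rightarrow> real \<Rightarrow> (real \<Rightarrow> real^'d \<Rightarrow> real^'d) \<Rightarrow>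
     (real \<Rightarrow> real^'d \<Rightarrow> real^'d) \<Rightarrow> real"
where
  "energy_norm D \<nu> w v = sqrt (
     (Linf_norm (lebesgue_on {0<..<final_time D}) (\<lambda>t. L2_norm (vol D) (v t)))\<^sup>2
     + \<nu> * (A_norm D v)\<^sup>2 + (J_seminorm D v)\<^sup>2 + (gamma_seminorm D w v)\<^sup>2)"

text \<open>\<open>C\<close> is an admissible constant in the stability estimate for the linear problem with
  prescribed advection field \<open>w\<close>, uniformly in \<open>w\<close> and in the data.\<close>

definition linear_stability_constant :: "'d::finite discretization \<Rightarrow> real \<Rightarrow> real \<Rightarrow> bool" where
  "linear_stability_constant D \<nu> C \<longleftrightarrow> 0 < C \<and>
     (\<forall>w\<in>Z_ht D. \<forall>u\<in>Z_ht D.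
      \<forall>f\<in>L1L2_space (final_time D) (domain_of D). \<forall>u0\<in>Z_space (domain_of D).
        (\<forall>z\<in>Z_ht D. m_form D u z + \<nu> * a_form D u z + c_form D w u z = rhs_form D f u0 z) \<longrightarrow>
        (energy_norm D \<nu> w u)\<^sup>2 \<le>
          C * ((L1L2_norm (final_time D) (domain_of D) f)\<^sup>2 + (L2_norm (vol D) u0)\<^sup>2))"

end

theory Submission
  imports Defs "HOL-Library.Function_Algebras"
begin

text \<open>Proof idea. For a prescribed advection field the discrete problem is a square linear system on a
  finite-dimensional space. The assumed stability estimate with zero data makes it uniquely solvable, and
  with the given data it bounds the solution uniformly in the field. Since the form is continuous in the
  field, so is the solution, and Brouwer's theorem applied to \<open>a \<mapsto> solution with field tilde a\<close> on a cube
  of coordinates yields a solution of the semi-implicit problem; one more use of the stability estimate,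
  with the field frozen at this solution, gives the bound. No coercivity of the viscous form is needed, so
  that every penalty threshold works.\<close>

section \<open>Quasilinear systems in finitely many real variables\<close>

text \<open>The labour lies in the linearity and continuity of the forms. Integrals and limits are
  total operations here, so each additive law has to be earned by integrability or by an existing
  limit. Discrete fields are therefore reduced to finite sums of a continuous function of time times
  a bounded function of space (\<open>sep\<close>), for which both are at hand. Discrete functions
  are moreover arbitrary at time nodes and on the skeleton; linear relations, bases and coordinates
  are formulated away from these null sets, and no quotient space is formed. The form is nonlinear
  in the advection field only through \<open>gamma_F\<close>, the maximum of a constant and a
  supremum norm. This factor is not polynomial in time, but interpolation sees it only at the Radau
  nodes, where it is a number depending continuously on the coordinates. The stability estimate
  holds for every field in \<open>Z_ht\<close>, and \<open>tilde\<close> maps this space linearly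
  into itself; hence the coordinate bound does not depend on the field, and the cube can be fixed
  beforehand.\<close>

lemma bounded_coordinates_subseq:
  fixes x :: "nat \<Rightarrow> nat \<Rightarrow> real"
  assumes "\<And>i k. i < m \<Longrightarrow> \<bar>x k i\<bar> \<le> R"
  shows "\<exists>r l. strict_mono (r :: nat \<Rightarrow> nat) \<and> (\<forall>i<m. (\<lambda>k. x (r k) i) \<longlonglongrightarrow> l i)"
  using assms
proof (induction m)
  case 0
  then show ?case by (auto intro: exI[of _ id] simp: strict_mono_id)
next
  case (Suc m)
  then obtain r l where r: "strict_mono (r :: nat \<Rightarrow> nat)" "\<And>i. i < m \<Longrightarrow> (\<lambda>k. x (r k) i) \<longlonglongrightarrow> l i"
    by (metis less_Suc_eq)
  have "bounded (range (\<lambda>k. x (r k) m))"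
    using Suc.prems by (auto simp: bounded_iff)
  then obtain l' s where s: "strict_mono (s :: nat \<Rightarrow> nat)" "((\<lambda>k. x (r k) m) \<circ> s) \<longlonglongrightarrow> l'"
    using bounded_imp_convergent_subsequence by blast
  have "(\<lambda>k. x ((r \<circ> s) k) i) \<longlonglongrightarrow> (l(m := l')) i" if "i < Suc m" for i
  proof (cases "i = m")
    case True
    then show ?thesis using s by (simp add: o_def)
  next
    case False
    then have "((\<lambda>k. x (r k) i) \<circ> s) \<longlonglongrightarrow> l i"
      using that r s by (intro LIMSEQ_subseq_LIMSEQ) auto
    then show ?thesis using False by (simp add: o_def)
  qed
  then show ?case
    using strict_mono_o[OF r(1) s(1)] by blast
qed

text \<open>Brouwer's theorem on a cube whose dimension is a natural number rather than a type; the
  combinatorial core is the library's Kuhn lemma.\<close>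

lemma brouwer_nat_cube:
  fixes f :: "(nat \<Rightarrow> real) \<Rightarrow> nat \<Rightarrow> real"
  assumes bd: "\<And>x i. i < m \<Longrightarrow> 0 \<le> f x i \<and> f x i \<le> 1"
    and cont: "\<And>x l i. \<lbrakk>\<And>j. j < m \<Longrightarrow> (\<lambda>k. x k j) \<longlonglongrightarrow> l j; i < m\<rbrakk> \<Longrightarrow> (\<lambda>k. f (x k) i) \<longlonglongrightarrow> f l i"
  shows "\<exists>x. \<forall>i<m. f x i = x i"
proof -
  \<comment> \<open>Grid points of mesh width \<open>1 / p\<close>: the vertices in Kuhn's lemma are
    integer vectors with entries up to \<open>p\<close>.\<close>
  define pt where "pt p q i = real (q i) / real p" for p :: nat and q :: "nat \<Rightarrow> nat" and i
  \<comment> \<open>Label 0 means that \<open>f\<close> does not decrease the i-th coordinate. The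
    clause \<open>q i \<noteq> p\<close> forces label 1 on the upper face; on the lower face label 0
    is automatic because \<open>f\<close> is nonnegative.\<close>
  define label where "label p q i = (if pt p q i \<le> f (pt p q) i \<and> q i \<noteq> p then 0 else 1 :: nat)"
    for p q i
  have "\<exists>q. (\<forall>i<m. q i < p) \<and> (\<forall>i<m. \<exists>r s. (\<forall>j<m. q j \<le> r j \<and> r j \<le> q j + 1) \<and>
      (\<forall>j<m. q j \<le> s j \<and> s j \<le> q j + 1) \<and> label p r i \<noteq> label p s i)" if "0 < p" for p
  proof -
    have 1: "\<forall>x. (\<forall>i<m. x i \<le> p) \<longrightarrow> (\<forall>i<m. label p x i = 0 \<or> label p x i = 1)"
      by (auto simp: label_def)
    have 2: "\<forall>x. (\<forall>i<m. x i \<le> p) \<longrightarrow> (\<forall>i<m. x i = 0 \<longrightarrow> label p x i = 0)"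
      using bd that by (auto simp: label_def pt_def)
    have 3: "\<forall>x. (\<forall>i<m. x i \<le> p) \<longrightarrow> (\<forall>i<m. x i = p \<longrightarrow> label p x i = 1)"
      by (auto simp: label_def)
    show ?thesis
      by (rule kuhn_lemma[OF that 1 2 3]) blast
  qed
  \<comment> \<open>\<open>Suc p\<close> keeps the number of subdivisions positive for every index
    of the sequence.\<close>
  then have "\<forall>p. \<exists>q. (\<forall>i<m. q i < Suc p) \<and> (\<forall>i<m. \<exists>r s. (\<forall>j<m. q j \<le> r j \<and> r j \<le> q j + 1) \<and>
      (\<forall>j<m. q j \<le> s j \<and> s j \<le> q j + 1) \<and> label (Suc p) r i \<noteq> label (Suc p) s i)"
    by blast
  from choice[OF this] obtain q where q: "\<And>p i. i < m \<Longrightarrow> q p i < Suc p"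
    and ex: "\<And>p i. i < m \<Longrightarrow> \<exists>r s. (\<forall>j<m. q p j \<le> r j \<and> r j \<le> q p j + 1) \<and>
      (\<forall>j<m. q p j \<le> s j \<and> s j \<le> q p j + 1) \<and> label (Suc p) r i \<noteq> label (Suc p) s i"
    by blast
  have "\<exists>r s. (\<forall>j<m. q p j \<le> r j \<and> r j \<le> q p j + 1) \<and>
      (\<forall>j<m. q p j \<le> s j \<and> s j \<le> q p j + 1) \<and> label (Suc p) r i = 0 \<and> label (Suc p) s i = 1"
    if i: "i < m" for p i
  proof -
    obtain r s where rs: "\<forall>j<m. q p j \<le> r j \<and> r j \<le> q p j + 1"
      "\<forall>j<m. q p j \<le> s j \<and> s j \<le> q p j + 1" "label (Suc p) r i \<noteq> label (Suc p) s i"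
      using ex[OF i] by blast
    then consider "label (Suc p) r i = 0" "label (Suc p) s i = 1"
      | "label (Suc p) s i = 0" "label (Suc p) r i = 1"
      unfolding label_def by (auto split: if_splits)
    then show ?thesis using rs by cases blast+
  qed
  then have "\<forall>p i. \<exists>r s. i < m \<longrightarrow> (\<forall>j<m. q p j \<le> r j \<and> r j \<le> q p j + 1) \<and>
      (\<forall>j<m. q p j \<le> s j \<and> s j \<le> q p j + 1) \<and> label (Suc p) r i = 0 \<and> label (Suc p) s i = 1"
    by blast
  then obtain r s where r: "\<And>p i j. \<lbrakk>i < m; j < m\<rbrakk> \<Longrightarrow> q p j \<le> r p i j \<and> r p i j \<le> q p j + 1"
    and s: "\<And>p i j. \<lbrakk>i < m; j < m\<rbrakk> \<Longrightarrow> q p j \<le> s p i j \<and> s p i j \<le> q p j + 1"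
    and lr: "\<And>p i. i < m \<Longrightarrow> label (Suc p) (r p i) i = 0" and ls: "\<And>p i. i < m \<Longrightarrow> label (Suc p) (s p i) i = 1"
    unfolding choice_iff by blast
  have "\<bar>pt (Suc k) (q k) i\<bar> \<le> 1" if "i < m" for i k
    using q[OF that, of k] by (simp add: pt_def)
  then obtain \<phi> l where \<phi>: "strict_mono (\<phi> :: nat \<Rightarrow> nat)"
    and l: "\<And>i. i < m \<Longrightarrow> (\<lambda>k. pt (Suc (\<phi> k)) (q (\<phi> k)) i) \<longlonglongrightarrow> l i"
    using bounded_coordinates_subseq[of m "\<lambda>k. pt (Suc k) (q k)" 1] by blast
  have inv: "(\<lambda>k. 1 / real (Suc (\<phi> k))) \<longlonglongrightarrow> 0"
    using LIMSEQ_subseq_LIMSEQ[OF LIMSEQ_inverse_real_of_nat \<phi>] by (simp add: o_def inverse_eq_divide)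
  \<comment> \<open>All vertices of the cell found by Kuhn's lemma lie within one mesh width of its
    lower corner, hence share its limit.\<close>
  have near: "(\<lambda>k. pt (Suc (\<phi> k)) (v (\<phi> k)) j) \<longlonglongrightarrow> l j"
    if "\<And>p. q p j \<le> v p j \<and> v p j \<le> q p j + 1" "j < m" for v j
  proof (rule tendsto_sandwich[OF _ _ l[OF that(2)]])
    show "(\<lambda>k. pt (Suc (\<phi> k)) (q (\<phi> k)) j + 1 / real (Suc (\<phi> k))) \<longlonglongrightarrow> l j"
      using tendsto_add[OF l[OF that(2)] inv] by simp
    show "\<forall>\<^sub>F k in sequentially. pt (Suc (\<phi> k)) (q (\<phi> k)) j \<le> pt (Suc (\<phi> k)) (v (\<phi> k)) j"
      using that(1) by (auto simp: pt_def divide_right_mono)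
    have "pt (Suc p) (v p) j \<le> pt (Suc p) (q p) j + 1 / real (Suc p)" for p
      using that(1)[of p] unfolding pt_def add_divide_distrib[symmetric]
      by (intro divide_right_mono) linarith+
    then show "\<forall>\<^sub>F k in sequentially. pt (Suc (\<phi> k)) (v (\<phi> k)) j \<le>
        pt (Suc (\<phi> k)) (q (\<phi> k)) j + 1 / real (Suc (\<phi> k))"
      by auto
  qed
  \<comment> \<open>In the limit the vertices with label 0 give \<open>l i \<le> f l i\<close>, and
    those with label 1 the reverse inequality.\<close>
  have "f l i = l i" if i: "i < m" for i
  proof (rule antisym)
    have "(\<lambda>k. f (pt (Suc (\<phi> k)) (r (\<phi> k) i)) i) \<longlonglongrightarrow> f l i"
      using near[of _ "\<lambda>p. r p i"] r i by (intro cont) auto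
    moreover have "(\<lambda>k. pt (Suc (\<phi> k)) (r (\<phi> k) i) i) \<longlonglongrightarrow> l i"
      using near[of _ "\<lambda>p. r p i"] r i by auto
    moreover have "pt (Suc (\<phi> k)) (r (\<phi> k) i) i \<le> f (pt (Suc (\<phi> k)) (r (\<phi> k) i)) i" for k
      using lr[OF i, of "\<phi> k"] by (auto simp: label_def split: if_splits)
    ultimately show "l i \<le> f l i"
      by (meson LIMSEQ_le)
    have "(\<lambda>k. f (pt (Suc (\<phi> k)) (s (\<phi> k) i)) i) \<longlonglongrightarrow> f l i"
      using near[of _ "\<lambda>p. s p i"] s i by (intro cont) auto
    moreover have "(\<lambda>k. pt (Suc (\<phi> k)) (s (\<phi> k) i) i) \<longlonglongrightarrow> l i"
      using near[of _ "\<lambda>p. s p i"] s i by auto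
    moreover have "f (pt (Suc (\<phi> k)) (s (\<phi> k) i)) i \<le> pt (Suc (\<phi> k)) (s (\<phi> k) i) i" for k
    \<comment> \<open>Label 1 has two causes: on the upper face the coordinate is 1, which bounds
      \<open>f\<close>; elsewhere \<open>f\<close> strictly decreases the coordinate.\<close>
    proof (cases "s (\<phi> k) i i = Suc (\<phi> k)")
      case True
      then show ?thesis using bd[OF i] by (simp add: pt_def del: of_nat_Suc)
    next
      case False
      then show ?thesis
        using ls[OF i, of "\<phi> k"] by (auto simp: label_def split: if_splits)
    qed
    ultimately show "f l i \<le> l i"
      by (meson LIMSEQ_le)
  qed
  then show ?thesis by blast
qed

section \<open>Linear algebra in spaces of functions\<close>

text \<open>Functions become a vector space through the locale \<open>vector_space\<close>, on top
  of pointwise addition. Span, independence and the exchange bound then serve both for columns of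
  numbers and for space-time fields.\<close>

definition fun_scale :: "real \<Rightarrow> ('a \<Rightarrow> 'b::real_vector) \<Rightarrow> 'a \<Rightarrow> 'b" where
  "fun_scale r f x = r *\<^sub>R f x"

interpretation fun_space: vector_space "fun_scale :: real \<Rightarrow> ('a \<Rightarrow> 'b::real_vector) \<Rightarrow> 'a \<Rightarrow> 'b"
  by standard (auto simp: fun_scale_def fun_eq_iff algebra_simps)

lemma sum_fun_apply: "(\<Sum>i\<in>A. f i) x = (\<Sum>i\<in>A. f i x :: 'b::ab_group_add)"
  by (induction A rule: infinite_finite_induct) auto

lemma sum_fun_scale_apply:
  "(\<Sum>p\<in>A. fun_scale (c p) (b p)) x = (\<Sum>p\<in>A. c p *\<^sub>R b p x)"
  by (simp add: sum_fun_apply fun_scale_def)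

text \<open>Dimension count: injectivity makes the \<open>m\<close> columns independent. A
  right-hand side outside their span would give \<open>m + 1\<close> independent vectors in the span
  of \<open>m\<close> unit vectors.\<close>

lemma inj_linear_system_solvable:
  fixes M :: "nat \<Rightarrow> nat \<Rightarrow> real" and F :: "nat \<Rightarrow> real"
  assumes inj: "\<And>x. (\<And>p. p < m \<Longrightarrow> (\<Sum>q<m. M p q * x q) = 0) \<Longrightarrow> (\<And>q. q < m \<Longrightarrow> x q = 0)"
  shows "\<exists>x. \<forall>p<m. (\<Sum>q<m. M p q * x q) = F p"
proof -
  \<comment> \<open>Vectors with \<open>m\<close> entries are functions on \<open>nat\<close> padded
    by zero, so that they lie in the span of the unit vectors \<open>e\<close>.\<close>
  define col where "col q = (\<lambda>p. if p < m then M p q else 0)" for q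
  define e where "e q = (\<lambda>p. if p = q then 1 else 0 :: real)" for q :: nat
  define F' where "F' = (\<lambda>p. if p < m then F p else 0)"
  have ind: "x q = 0" if "(\<Sum>q<m. fun_scale (x q) (col q)) = 0" "q < m" for x q
  proof (rule inj[OF _ that(2)])
    fix p assume "p < m"
    then show "(\<Sum>q<m. M p q * x q) = 0"
      using fun_cong[OF that(1), of p] by (simp add: sum_fun_scale_apply col_def mult.commute)
  qed
  \<comment> \<open>Independence is a property of the set of columns, so coincidences are excluded
    separately: two equal columns would give a kernel vector with entries 1 and -1.\<close>
  have "inj_on col {..<m}"
  proof (rule inj_onI, rule ccontr)
    fix a b assume ab: "a \<in> {..<m}" "b \<in> {..<m}" "col a = col b" "a \<noteq> b"
    define x where "x = (\<lambda>q. if q = a then 1 else if q = b then -1 else 0 :: real)"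
    have "(\<Sum>q<m. fun_scale (x q) (col q)) = (\<Sum>q\<in>{a,b}. fun_scale (x q) (col q))"
      using ab by (intro sum.mono_neutral_right) (auto simp: x_def fun_scale_def fun_eq_iff)
    also have "\<dots> = 0"
      using ab by (auto simp: x_def fun_scale_def fun_eq_iff)
    finally have "x a = 0" using ab by (intro ind) auto
    then show False by (simp add: x_def)
  qed
  have "fun_space.independent (col ` {..<m})"
  proof (rule fun_space.independent_if_scalars_zero)
    fix g v assume g: "(\<Sum>x\<in>col ` {..<m}. fun_scale (g x) x) = 0" and "v \<in> col ` {..<m}"
    then obtain q where q: "v = col q" "q < m" by auto
    have "(\<Sum>q<m. fun_scale (g (col q)) (col q)) = 0"
      using g \<open>inj_on col {..<m}\<close> by (simp add: sum.reindex)
    from ind[OF this q(2)] show "g v = 0" using q by simp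
  qed auto
  have in_span: "v \<in> fun_space.span (e ` {..<m})" if "\<And>p. p \<ge> m \<Longrightarrow> v p = 0" for v
  proof -
    have "v = (\<Sum>q<m. fun_scale (v q) (e q))"
    proof
      fix p
      have "(\<Sum>q<m. v q *\<^sub>R e q p) = (\<Sum>q<m. if p = q then v q else 0)"
        by (intro sum.cong) (auto simp: e_def)
      then show "v p = (\<Sum>q<m. fun_scale (v q) (e q)) p"
        using that[of p] by (auto simp: sum_fun_scale_apply)
    qed
    also have "\<dots> \<in> fun_space.span (e ` {..<m})"
      by (intro fun_space.span_sum fun_space.span_scale fun_space.span_base) auto
    finally show ?thesis .
  qed
  have "F' \<in> fun_space.span (col ` {..<m})"
  proof (rule ccontr)
    assume *: "F' \<notin> fun_space.span (col ` {..<m})"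
    have F': "F' \<notin> col ` {..<m}"
    proof
      assume "F' \<in> col ` {..<m}"
      from fun_space.span_base[OF this] * show False by simp
    qed
    have "fun_space.independent (insert F' (col ` {..<m}))"
      by (rule fun_space.independent_insertI[OF * \<open>fun_space.independent (col ` {..<m})\<close>])
    moreover have "insert F' (col ` {..<m}) \<subseteq> fun_space.span (e ` {..<m})"
    proof
      fix v assume "v \<in> insert F' (col ` {..<m})"
      then have "v p = 0" if "p \<ge> m" for p using that by (auto simp: F'_def col_def)
      then show "v \<in> fun_space.span (e ` {..<m})" by (rule in_span)
    qed
    ultimately have "card (insert F' (col ` {..<m})) \<le> card (e ` {..<m})"
      using fun_space.independent_span_bound[of "e ` {..<m}"] by simp
    also have "\<dots> \<le> m" using card_image_le[of "{..<m}" e] by simp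
    finally have "card (insert F' (col ` {..<m})) \<le> m" .
    with F' show False
      using \<open>inj_on col {..<m}\<close> by (simp add: card_image)
  qed
  then obtain g where g: "F' = (\<Sum>v\<in>col ` {..<m}. fun_scale (g v) v)"
    unfolding fun_space.span_finite[OF finite_imageI[OF finite_lessThan]] by auto
  have "(\<Sum>q<m. M p q * g (col q)) = F p" if "p < m" for p
  proof -
    have "F p = (\<Sum>v\<in>col ` {..<m}. g v *\<^sub>R v p)"
      using fun_cong[OF g, of p] that by (simp add: sum_fun_scale_apply F'_def)
    also have "\<dots> = (\<Sum>q<m. g (col q) *\<^sub>R col q p)"
      using \<open>inj_on col {..<m}\<close> by (simp add: sum.reindex)
    also have "\<dots> = (\<Sum>q<m. M p q * g (col q))"
      using that by (simp add: col_def mult.commute)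
    finally show ?thesis ..
  qed
  then show ?thesis
    by (auto intro: exI[of _ "\<lambda>q. g (col q)"])
qed

text \<open>The solution of the system frozen at \<open>a\<close> depends continuously on \<open>a\<close> because its graph is
  closed and its range is bounded; a fixed point solves the quasilinear system.\<close>

lemma quasilinear_system_solvable:
  fixes M :: "(nat \<Rightarrow> real) \<Rightarrow> nat \<Rightarrow> nat \<Rightarrow> real" and F :: "nat \<Rightarrow> real"
  assumes inj: "\<And>a x q. \<lbrakk>\<And>p. p < m \<Longrightarrow> (\<Sum>q<m. M a p q * x q) = 0; q < m\<rbrakk> \<Longrightarrow> x q = 0"
    and bd: "\<And>a x q. \<lbrakk>\<And>p. p < m \<Longrightarrow> (\<Sum>q<m. M a p q * x q) = F p; q < m\<rbrakk> \<Longrightarrow> \<bar>x q\<bar> \<le> R"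
    and cont: "\<And>a l p q. \<lbrakk>\<And>j. j < m \<Longrightarrow> (\<lambda>k. a k j) \<longlonglongrightarrow> l j; p < m; q < m\<rbrakk>
      \<Longrightarrow> (\<lambda>k. M (a k) p q) \<longlonglongrightarrow> M l p q"
  shows "\<exists>a. \<forall>p<m. (\<Sum>q<m. M a p q * a q) = F p"
proof -
  \<comment> \<open>The added 1 makes the half-width of the cube positive, so that the rescaling may
    divide by it.\<close>
  define R' where "R' = \<bar>R\<bar> + 1"
  have "R' > 0" by (simp add: R'_def)
  have "\<forall>a. \<exists>x. \<forall>p<m. (\<Sum>q<m. M a p q * x q) = F p"
  proof
    fix a show "\<exists>x. \<forall>p<m. (\<Sum>q<m. M a p q * x q) = F p"
      by (rule inj_linear_system_solvable) (rule inj[of a])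
  qed
  then obtain S where S: "\<And>a p. p < m \<Longrightarrow> (\<Sum>q<m. M a p q * S a q) = F p"
    unfolding choice_iff by blast
  have S_bd: "\<bar>S a q\<bar> \<le> R'" if "q < m" for a q
    using bd[of a "S a" q] S[of _ a] that by (fastforce simp: R'_def)
  have uniq: "x q = S a q" if "\<And>p. p < m \<Longrightarrow> (\<Sum>q<m. M a p q * x q) = F p" "q < m" for a x q
  proof -
    have "(\<Sum>q<m. M a p q * (x q - S a q)) = 0" if "p < m" for p
      using that \<open>\<And>p. p < m \<Longrightarrow> (\<Sum>q<m. M a p q * x q) = F p\<close>[of p] S[of p a]
      by (simp only: right_diff_distrib sum_subtractf)
    from inj[OF this that(2)] show ?thesis by simp
  qed
  have S_cont: "(\<lambda>k. S (a k) i) \<longlonglongrightarrow> S l i"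
    if a: "\<And>j. j < m \<Longrightarrow> (\<lambda>k. a k j) \<longlonglongrightarrow> l j" and i: "i < m" for a l i
  proof (rule ccontr)
    assume "\<not> ?thesis"
    then obtain e where e: "e > 0" "\<exists>\<^sub>F k in sequentially. e \<le> \<bar>S (a k) i - S l i\<bar>"
      unfolding tendsto_iff not_eventually[symmetric] dist_real_def
      by (auto simp: not_le frequently_def)
    then have inf: "infinite {k. e \<le> \<bar>S (a k) i - S l i\<bar>}"
      by (simp add: frequently_cofinite[symmetric] cofinite_eq_sequentially)
    define r where "r = enumerate {k. e \<le> \<bar>S (a k) i - S l i\<bar>}"
    have r: "strict_mono r" "\<And>k. e \<le> \<bar>S (a (r k)) i - S l i\<bar>"
      using strict_mono_enumerate[OF inf] enumerate_in_set[OF inf] by (auto simp: r_def)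
    obtain s x where s: "strict_mono (s :: nat \<Rightarrow> nat)"
      and x: "\<And>j. j < m \<Longrightarrow> (\<lambda>k. S (a (r (s k))) j) \<longlonglongrightarrow> x j"
      using bounded_coordinates_subseq[of m "\<lambda>k. S (a (r k))" R'] S_bd by blast
    have ars: "(\<lambda>k. a (r (s k)) j) \<longlonglongrightarrow> l j" if "j < m" for j
      using LIMSEQ_subseq_LIMSEQ[OF a[OF that] strict_mono_o[OF r(1) s]] by (simp add: o_def)
    have "(\<Sum>q<m. M l p q * x q) = F p" if "p < m" for p
    proof (rule LIMSEQ_unique)
      show "(\<lambda>k. \<Sum>q<m. M (a (r (s k))) p q * S (a (r (s k))) q) \<longlonglongrightarrow> (\<Sum>q<m. M l p q * x q)"
        using ars x that by (intro tendsto_sum tendsto_mult cont[of "\<lambda>k. a (r (s k))"]) auto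
      show "(\<lambda>k. \<Sum>q<m. M (a (r (s k))) p q * S (a (r (s k))) q) \<longlonglongrightarrow> F p"
        using S[OF that] by simp
    qed
    from uniq[OF this i] have "(\<lambda>k. S (a (r (s k))) i) \<longlonglongrightarrow> S l i"
      using x[OF i] by simp
    then have "(\<lambda>k. \<bar>S (a (r (s k))) i - S l i\<bar>) \<longlonglongrightarrow> 0"
      by (simp add: LIM_zero tendsto_rabs_zero)
    then have "e \<le> 0"
      using r(2) by (intro LIMSEQ_le_const) auto
    then show False using e by simp
  qed
  \<comment> \<open>Affine map from the unit cube to the cube of half-width \<open>R'\<close>; the
    map handed to Brouwer's theorem is \<open>S\<close> conjugated by it.\<close>
  define T where "T y = (\<lambda>i. R' * (2 * y i - 1))" for y :: "nat \<Rightarrow> real"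
  have "\<exists>y. \<forall>i<m. (S (T y) i / R' + 1) / 2 = y i"
  proof (rule brouwer_nat_cube)
    fix y :: "nat \<Rightarrow> real" and i assume "i < m"
    with S_bd[OF this, of "T y"] \<open>R' > 0\<close>
    have "- 1 \<le> S (T y) i / R' \<and> S (T y) i / R' \<le> 1"
      by (auto simp: divide_simps)
    then show "0 \<le> (S (T y) i / R' + 1) / 2 \<and> (S (T y) i / R' + 1) / 2 \<le> 1"
      by auto
  next
    fix y :: "nat \<Rightarrow> nat \<Rightarrow> real" and l and i :: nat
    assume *: "\<And>j. j < m \<Longrightarrow> (\<lambda>k. y k j) \<longlonglongrightarrow> l j" "i < m"
    have "(\<lambda>k. S (T (y k)) i) \<longlonglongrightarrow> S (T l) i"
      using * by (intro S_cont) (auto simp: T_def intro!: tendsto_intros)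
    then show "(\<lambda>k. (S (T (y k)) i / R' + 1) / 2) \<longlonglongrightarrow> (S (T l) i / R' + 1) / 2"
      by (intro tendsto_intros) (use \<open>R' > 0\<close> in auto)
  qed
  then obtain y where y: "\<And>i. i < m \<Longrightarrow> (S (T y) i / R' + 1) / 2 = y i"
    by blast
  have "S (T y) i = T y i" if "i < m" for i
    using y[OF that] \<open>R' > 0\<close> by (simp add: T_def field_simps)
  then have "(\<Sum>q<m. M (T y) p q * T y q) = F p" if "p < m" for p
    using S[OF that, of "T y"] by simp
  then show ?thesis by blast
qed

text \<open>Compactness of the unit sphere for the maximum norm: a normalized sequence with values
  at most \<open>1 / (k + 1)\<close> would have a nonzero limit on which \<open>N\<close> vanishes.
  Applied to a Gram matrix, it turns a bound on the space-time L2 norm into bounds on the single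
  coordinates.\<close>

lemma quadratic_form_coercive:
  fixes G :: "nat \<Rightarrow> nat \<Rightarrow> real" and m :: nat
  defines "N \<equiv> \<lambda>x. \<Sum>p<m. \<Sum>q<m. x p * x q * G p q"
  assumes nonneg: "\<And>x. 0 \<le> N x" and pd: "\<And>x q. \<lbrakk>N x = 0; q < m\<rbrakk> \<Longrightarrow> x q = 0"
  shows "\<exists>c>0. \<forall>x. \<forall>q<m. c * (x q)\<^sup>2 \<le> N x"
proof (rule ccontr)
  assume *: "\<not> ?thesis"
  have N_scale: "N (\<lambda>p. r * x p) = r\<^sup>2 * N x" for r x
    by (simp add: N_def sum_distrib_left power2_eq_square mult_ac)
  have "\<exists>x. (\<forall>i<m. \<bar>x i\<bar> \<le> 1) \<and> (\<exists>i<m. \<bar>x i\<bar> = 1) \<and> N x \<le> 1 / real (Suc k)" for k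
  proof -
    have "\<not> (\<forall>x. \<forall>q<m. 1 / real (Suc k) * (x q)\<^sup>2 \<le> N x)"
    proof
      assume "\<forall>x. \<forall>q<m. 1 / real (Suc k) * (x q)\<^sup>2 \<le> N x"
      moreover have "0 < 1 / real (Suc k)" by simp
      ultimately show False using * by blast
    qed
    then obtain x q where q: "q < m" and x: "\<not> 1 / real (Suc k) * (x q)\<^sup>2 \<le> N x"
      by blast
    \<comment> \<open>Dividing by the largest modulus puts the counterexample on the unit sphere;
      homogeneity of degree two preserves the bound.\<close>
    define B where "B = Max ((\<lambda>i. \<bar>x i\<bar>) ` {..<m})"
    have B: "\<bar>x i\<bar> \<le> B" if "i < m" for i
      using that by (auto simp: B_def)
    have "B \<in> (\<lambda>i. \<bar>x i\<bar>) ` {..<m}"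
      unfolding B_def using q by (intro Max_in) auto
    then obtain j where j: "j < m" "\<bar>x j\<bar> = B" by auto
    have "x q \<noteq> 0" using x nonneg[of x] by auto
    then have "B > 0" using B[OF q] by linarith
    have "N x \<le> (1 / real (Suc k)) * (x q)\<^sup>2" using x by linarith
    also have "\<dots> \<le> (1 / real (Suc k)) * B\<^sup>2"
      using B[OF q] by (intro mult_left_mono) (auto simp: abs_le_square_iff[symmetric])
    finally have "(1 / B)\<^sup>2 * N x \<le> (1 / B)\<^sup>2 * ((1 / real (Suc k)) * B\<^sup>2)"
      by (rule mult_left_mono) simp
    also have "\<dots> = 1 / real (Suc k)"
      using \<open>B > 0\<close> by (simp add: power_divide)
    finally have "N (\<lambda>p. (1 / B) * x p) \<le> 1 / real (Suc k)"
      unfolding N_scale .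
    moreover have "\<forall>i<m. \<bar>(1 / B) * x i\<bar> \<le> 1" "\<bar>(1 / B) * x j\<bar> = 1"
      using B j \<open>B > 0\<close> by (auto simp: abs_mult)
    ultimately show ?thesis
      using j(1) by (intro exI[of _ "\<lambda>p. (1 / B) * x p"] conjI exI[of _ j])
  qed
  then have "\<forall>k. \<exists>x. (\<forall>i<m. \<bar>x i\<bar> \<le> 1) \<and> (\<exists>i<m. \<bar>x i\<bar> = 1) \<and> N x \<le> 1 / real (Suc k)"
    by blast
  from choice[OF this] obtain x where x: "\<And>k i. i < m \<Longrightarrow> \<bar>x k i\<bar> \<le> 1" "\<And>k. \<exists>i<m. \<bar>x k i\<bar> = 1"
    "\<And>k. N (x k) \<le> 1 / real (Suc k)"
    by blast
  obtain r l where r: "strict_mono (r :: nat \<Rightarrow> nat)" and l: "\<And>i. i < m \<Longrightarrow> (\<lambda>k. x (r k) i) \<longlonglongrightarrow> l i"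
    using bounded_coordinates_subseq[of m x 1] x(1) by blast
  have "(\<lambda>k. N (x (r k))) \<longlonglongrightarrow> N l"
    unfolding N_def by (intro tendsto_intros l) auto
  moreover have "(\<lambda>k. 1 / real (Suc (r k))) \<longlonglongrightarrow> 0"
    using LIMSEQ_subseq_LIMSEQ[OF LIMSEQ_inverse_real_of_nat r] by (simp add: o_def inverse_eq_divide)
  ultimately have "N l \<le> 0"
    using x(3) by (meson LIMSEQ_le)
  then have "N l = 0" using nonneg[of l] by simp
  \<comment> \<open>The position of the entry of modulus one may vary with \<open>k\<close>. The sum
    of the moduli is at least one for every \<open>k\<close> and passes to the limit.\<close>
  have lim: "(\<lambda>k. \<Sum>i<m. \<bar>x (r k) i\<bar>) \<longlonglongrightarrow> (\<Sum>i<m. \<bar>l i\<bar>)"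
    by (intro tendsto_intros l) auto
  have "1 \<le> (\<Sum>i<m. \<bar>x (r k) i\<bar>)" for k
  proof -
    obtain i where i: "i < m" "\<bar>x (r k) i\<bar> = 1" using x(2) by blast
    have "\<bar>x (r k) i\<bar> \<le> (\<Sum>i<m. \<bar>x (r k) i\<bar>)"
      using i by (intro member_le_sum) auto
    then show ?thesis using i by simp
  qed
  then have "1 \<le> (\<Sum>i<m. \<bar>l i\<bar>)"
    by (intro LIMSEQ_le_const[OF lim]) auto
  moreover have "(\<Sum>i<m. \<bar>l i\<bar>) = 0"
    using pd[OF \<open>N l = 0\<close>] by simp
  ultimately show False by simp
qed

section \<open>Essential suprema\<close>

text \<open>\<open>real_of_ereal\<close> sends both infinities to 0, so the degenerate cases are
  harmless: the essential supremum is minus infinity for a measurable function and a null measure,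
  and otherwise it is nonnegative.\<close>

lemma Linf_norm_nonneg: "0 \<le> Linf_norm M v"
proof (cases "emeasure M (space M) = 0 \<and> (\<lambda>x. ereal (norm (v x))) \<in> borel_measurable M")
  case True
  then show ?thesis by (simp add: Linf_norm_def esssup_zero_space)
next
  case False
  have "0 \<le> esssup M (\<lambda>x. ereal (norm (v x)))"
  proof (cases "emeasure M (space M) = 0")
    case True
    with False show ?thesis by (simp add: esssup_non_measurable)
  next
    case False
    have "0 = esssup M (\<lambda>x. 0::ereal)" using esssup_const[OF False] by metis
    also have "\<dots> \<le> esssup M (\<lambda>x. ereal (norm (v x)))" by (intro esssup_mono) auto
    finally show ?thesis .
  qed
  then show ?thesis by (simp add: Linf_norm_def real_of_ereal_pos)
qed

text \<open>The a priori bound \<open>B\<close> rules out an infinite essential supremum, which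
  \<open>real_of_ereal\<close> would turn into 0.\<close>

lemma Linf_norm_AE:
  fixes v :: "'a \<Rightarrow> 'b::euclidean_space"
  assumes [measurable]: "v \<in> borel_measurable M" and B: "AE x in M. norm (v x) \<le> B"
  shows "AE x in M. norm (v x) \<le> Linf_norm M v"
proof -
  define E where "E = esssup M (\<lambda>x. ereal (norm (v x)))"
  have "E \<le> ereal B"
    unfolding E_def using B by (intro esssup_I) auto
  then have "E \<noteq> \<infinity>" by auto
  have "AE x in M. ereal (norm (v x)) \<le> E" unfolding E_def by (rule esssup_AE)
  then show ?thesis
  proof eventually_elim
    case (elim x)
    with \<open>E \<noteq> \<infinity>\<close> show ?case
      unfolding Linf_norm_def E_def[symmetric] by (cases E) auto
  qed
qed

lemma Linf_norm_le:
  fixes v :: "'a \<Rightarrow> 'b::euclidean_space"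
  assumes [measurable]: "v \<in> borel_measurable M" and B: "AE x in M. norm (v x) \<le> B" "0 \<le> B"
  shows "Linf_norm M v \<le> B"
proof -
  have "esssup M (\<lambda>x. ereal (norm (v x))) \<le> ereal B"
    using B by (intro esssup_I) auto
  then show ?thesis
    unfolding Linf_norm_def using B(2)
    by (cases "esssup M (\<lambda>x. ereal (norm (v x)))") auto
qed

lemma Linf_norm_lipschitz:
  fixes v w :: "'a \<Rightarrow> 'b::euclidean_space"
  assumes [measurable]: "v \<in> borel_measurable M" "w \<in> borel_measurable M"
    and B: "AE x in M. norm (w x) \<le> B" and e: "AE x in M. norm (v x - w x) \<le> e" "0 \<le> e"
  shows "Linf_norm M v \<le> Linf_norm M w + e"
proof (rule Linf_norm_le)
  show "AE x in M. norm (v x) \<le> Linf_norm M w + e"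
    using Linf_norm_AE[OF assms(2) B] e(1)
  proof eventually_elim
    case (elim x)
    then show ?case using norm_triangle_ineq2[of "v x" "w x"] by linarith
  qed
  show "0 \<le> Linf_norm M w + e" using Linf_norm_nonneg[of M w] e(2) by simp
qed auto

section \<open>Bounded measurable functions away from an exceptional set\<close>

text \<open>The exceptional set \<open>space M - G\<close> carries no information. Demanding that all its subsets be
  measurable covers a complete measure with a null exceptional set as well as an incomplete
  measure with \<open>G = space M\<close>.\<close>

definition good_set :: "'a measure \<Rightarrow> 'a set \<Rightarrow> bool" where
  "good_set M G \<longleftrightarrow> finite_measure M \<and> G \<subseteq> space M \<and> (\<forall>A\<subseteq>space M - G. A \<in> null_sets M)"

text \<open>Outside \<open>G\<close> only measurability is required, since no bound is known there:
  on the skeleton a broken gradient is whatever \<open>jacobian\<close> returns.\<close>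

definition bdd_meas :: "'a measure \<Rightarrow> 'a set \<Rightarrow> ('a \<Rightarrow> 'b::euclidean_space) \<Rightarrow> bool" where
  "bdd_meas M G c \<longleftrightarrow> c \<in> borel_measurable M \<and> bounded (c ` G)"

lemma good_set_AE: "good_set M G \<Longrightarrow> (\<And>x. x \<in> G \<Longrightarrow> P x) \<Longrightarrow> AE x in M. P x"
  unfolding good_set_def by (rule AE_I'[of "space M - G"]) auto

lemma good_set_sets: "good_set M G \<Longrightarrow> G \<in> sets M"
proof -
  assume "good_set M G"
  then have "space M - G \<in> sets M" "G \<subseteq> space M" by (auto simp: good_set_def null_sets_def)
  then have "space M - (space M - G) \<in> sets M" by auto
  then show ?thesis using \<open>G \<subseteq> space M\<close> by (simp add: double_diff)
qed

text \<open>Preimages under \<open>f\<close> and \<open>g\<close> differ inside the exceptional set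
  only, and all its subsets are measurable.\<close>

lemma good_set_measurable_cong:
  assumes G: "good_set M G" and f: "f \<in> measurable M N" and g: "g \<in> space M \<rightarrow> space N"
    and eq: "\<And>x. x \<in> G \<Longrightarrow> f x = g x"
  shows "g \<in> measurable M N"
proof (rule measurableI)
  fix A assume A: "A \<in> sets N"
  have "g -` A \<inter> space M = (f -` A \<inter> space M \<inter> G) \<union> (g -` A \<inter> (space M - G))"
    using eq G by (auto simp: good_set_def)
  moreover have "g -` A \<inter> (space M - G) \<in> sets M"
    using G by (auto simp: good_set_def null_sets_def)
  ultimately show "g -` A \<inter> space M \<in> sets M"
    using measurable_sets[OF f A] good_set_sets[OF G] by auto
qed (use g in auto)

lemma bdd_meas_cong:
  assumes "good_set M G" "bdd_meas M G f" "\<And>x. x \<in> G \<Longrightarrow> f x = g x"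
  shows "bdd_meas M G g"
proof -
  have "f ` G = g ` G" using assms(3) by auto
  then show ?thesis
    using assms good_set_measurable_cong[of M G f borel g] by (auto simp: bdd_meas_def)
qed

lemma bdd_meas_integrable: "good_set M G \<Longrightarrow> bdd_meas M G f \<Longrightarrow> integrable M f"
proof -
  assume G: "good_set M G" and f: "bdd_meas M G f"
  then obtain B where "\<And>x. x \<in> G \<Longrightarrow> norm (f x) \<le> B"
    by (auto simp: bdd_meas_def bounded_iff)
  with G f show "integrable M f"
    by (intro finite_measure.integrable_const_bound[where B=B] good_set_AE[OF G])
       (auto simp: good_set_def bdd_meas_def)
qed

lemma bdd_meas_bilinear:
  assumes "bounded_bilinear pr" "bdd_meas M G f" "bdd_meas M G g"
  shows "bdd_meas M G (\<lambda>x. pr (f x) (g x))"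
proof -
  interpret bounded_bilinear pr by fact
  have [measurable]: "f \<in> borel_measurable M" "g \<in> borel_measurable M"
    using assms by (auto simp: bdd_meas_def)
  have "continuous_on UNIV (\<lambda>x. pr (fst x) (snd x))"
    by (rule continuous_on[OF continuous_on_fst[OF continuous_on_id] continuous_on_snd[OF continuous_on_id]])
  then have "(\<lambda>x. pr (f x) (g x)) \<in> borel_measurable M"
    by (rule borel_measurable_continuous_Pair[OF \<open>f \<in> _\<close> \<open>g \<in> _\<close>])
  moreover obtain A B where AB: "\<And>x. x \<in> G \<Longrightarrow> norm (f x) \<le> A" "\<And>x. x \<in> G \<Longrightarrow> norm (g x) \<le> B"
    using assms by (auto simp: bdd_meas_def bounded_iff)
  obtain K where K: "K \<ge> 0" "\<And>a b. norm (pr a b) \<le> norm a * norm b * K"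
    using nonneg_bounded by blast
  have "norm (pr (f x) (g x)) \<le> A * B * K" if "x \<in> G" for x
  proof -
    have "norm (pr (f x) (g x)) \<le> norm (f x) * norm (g x) * K" by (rule K)
    also have "\<dots> \<le> A * B * K"
      using AB[OF that] K(1) by (intro mult_right_mono mult_mono) (auto intro: order_trans[OF norm_ge_zero])
    finally show ?thesis .
  qed
  then have "bounded ((\<lambda>x. pr (f x) (g x)) ` G)" by (auto simp: bounded_iff)
  ultimately show ?thesis by (simp add: bdd_meas_def)
qed

lemma bdd_meas_scale: "bdd_meas M G f \<Longrightarrow> bdd_meas M G (\<lambda>x. r *\<^sub>R f x)"
  by (auto simp: bdd_meas_def bounded_scaleR_comp)

lemma bdd_meas_add: "bdd_meas M G f \<Longrightarrow> bdd_meas M G g \<Longrightarrow> bdd_meas M G (\<lambda>x. f x + g x)"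
  by (auto simp: bdd_meas_def bounded_plus_comp)

lemma bdd_meas_lincomb:
  assumes "good_set M G" "bdd_meas M G f" "bdd_meas M G g"
    and "\<And>x. x \<in> G \<Longrightarrow> h x = r *\<^sub>R f x + s *\<^sub>R g x"
  shows "bdd_meas M G h"
  by (rule bdd_meas_cong[OF assms(1) bdd_meas_add[OF bdd_meas_scale bdd_meas_scale]])
     (use assms in auto)

lemma L2_inner_commute: "L2_inner M f g = L2_inner M g f"
  by (simp add: L2_inner_def inner_commute)

text \<open>The integral of a non-integrable function is 0, so additivity needs each product to be
  integrable; boundedness on \<open>G\<close> and finiteness of the measure provide this.\<close>

lemma L2_inner_bdd_lincomb:
  assumes G: "good_set M G" and f: "bdd_meas M G f" "bdd_meas M G f'" and g: "bdd_meas M G g"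
    and h: "\<And>x. x \<in> G \<Longrightarrow> h x = r *\<^sub>R f x + s *\<^sub>R f' x"
  shows "L2_inner M h g = r * L2_inner M f g + s * L2_inner M f' g"
proof -
  note int = bdd_meas_integrable[OF G bdd_meas_bilinear[OF bounded_bilinear_inner]]
  have hm: "bdd_meas M G h" by (rule bdd_meas_lincomb[OF G f h])
  have "L2_inner M h g = (LINT x|M. r * (f x \<bullet> g x) + s * (f' x \<bullet> g x))"
    unfolding L2_inner_def
    by (intro integral_cong_AE good_set_AE[OF G] borel_measurable_integrable[OF int[OF hm g]])
       (auto simp: h inner_simps intro!: borel_measurable_integrable Bochner_Integration.integrable_add
         integrable_mult_right int f g)
  also have "\<dots> = r * L2_inner M f g + s * L2_inner M f' g"
    unfolding L2_inner_def using int[OF f(1) g] int[OF f(2) g] by simp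
  finally show ?thesis .
qed

section \<open>Space-time fields of separated form\<close>

text \<open>Finite sums of products of a time factor and a space factor. Each time factor is
  continuous on the whole line and not just on \<open>S\<close>, which gives boundedness on slabs
  and limits at their end points. Both rules prescribe values only for \<open>t\<close> in
  \<open>S\<close> and \<open>x\<close> in \<open>G\<close>.\<close>

inductive sep ::
  "'a measure \<Rightarrow> 'a set \<Rightarrow> real set \<Rightarrow> (real \<Rightarrow> 'a \<Rightarrow> 'b::euclidean_space) \<Rightarrow> bool"
  for M G S where
  sep_base: "\<lbrakk>continuous_on UNIV \<theta>; bdd_meas M G c; \<And>t x. t \<in> S \<Longrightarrow> x \<in> G \<Longrightarrow> f t x = \<theta> t *\<^sub>R c x\<rbrakk>
    \<Longrightarrow> sep M G S f"
| sep_add: "\<lbrakk>sep M G S f; sep M G S g; \<And>t x. t \<in> S \<Longrightarrow> x \<in> G \<Longrightarrow> h t x = f t x + g t x\<rbrakk>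
    \<Longrightarrow> sep M G S h"

lemma sep_cong:
  assumes "sep M G S f" "\<And>t x. t \<in> S \<Longrightarrow> x \<in> G \<Longrightarrow> g t x = f t x"
  shows "sep M G S g"
  using assms(1)
proof cases
  case (sep_base \<theta> c)
  show ?thesis by (rule sep.sep_base[OF sep_base(1,2)]) (simp add: assms(2) sep_base(3))
next
  case (sep_add f' g')
  show ?thesis by (rule sep.sep_add[OF sep_add(1,2)]) (simp add: assms(2) sep_add(3))
qed

lemma sep_zero: "sep M G S (\<lambda>t x. 0)"
  by (rule sep_base[of "\<lambda>_. 0" M G "\<lambda>_. 0"]) (auto simp: bdd_meas_def image_constant_conv)

lemma sep_sum:
  assumes "\<And>i. i \<in> I \<Longrightarrow> sep M G S (f i)"
  shows "sep M G S (\<lambda>t x. \<Sum>i\<in>I. f i t x)"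
  using assms
proof (induction I rule: infinite_finite_induct)
  case (insert i I)
  have "sep M G S (f i)" "sep M G S (\<lambda>t x. \<Sum>i\<in>I. f i t x)"
    using insert by auto
  then show ?case by (rule sep_add) (simp add: insert)
qed (auto intro: sep_zero)

text \<open>Expansion of the product of two finite sums: the induction on \<open>g\<close> rests on
  an inner induction on \<open>f\<close> against a single product.\<close>

lemma sep_bilinear:
  assumes pr: "bounded_bilinear pr" and f: "sep M G S f" and g: "sep M G S g"
    and h: "\<And>t x. t \<in> S \<Longrightarrow> x \<in> G \<Longrightarrow> h t x = pr (f t x) (g t x)"
  shows "sep M G S h"
proof -
  interpret bounded_bilinear pr by fact
  have *: "sep M G S (\<lambda>t x. pr (f t x) (\<theta> t *\<^sub>R c x))"
    if "continuous_on UNIV \<theta>" "bdd_meas M G c" for \<theta> c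
    using f
  proof induction
    case (sep_base \<phi> d f)
    show ?case
      by (rule sep.sep_base[OF continuous_on_mult[OF sep_base(1) that(1)] bdd_meas_bilinear[OF pr sep_base(2) that(2)]])
         (simp add: sep_base(3) scaleR_left scaleR_right mult.commute)
  next
    case (sep_add f' g' h')
    show ?case
      by (rule sep.sep_add[OF sep_add.IH]) (simp add: sep_add.hyps add_left)
  qed
  have "sep M G S (\<lambda>t x. pr (f t x) (g t x))"
    using g
  proof induction
    case (sep_base \<theta> c g)
    show ?case by (rule sep_cong[OF *[OF sep_base(1,2)]]) (simp add: sep_base(3))
  next
    case (sep_add f' g' h')
    show ?case
      by (rule sep.sep_add[OF sep_add.IH]) (simp add: sep_add.hyps add_right)
  qed
  then show ?thesis by (rule sep_cong) (use h in auto)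
qed

lemma sep_scale:
  assumes "sep M G S f" "continuous_on UNIV \<theta>"
    and "\<And>t x. t \<in> S \<Longrightarrow> x \<in> G \<Longrightarrow> g t x = \<theta> t *\<^sub>R f t x"
  shows "sep M G S g"
proof -
  have "sep M G S (\<lambda>t x. \<theta> t *\<^sub>R f t x)"
    using assms(1)
  proof induction
    case (sep_base \<phi> d f)
    show ?case
      by (rule sep.sep_base[OF continuous_on_mult[OF assms(2) sep_base(1)] sep_base(2)]) (simp add: sep_base(3))
  next
    case (sep_add f' g' h')
    show ?case
      by (rule sep.sep_add[OF sep_add.IH]) (simp add: sep_add.hyps scaleR_add_right)
  qed
  then show ?thesis by (rule sep_cong) (use assms(3) in auto)
qed

lemma sep_bdd_meas:
  assumes G: "good_set M G" and "sep M G S f" "t \<in> S"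
  shows "bdd_meas M G (f t)"
  using assms(2,3)
proof induction
  case (sep_base \<theta> c f)
  show ?case by (rule bdd_meas_cong[OF G bdd_meas_scale[OF sep_base(2), of "\<theta> t"]]) (simp add: sep_base)
next
  case (sep_add f g h)
  show ?case
    by (rule bdd_meas_cong[OF G bdd_meas_add[OF sep_add.IH(1)[OF sep_add.prems] sep_add.IH(2)[OF sep_add.prems]]])
       (simp add: sep_add)
qed

text \<open>Integration over space acts on the space factor and leaves a multiple of the time
  factor. The continuous function on the whole line is recorded because its bound on a compact
  interval gives integrability in time.\<close>

lemma sep_integral:
  assumes G: "good_set M G" and "sep M G S f"
  shows "\<exists>\<phi>. continuous_on UNIV \<phi> \<and> (\<forall>t\<in>S. \<phi> t = (LINT x|M. f t x))"
  using assms(2)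
proof induction
  case (sep_base \<theta> c f)
  have "\<theta> t *\<^sub>R (LINT x|M. c x) = (LINT x|M. f t x)" if "t \<in> S" for t
  proof -
    have "bdd_meas M G (f t)"
      by (rule bdd_meas_cong[OF G bdd_meas_scale[OF sep_base(2), of "\<theta> t"]]) (simp add: sep_base that)
    then have "(LINT x|M. f t x) = (LINT x|M. \<theta> t *\<^sub>R c x)"
      using sep_base(2) by (intro integral_cong_AE good_set_AE[OF G])
        (auto simp: bdd_meas_def sep_base(3) that)
    then show ?thesis by simp
  qed
  then show ?case
    using sep_base by (intro exI[of _ "\<lambda>t. \<theta> t *\<^sub>R (LINT x|M. c x)"]) (auto intro!: continuous_intros)
next
  case (sep_add f g h)
  then obtain \<phi> \<psi> where *: "continuous_on UNIV \<phi>" "continuous_on UNIV \<psi>"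
    "\<forall>t\<in>S. \<phi> t = (LINT x|M. f t x)" "\<forall>t\<in>S. \<psi> t = (LINT x|M. g t x)"
    by blast
  have "\<phi> t + \<psi> t = (LINT x|M. h t x)" if "t \<in> S" for t
  proof -
    have b: "bdd_meas M G (f t)" "bdd_meas M G (g t)"
      by (rule sep_bdd_meas[OF G _ that], fact sep_add)+
    have "bdd_meas M G (h t)"
      by (rule bdd_meas_cong[OF G bdd_meas_add[OF b]]) (simp add: sep_add that)
    then have "(LINT x|M. h t x) = (LINT x|M. f t x + g t x)"
      using b by (intro integral_cong_AE good_set_AE[OF G]) (auto simp: bdd_meas_def sep_add(3) that)
    also have "\<dots> = (LINT x|M. f t x) + (LINT x|M. g t x)"
      using b by (intro Bochner_Integration.integral_add bdd_meas_integrable[OF G]) auto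
    finally show ?thesis using * that by simp
  qed
  then show ?case
    using * by (intro exI[of _ "\<lambda>t. \<phi> t + \<psi> t"]) (auto intro!: continuous_intros)
qed

lemma sep_L2_inner:
  assumes G: "good_set M G" and "sep M G S f" "sep M G S g"
  shows "\<exists>\<phi>. continuous_on UNIV \<phi> \<and> (\<forall>t\<in>S. \<phi> t = L2_inner M (f t) (g t))"
  unfolding L2_inner_def
  by (rule sep_integral[OF G]) (rule sep_bilinear[OF bounded_bilinear_inner assms(2,3)], rule refl)

lemma integrable_continuous_on_slab:
  fixes \<phi> g :: "real \<Rightarrow> real"
  assumes "continuous_on UNIV \<phi>" "\<And>t. t \<in> {a<..<b} \<Longrightarrow> \<phi> t = g t"
  shows "integrable (lebesgue_on {a<..<b}) g"
proof -
  have "compact (\<phi> ` {a..b})"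
    by (rule compact_continuous_image[OF continuous_on_subset[OF assms(1)]]) auto
  then obtain B where B: "\<And>t. t \<in> {a..b} \<Longrightarrow> norm (\<phi> t) \<le> B"
    by (meson bounded_iff compact_imp_bounded imageI)
  have "integrable (lebesgue_on {a<..<b}) \<phi>"
  proof (rule finite_measure.integrable_const_bound[where B=B])
    show "finite_measure (lebesgue_on {a<..<b})"
      by (intro finite_measure_lebesgue_on) auto
    show "AE t in lebesgue_on {a<..<b}. norm (\<phi> t) \<le> B"
      using B by (intro AE_I2) auto
    show "\<phi> \<in> borel_measurable (lebesgue_on {a<..<b})"
      using borel_measurable_continuous_onI[OF assms(1)] by (simp add: measurable_completion measurable_restrict_space1)
  qed
  moreover have "integrable (lebesgue_on {a<..<b}) \<phi> \<longleftrightarrow> integrable (lebesgue_on {a<..<b}) g"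
    using assms(2) by (intro Bochner_Integration.integrable_cong) auto
  ultimately show ?thesis by simp
qed

lemma sep_form_lincomb:
  assumes G: "good_set M G" and f: "sep M G {a<..<b} f" "sep M G {a<..<b} f'" and g: "sep M G {a<..<b} g"
    and h: "\<And>t x. t \<in> {a<..<b} \<Longrightarrow> x \<in> G \<Longrightarrow> h t x = r *\<^sub>R f t x + s *\<^sub>R f' t x"
  shows "(LINT t|lebesgue_on {a<..<b}. L2_inner M (h t) (g t)) =
    r * (LINT t|lebesgue_on {a<..<b}. L2_inner M (f t) (g t)) +
    s * (LINT t|lebesgue_on {a<..<b}. L2_inner M (f' t) (g t))"
proof -
  have *: "L2_inner M (h t) (g t) = r * L2_inner M (f t) (g t) + s * L2_inner M (f' t) (g t)"
    if "t \<in> {a<..<b}" for t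
    by (rule L2_inner_bdd_lincomb[OF G sep_bdd_meas[OF G f(1) that] sep_bdd_meas[OF G f(2) that]
          sep_bdd_meas[OF G g that] h[OF that]])
  have int: "integrable (lebesgue_on {a<..<b}) (\<lambda>t. L2_inner M (f t) (g t))" if "sep M G {a<..<b} f" for f
    using sep_L2_inner[OF G that g] by (auto intro: integrable_continuous_on_slab)
  have "(LINT t|lebesgue_on {a<..<b}. L2_inner M (h t) (g t)) =
      (LINT t|lebesgue_on {a<..<b}. r * L2_inner M (f t) (g t) + s * L2_inner M (f' t) (g t))"
    by (intro Bochner_Integration.integral_cong) (auto simp: *)
  also have "\<dots> = r * (LINT t|lebesgue_on {a<..<b}. L2_inner M (f t) (g t)) +
      s * (LINT t|lebesgue_on {a<..<b}. L2_inner M (f' t) (g t))"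
    using int[OF f(1)] int[OF f(2)] by simp
  finally show ?thesis .
qed

text \<open>Uniformity in space comes from the boundedness of each space factor on \<open>G\<close>.
  It is what allows the supremum norm in \<open>gamma_F\<close> to pass to the limit.\<close>

lemma sep_uniform_limit:
  assumes "sep M G S f"
  shows "\<exists>g. bdd_meas M G g \<and> uniform_limit G f g (at s within S)"
  using assms
proof induction
  case (sep_base \<theta> c f)
  have "(\<theta> \<longlongrightarrow> \<theta> s) (at s within S)"
    using sep_base(1) by (simp add: continuous_on_eq_continuous_at continuous_at_imp_continuous_within
        continuous_within[symmetric])
  then have "uniform_limit G (\<lambda>t x. \<theta> t) (\<lambda>x. \<theta> s) (at s within S)"
    by (auto simp: uniform_limit_iff tendsto_iff elim: eventually_mono)
  then have "uniform_limit G (\<lambda>t x. \<theta> t *\<^sub>R c x) (\<lambda>x. \<theta> s *\<^sub>R c x) (at s within S)"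
    using sep_base(2)
    by (intro bounded_bilinear.bounded_uniform_limit[OF bounded_bilinear_scaleR] uniform_limit_const)
       (auto simp: bdd_meas_def image_constant_conv)
  moreover have "\<forall>\<^sub>F t in at s within S. \<forall>x\<in>G. \<theta> t *\<^sub>R c x = f t x"
    using sep_base(3) by (auto simp: eventually_at_filter)
  ultimately have "uniform_limit G f (\<lambda>x. \<theta> s *\<^sub>R c x) (at s within S)"
    by (subst (asm) uniform_limit_cong) auto
  then show ?case using bdd_meas_scale[OF sep_base(2)] by blast
next
  case (sep_add f g h)
  then obtain f' g' where *: "bdd_meas M G f'" "bdd_meas M G g'"
    "uniform_limit G f f' (at s within S)" "uniform_limit G g g' (at s within S)"
    by blast
  have "uniform_limit G (\<lambda>t x. f t x + g t x) (\<lambda>x. f' x + g' x) (at s within S)"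
    by (intro uniform_limit_intros *)
  moreover have "\<forall>\<^sub>F t in at s within S. \<forall>x\<in>G. f t x + g t x = h t x"
    using sep_add(3) by (auto simp: eventually_at_filter)
  ultimately have "uniform_limit G h (\<lambda>x. f' x + g' x) (at s within S)"
    by (subst (asm) uniform_limit_cong) auto
  then show ?case using bdd_meas_add[OF *(1,2)] by blast
qed

text \<open>Common form of \<open>left_lim\<close>, \<open>right_lim\<close> and
  \<open>inside_value\<close>: a limit along \<open>at s within S\<close> is one-sided at an end
  point of a slab.\<close>

definition time_limit :: "real set \<Rightarrow> (real \<Rightarrow> 'a \<Rightarrow> 'b::t2_space) \<Rightarrow> real \<Rightarrow> 'a \<Rightarrow> 'b" where
  "time_limit S f s x = Lim (at s within S) (\<lambda>t. f t x)"

text \<open>\<open>Lim\<close> returns a chosen limit; on a nontrivial filter it is the one that the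
  separated form provides.\<close>

lemma sep_time_limit:
  assumes G: "good_set M G" and f: "sep M G S f" and s: "at s within S \<noteq> bot"
  shows "uniform_limit G f (time_limit S f s) (at s within S)" (is ?ul)
    and "bdd_meas M G (time_limit S f s)" (is ?bm)
    and "\<And>x. x \<in> G \<Longrightarrow> ((\<lambda>t. f t x) \<longlongrightarrow> time_limit S f s x) (at s within S)"
proof -
  obtain g where g: "bdd_meas M G g" "uniform_limit G f g (at s within S)"
    using sep_uniform_limit[OF f] by blast
  have eq: "g x = time_limit S f s x" if "x \<in> G" for x
    using tendsto_uniform_limitI[OF g(2) that] s by (simp add: time_limit_def tendsto_Lim)
  have "uniform_limit G f g (at s within S) \<longleftrightarrow> ?ul"
    by (rule uniform_limit_cong') (simp_all add: eq)
  with g(2) show ?ul by simp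
  then show "((\<lambda>t. f t x) \<longlongrightarrow> time_limit S f s x) (at s within S)" if "x \<in> G" for x
    using that by (rule tendsto_uniform_limitI)
  show ?bm by (rule bdd_meas_cong[OF G g(1) eq])
qed

lemma time_limit_lincomb:
  assumes G: "good_set M G" and f: "sep M G S f" "sep M G S f'" and s: "at s within S \<noteq> bot"
    and h: "\<And>t x. t \<in> S \<Longrightarrow> x \<in> G \<Longrightarrow> h t x = r *\<^sub>R f t x + q *\<^sub>R f' t x" and x: "x \<in> G"
  shows "time_limit S h s x = r *\<^sub>R time_limit S f s x + q *\<^sub>R time_limit S f' s x"
proof -
  have "((\<lambda>t. r *\<^sub>R f t x + q *\<^sub>R f' t x) \<longlongrightarrow> r *\<^sub>R time_limit S f s x + q *\<^sub>R time_limit S f' s x) (at s within S)"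
    by (intro tendsto_intros sep_time_limit(3)[OF G _ s x] f)
  moreover have "\<forall>\<^sub>F t in at s within S. r *\<^sub>R f t x + q *\<^sub>R f' t x = h t x"
    using h x by (auto simp: eventually_at_filter)
  ultimately have "((\<lambda>t. h t x) \<longlongrightarrow> r *\<^sub>R time_limit S f s x + q *\<^sub>R time_limit S f' s x) (at s within S)"
    by (rule Lim_transform_eventually)
  then show ?thesis unfolding time_limit_def using s by (intro tendsto_Lim) auto
qed

section \<open>Geometry of the mesh\<close>

text \<open>A Lipschitz domain lies locally on one side of its boundary. An interior point of the
  closure outside \<Omega>, moved slightly against \<open>e\<close>, would enter an open set
  disjoint from \<Omega> while staying in the closure. This places the open elements inside
  \<Omega>, although the mesh is only known to fill the closure.\<close>

lemma lipschitz_domain_interior_closure: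
  assumes "lipschitz_domain \<Omega>"
  shows "interior (closure \<Omega>) \<subseteq> \<Omega>"
proof (rule subsetI, rule ccontr)
  fix x assume x: "x \<in> interior (closure \<Omega>)" "x \<notin> \<Omega>"
  have "open \<Omega>" using assms by (simp add: lipschitz_domain_def)
  then have "x \<in> frontier \<Omega>"
    using x interior_subset[of "closure \<Omega>"] by (auto simp: frontier_def interior_open)
  then obtain e \<psi> L r where e: "norm e = 1" and r: "0 < r" and lip: "L-lipschitz_on UNIV \<psi>"
    and eq: "\<Omega> \<inter> ball x r = {x' \<in> ball x r. \<psi> (x' - (x' \<bullet> e) *\<^sub>R e) < x' \<bullet> e}"
    using assms unfolding lipschitz_domain_def by blast
  have "x \<in> ball x r" using r by simp
  with eq x(2) have ge: "x \<bullet> e \<le> \<psi> (x - (x \<bullet> e) *\<^sub>R e)" by fastforce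
  obtain \<delta> where \<delta>: "\<delta> > 0" "ball x \<delta> \<subseteq> closure \<Omega>"
    using x(1) by (auto simp: mem_interior)
  \<comment> \<open>Half the minimum keeps \<open>y\<close> both in the ball contained in the
    closure and in the ball where \<Omega> is described by the graph.\<close>
  define s where "s = min \<delta> r / 2"
  define y where "y = x - s *\<^sub>R e"
  define U where "U = ball x r \<inter> {z. z \<bullet> e < \<psi> (z - (z \<bullet> e) *\<^sub>R e)}"
  have s: "0 < s" "s < \<delta>" "s < r" using \<delta>(1) r by (auto simp: s_def)
  have "dist x y = s" using s e by (simp add: y_def dist_norm)
  then have y: "y \<in> closure \<Omega>" "y \<in> ball x r" using \<delta> s by auto
  have "e \<bullet> e = 1" using e by (simp add: norm_eq_1)
  then have "y - (y \<bullet> e) *\<^sub>R e = x - (x \<bullet> e) *\<^sub>R e" "y \<bullet> e = x \<bullet> e - s"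
    by (auto simp: y_def inner_simps algebra_simps)
  with ge s y have "y \<in> U" by (auto simp: U_def)
  have "continuous_on UNIV \<psi>" using lip by (rule lipschitz_on_continuous_on)
  then have "continuous_on UNIV (\<lambda>z. \<psi> (z - (z \<bullet> e) *\<^sub>R e))"
    by (rule continuous_on_compose2) (auto intro!: continuous_intros)
  then have "open {z. z \<bullet> e < \<psi> (z - (z \<bullet> e) *\<^sub>R e)}"
    by (intro open_Collect_less continuous_intros)
  then have "open U" by (auto simp: U_def)
  moreover have "U \<inter> \<Omega> = {}"
  proof (rule ccontr)
    assume "U \<inter> \<Omega> \<noteq> {}"
    then obtain z where z: "z \<in> U" "z \<in> \<Omega>" by blast
    then have "z \<in> \<Omega> \<inter> ball x r" by (simp add: U_def)
    with z(1) show False unfolding eq by (auto simp: U_def)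
  qed
  ultimately have "U \<inter> closure \<Omega> = {}" using open_Int_closure_eq_empty by blast
  with \<open>y \<in> U\<close> y show False by blast
qed

definition mesh_interior :: "'d::finite discretization \<Rightarrow> (real^'d) set" where
  "mesh_interior D = (\<Union>K\<in>mesh D. interior K)"

locale valid_mesh =
  fixes D :: "'d::finite discretization" and \<rho> :: real
  assumes valid: "valid_discretization \<rho> D"
begin

abbreviation "\<Omega> \<equiv> domain_of D"
abbreviation "G \<equiv> mesh_interior D"

lemma finite_mesh: "finite (mesh D)"
  using valid by (auto simp: valid_discretization_def triangulation_def)

lemma domain_lipschitz: "lipschitz_domain \<Omega>"
  using valid by (simp add: valid_discretization_def)

lemma domain_open: "open \<Omega>" and domain_bounded: "bounded \<Omega>"
  using domain_lipschitz by (auto simp: lipschitz_domain_def)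

lemma domain_sets: "\<Omega> \<in> sets lebesgue" and domain_lmeasurable: "\<Omega> \<in> lmeasurable"
  using domain_open domain_bounded by (auto intro: lmeasurable_open)

lemma mesh_simplex: "K \<in> mesh D \<Longrightarrow> int CARD('d) simplex K"
  using valid by (auto simp: valid_discretization_def)

text \<open>A simplex of full affine dimension has interior points, and by convexity it is the
  closure of its interior. Hence limits from inside an element make sense at every point of its
  facets.\<close>

lemma mesh_element:
  assumes "K \<in> mesh D"
  shows "convex K" "compact K" "closed K" "interior K \<noteq> {}" "closure (interior K) = K"
proof -
  note simp = mesh_simplex[OF assms]
  show c: "convex K" "compact K" "closed K"
    using convex_simplex[OF simp] compact_simplex[OF simp] closed_simplex[OF simp] by auto
  have "aff_dim K = DIM(real^'d)" using aff_dim_simplex[OF simp] by simp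
  then have "affine hull K = UNIV" using aff_dim_eq_full by blast
  moreover have "K \<noteq> {}" using simp by auto
  ultimately show i: "interior K \<noteq> {}"
    using rel_interior_eq_empty[OF c(1)] rel_interior_interior by metis
  show "closure (interior K) = K"
    using convex_closure_interior[OF c(1) i] c(3) by simp
qed

lemma mesh_interior_subset: "G \<subseteq> \<Omega>"
proof -
  have "interior K \<subseteq> \<Omega>" if "K \<in> mesh D" for K
  proof -
    have "K \<subseteq> closure \<Omega>" using that valid by (auto simp: valid_discretization_def)
    then show ?thesis
      using interior_mono lipschitz_domain_interior_closure[OF domain_lipschitz] by blast
  qed
  then show ?thesis by (auto simp: mesh_interior_def)
qed

lemma skeleton_null: "\<Omega> - G \<in> null_sets lebesgue"
proof -
  have "\<Omega> \<subseteq> \<Union>(mesh D)"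
    using valid closure_subset[of \<Omega>] by (auto simp: valid_discretization_def)
  then have "\<Omega> - G \<subseteq> (\<Union>K\<in>mesh D. frontier K)"
    using mesh_element(3) by (auto simp: mesh_interior_def frontier_def) (use closure_closed in blast)
  moreover have "negligible (\<Union>K\<in>mesh D. frontier K)"
    using finite_mesh mesh_element(1) by (intro negligible_Union) (auto intro: negligible_convex_frontier)
  ultimately show ?thesis
    using negligible_subset negligible_iff_null_sets by blast
qed

text \<open>Lebesgue measure is complete, so every subset of the null skeleton is
  measurable.\<close>

lemma good_vol: "good_set (vol D) G"
  unfolding good_set_def
proof (intro conjI allI impI)
  show "finite_measure (vol D)"
    by (rule finite_measure_lebesgue_on[OF domain_lmeasurable])
  show "G \<subseteq> space (vol D)"
    using mesh_interior_subset by simp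
  fix A assume "A \<subseteq> space (vol D) - G"
  then have "A \<subseteq> \<Omega> - G" by simp
  then have "A \<in> null_sets lebesgue"
    using skeleton_null null_sets_completion_subset by blast
  with \<open>A \<subseteq> \<Omega> - G\<close> show "A \<in> null_sets (vol D)"
    using domain_sets by (subst null_sets_restrict_space) auto
qed

lemma within_interior_nontrivial: "K \<in> mesh D \<Longrightarrow> x \<in> K \<Longrightarrow> at x within interior K \<noteq> bot"
proof -
  assume K: "K \<in> mesh D" and x: "x \<in> K"
  have "x islimpt interior K"
  proof (cases "x \<in> interior K")
    case True
    then show ?thesis by (metis interior_limit_point interior_interior)
  next
    case False
    then show ?thesis using mesh_element(5)[OF K] x by (auto simp: closure_def)
  qed
  then show ?thesis by (simp add: trivial_limit_within)
qed

section \<open>Piecewise smooth fields and linear operators on them\<close>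

text \<open>The piece on each element is continuous on the whole space, as polynomials are: it is
  bounded on the compact element, and its values are the traces at boundary points.\<close>

definition pw_cont :: "(real^'d \<Rightarrow> 'b::euclidean_space) \<Rightarrow> bool" where
  "pw_cont f \<longleftrightarrow> (\<forall>K\<in>mesh D. \<exists>p. continuous_on UNIV p \<and> (\<forall>x\<in>interior K. f x = p x))"

text \<open>The derivative is carried as a matrix field, so that \<open>p'\<close> is the broken
  gradient on the open element.\<close>

definition pw_C1 :: "(real^'d \<Rightarrow> real^'d) \<Rightarrow> bool" where
  "pw_C1 v \<longleftrightarrow> (\<forall>K\<in>mesh D. \<exists>p p'. (\<forall>x. (p has_derivative (\<lambda>h. p' x *v h)) (at x)) \<and>
     continuous_on UNIV p' \<and> (\<forall>x\<in>interior K. v x = p x))"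

lemma pw_C1E:
  assumes "pw_C1 v" "K \<in> mesh D"
  obtains p p' where "\<And>x. (p has_derivative (\<lambda>h. p' x *v h)) (at x)" "continuous_on UNIV p'"
    "\<And>x. x \<in> interior K \<Longrightarrow> v x = p x"
  using assms unfolding pw_C1_def by metis

lemma pw_contE:
  assumes "pw_cont f" "K \<in> mesh D"
  obtains p where "continuous_on UNIV p" "\<And>x. x \<in> interior K \<Longrightarrow> f x = p x"
  using assms by (auto simp: pw_cont_def)

text \<open>Measurability is checked on the open elements and on the complement of \<open>G\<close>,
  after setting the field to 0 there; restoring its values changes it on a null set only.\<close>

lemma pw_cont_bdd_meas:
  fixes f :: "real^'d \<Rightarrow> 'b::euclidean_space"
  assumes "pw_cont f"
  shows "bdd_meas (vol D) G f"
proof -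
  define f' where "f' x = (if x \<in> G then f x else 0)" for x
  have "f' \<in> borel_measurable (vol D)"
  proof (rule measurable_piecewise_restrict[of "insert (- G) (interior ` mesh D)"])
    show "countable (insert (- G) (interior ` mesh D))"
      using finite_mesh by (simp add: countable_finite)
    have "open G" by (auto simp: mesh_interior_def)
    then have borel: "- G \<in> sets lebesgue" "\<And>K. interior K \<in> sets lebesgue" by auto
    fix A assume A: "A \<in> insert (- G) (interior ` mesh D)"
    then have "A \<in> sets lebesgue" using borel by auto
    then show "A \<inter> space (vol D) \<in> sets (vol D)"
      using domain_sets by (auto simp: sets_restrict_space)
    show "f' \<in> borel_measurable (restrict_space (vol D) A)"
    proof (cases "A = - G")
      case True
      have "f' \<in> borel_measurable (restrict_space (vol D) A) \<longleftrightarrow>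
          (\<lambda>_. 0 :: 'b) \<in> borel_measurable (restrict_space (vol D) A)"
        by (rule measurable_cong) (auto simp: f'_def True space_restrict_space)
      then show ?thesis by simp
    next
      case False
      then obtain K where K: "K \<in> mesh D" "A = interior K" using A by auto
      obtain p where p: "continuous_on UNIV p" "\<And>x. x \<in> interior K \<Longrightarrow> f x = p x"
        using pw_contE[OF assms K(1)] by blast
      have "f' \<in> borel_measurable (restrict_space (vol D) A) \<longleftrightarrow>
          p \<in> borel_measurable (restrict_space (vol D) A)"
        using K p(2) by (intro measurable_cong) (auto simp: f'_def mesh_interior_def space_restrict_space)
      moreover have "p \<in> borel_measurable (vol D)"
        using borel_measurable_continuous_onI[OF p(1)]
        by (simp add: measurable_completion measurable_restrict_space1)
      ultimately show ?thesis by (simp add: measurable_restrict_space1)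
    qed
  qed (auto simp: mesh_interior_def)
  then have "f \<in> borel_measurable (vol D)"
    by (rule good_set_measurable_cong[OF good_vol]) (auto simp: f'_def)
  moreover have "bounded (f ` G)"
  proof -
    have "bounded (f ` interior K)" if K: "K \<in> mesh D" for K
    proof -
      obtain p where p: "continuous_on UNIV p" "\<And>x. x \<in> interior K \<Longrightarrow> f x = p x"
        using pw_contE[OF assms K] by blast
      have "bounded (p ` K)"
        using mesh_element(2)[OF K] p(1)
        by (intro compact_imp_bounded compact_continuous_image) (auto intro: continuous_on_subset)
      moreover have "f ` interior K \<subseteq> p ` K"
        using p(2) interior_subset[of K] by auto
      ultimately show ?thesis by (rule bounded_subset)
    qed
    then show ?thesis
      unfolding mesh_interior_def image_UN using finite_mesh by (intro bounded_UN) auto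
  qed
  ultimately show ?thesis by (simp add: bdd_meas_def)
qed

lemma trace_from_eq:
  assumes "K \<in> mesh D" "x \<in> K" "continuous_on UNIV p" "\<And>x. x \<in> interior K \<Longrightarrow> f x = p x"
  shows "trace_from K f x = p x"
proof -
  have "(p \<longlongrightarrow> p x) (at x within interior K)"
    using assms(3) by (simp add: continuous_on_eq_continuous_at continuous_at_imp_continuous_at_within
        continuous_within[symmetric])
  moreover have "\<forall>\<^sub>F y in at x within interior K. p y = f y"
    using assms(4) by (auto simp: eventually_at_filter)
  ultimately have "(f \<longlongrightarrow> p x) (at x within interior K)"
    by (rule Lim_transform_eventually)
  then show ?thesis
    unfolding trace_from_def using within_interior_nontrivial[OF assms(1,2)] by (intro tendsto_Lim) auto
qed

lemma trace_from_continuous: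
  assumes "K \<in> mesh D" "pw_cont f"
  shows "continuous_on K (trace_from K f)"
proof -
  obtain p where p: "continuous_on UNIV p" "\<And>x. x \<in> interior K \<Longrightarrow> f x = p x"
    using pw_contE[OF assms(2,1)] by blast
  have "continuous_on K p" using p(1) by (rule continuous_on_subset) auto
  moreover have "continuous_on K (trace_from K f) \<longleftrightarrow> continuous_on K p"
    using trace_from_eq[OF assms(1) _ p] by (intro continuous_on_cong) auto
  ultimately show ?thesis by simp
qed

lemma trace_from_lincomb:
  assumes K: "K \<in> mesh D" "x \<in> K" and f: "pw_cont f1" "pw_cont f2"
    and eq: "\<And>x. x \<in> G \<Longrightarrow> f x = r *\<^sub>R f1 x + s *\<^sub>R f2 x"
  shows "trace_from K f x = r *\<^sub>R trace_from K f1 x + s *\<^sub>R trace_from K f2 x"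
proof -
  obtain p1 where p1: "continuous_on UNIV p1" "\<And>x. x \<in> interior K \<Longrightarrow> f1 x = p1 x"
    using pw_contE[OF f(1) K(1)] by blast
  obtain p2 where p2: "continuous_on UNIV p2" "\<And>x. x \<in> interior K \<Longrightarrow> f2 x = p2 x"
    using pw_contE[OF f(2) K(1)] by blast
  have "interior K \<subseteq> G" using K by (auto simp: mesh_interior_def)
  then have "trace_from K f x = r *\<^sub>R p1 x + s *\<^sub>R p2 x"
    using p1 p2 eq by (intro trace_from_eq[OF K] continuous_intros) auto
  then show ?thesis
    using trace_from_eq[OF K p1] trace_from_eq[OF K p2] by simp
qed

lemma broken_grad_eq:
  assumes "(p has_derivative (\<lambda>h. A *v h)) (at x)" "x \<in> interior K" "\<And>y. y \<in> interior K \<Longrightarrow> v y = p y"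
  shows "broken_grad v x = A"
proof -
  have "(v has_derivative (\<lambda>h. A *v h)) (at x)"
    using assms by (intro has_derivative_transform_within_open[OF assms(1), of "interior K"]) auto
  then have "frechet_derivative v (at x) = (\<lambda>h. A *v h)"
    by (metis frechet_derivative_at)
  then show ?thesis by (simp add: broken_grad_def jacobian_def)
qed

text \<open>The relation among the arguments is assumed on \<open>G\<close> alone. With coefficients
  1 and 0 it says that piecewise C1 fields agreeing on \<open>G\<close> have the same image
  there.\<close>

definition pw_op :: "((real^'d \<Rightarrow> real^'d) \<Rightarrow> real^'d \<Rightarrow> 'b::euclidean_space) \<Rightarrow> bool" where
  "pw_op Q \<longleftrightarrow> (\<forall>v. pw_C1 v \<longrightarrow> pw_cont (Q v)) \<and>
     (\<forall>v v1 v2 r s. pw_C1 v1 \<longrightarrow> pw_C1 v2 \<longrightarrow> (\<forall>x\<in>G. v x = r *\<^sub>R v1 x + s *\<^sub>R v2 x) \<longrightarrow>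
        (\<forall>x\<in>G. Q v x = r *\<^sub>R Q v1 x + s *\<^sub>R Q v2 x))"

text \<open>The image lives on \<open>H\<close> with measure \<open>M\<close>, which will be the
  domain or a facet, while arguments are still compared on \<open>G\<close>.\<close>

definition mesh_op ::
  "(real^'d) measure \<Rightarrow> (real^'d) set \<Rightarrow> ((real^'d \<Rightarrow> real^'d) \<Rightarrow> real^'d \<Rightarrow> 'b::euclidean_space) \<Rightarrow> bool"
where
  "mesh_op M H Q \<longleftrightarrow> good_set M H \<and> (\<forall>v. pw_C1 v \<longrightarrow> bdd_meas M H (Q v)) \<and>
     (\<forall>v v1 v2 r s. pw_C1 v1 \<longrightarrow> pw_C1 v2 \<longrightarrow> (\<forall>x\<in>G. v x = r *\<^sub>R v1 x + s *\<^sub>R v2 x) \<longrightarrow>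
        (\<forall>x\<in>H. Q v x = r *\<^sub>R Q v1 x + s *\<^sub>R Q v2 x))"

lemma pw_C1_imp_pw_cont: "pw_C1 v \<Longrightarrow> pw_cont v"
  unfolding pw_C1_def pw_cont_def
  by (meson continuous_at_imp_continuous_on has_derivative_continuous)

lemma pw_op_id: "pw_op (\<lambda>v. v)"
  by (auto simp: pw_op_def pw_C1_imp_pw_cont)

lemma pw_op_broken_grad: "pw_op broken_grad"
  unfolding pw_op_def
proof (intro conjI allI impI ballI)
  fix v assume v: "pw_C1 v"
  show "pw_cont (broken_grad v)"
    unfolding pw_cont_def
  proof
    fix K assume "K \<in> mesh D"
    then obtain p p' where p: "\<And>x. (p has_derivative (\<lambda>h. p' x *v h)) (at x)"
      "continuous_on UNIV p'" "\<And>x. x \<in> interior K \<Longrightarrow> v x = p x"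
      using pw_C1E[OF v] by metis
    show "\<exists>p. continuous_on UNIV p \<and> (\<forall>x\<in>interior K. broken_grad v x = p x)"
      using p(2) broken_grad_eq[OF p(1) _ p(3)] by (intro exI[of _ p']) simp
  qed
next
  fix v v1 v2 r s x
  assume v: "pw_C1 v1" "pw_C1 v2" "\<forall>x\<in>G. v x = r *\<^sub>R v1 x + s *\<^sub>R v2 x" and "x \<in> G"
  then obtain K where K: "K \<in> mesh D" "x \<in> interior K" by (auto simp: mesh_interior_def)
  obtain p p' where p: "\<And>x. (p has_derivative (\<lambda>h. p' x *v h)) (at x)"
    "\<And>x. x \<in> interior K \<Longrightarrow> v1 x = p x"
    using pw_C1E[OF v(1) K(1)] by metis
  obtain q q' where q: "\<And>x. (q has_derivative (\<lambda>h. q' x *v h)) (at x)"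
    "\<And>x. x \<in> interior K \<Longrightarrow> v2 x = q x"
    using pw_C1E[OF v(2) K(1)] by metis
  have "((\<lambda>x. r *\<^sub>R p x + s *\<^sub>R q x) has_derivative (\<lambda>h. r *\<^sub>R (p' x *v h) + s *\<^sub>R (q' x *v h))) (at x)"
    by (intro derivative_intros p q)
  also have "(\<lambda>h. r *\<^sub>R (p' x *v h) + s *\<^sub>R (q' x *v h)) = (\<lambda>h. (r *\<^sub>R p' x + s *\<^sub>R q' x) *v h)"
    by (simp add: matrix_vector_mult_add_rdistrib scaleR_matrix_vector_assoc)
  finally have "broken_grad v x = r *\<^sub>R p' x + s *\<^sub>R q' x"
    using K v(3) p(2) q(2) by (intro broken_grad_eq[of _ _ x K]) (auto simp: mesh_interior_def)
  then show "broken_grad v x = r *\<^sub>R broken_grad v1 x + s *\<^sub>R broken_grad v2 x"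
    using broken_grad_eq[OF p(1) K(2) p(2)] broken_grad_eq[OF q(1) K(2) q(2)] by simp
qed

lemma mesh_op_vol: "pw_op Q \<Longrightarrow> mesh_op (vol D) G Q"
  by (auto simp: pw_op_def mesh_op_def good_vol pw_cont_bdd_meas)

section \<open>Facets\<close>

lemma interior_facets_subset: "interior_facets D \<subseteq> facets D"
  by (auto simp: interior_facets_def facets_def)

lemma facet_geometry:
  assumes "F \<in> facets D"
  shows "compact F" "convex F" "F \<noteq> {}"
proof -
  obtain K where K: "K \<in> mesh D" "F facet_of K" using assms by (auto simp: facets_def)
  then have "F face_of K" "F \<noteq> {}" by (auto simp: facet_of_def)
  then show "compact F" "convex F" "F \<noteq> {}"
    using face_of_imp_compact[of K F] mesh_element[OF K(1)] face_of_imp_convex by auto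
qed

text \<open>The prism over \<open>F\<close> is a continuous image of a compact product, hence of
  finite volume, and the projection onto a closed convex set is continuous. The result is a Borel
  measure, for which all of \<open>F\<close> is taken as the good set.\<close>

lemma surface_measure_props:
  assumes "F \<in> facets D"
  shows "good_set (surface_measure D F) F" "sets (surface_measure D F) = sets (restrict_space borel F)"
proof -
  define P where "P = {x + s *\<^sub>R facet_normal D F | x s. x \<in> F \<and> 0 \<le> s \<and> s \<le> 1}"
  note F = facet_geometry[OF assms]
  have "P = (\<lambda>(x, s). x + s *\<^sub>R facet_normal D F) ` (F \<times> {0..1})"
    unfolding P_def by force
  moreover have "compact ((\<lambda>(x, s). x + s *\<^sub>R facet_normal D F) ` (F \<times> {0..1::real}))"
    using F(1) by (intro compact_continuous_image compact_Times)
      (auto simp: case_prod_beta intro!: continuous_intros)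
  ultimately have P: "compact P" by simp
  have fin: "finite_measure (restrict_space lborel P)"
  proof (rule finite_measureI)
    have "emeasure lborel P < \<infinity>"
      using emeasure_bounded_finite[OF compact_imp_bounded[OF P]] by simp
    then show "emeasure (restrict_space lborel P) (space (restrict_space lborel P)) \<noteq> \<infinity>"
      using P by (simp add: emeasure_restrict_space space_restrict_space borel_compact)
  qed
  have "continuous_on UNIV (closest_point F)"
    using F by (intro continuous_on_closest_point) (auto simp: compact_imp_closed)
  then have "closest_point F \<in> borel_measurable lborel"
    using borel_measurable_continuous_onI by simp
  then have m: "closest_point F \<in> measurable (restrict_space lborel P) (restrict_space borel F)"
    using F by (intro measurable_restrict_space2 measurable_restrict_space1)
      (auto simp: closest_point_in_set compact_imp_closed)
  show "sets (surface_measure D F) = sets (restrict_space borel F)"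
    by (simp add: surface_measure_def)
  have "space (surface_measure D F) = F" by (simp add: surface_measure_def space_restrict_space)
  moreover have "finite_measure (surface_measure D F)"
    unfolding surface_measure_def P_def[symmetric]
    by (rule finite_measure.finite_measure_distr[OF fin m])
  ultimately show "good_set (surface_measure D F) F"
    by (auto simp: good_set_def)
qed

lemma bdd_meas_surface:
  fixes g :: "real^'d \<Rightarrow> 'b::euclidean_space"
  assumes F: "F \<in> facets D" and g: "continuous_on F g"
  shows "bdd_meas (surface_measure D F) F g"
proof -
  have "g \<in> borel_measurable (restrict_space borel F)"
    by (rule borel_measurable_continuous_on_restrict[OF g])
  then have "g \<in> borel_measurable (surface_measure D F)"
    using surface_measure_props(2)[OF F] measurable_cong_sets by blast
  moreover have "bounded (g ` F)"
    using compact_continuous_image[OF g facet_geometry(1)[OF F]] by (rule compact_imp_bounded)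
  ultimately show ?thesis by (simp add: bdd_meas_def)
qed

lemma plus_element_props:
  assumes "F \<in> facets D"
  shows "plus_element D F \<in> mesh D" "F \<subseteq> plus_element D F"
proof -
  have "\<exists>K. K \<in> mesh D \<and> F facet_of K \<and> outward_unit_normal K F (facet_normal D F)"
    using assms valid by (auto simp: valid_discretization_def)
  from someI_ex[OF this] show "plus_element D F \<in> mesh D" "F \<subseteq> plus_element D F"
    unfolding plus_element_def[symmetric] by (auto dest: facet_of_imp_subset)
qed

lemma minus_element_props:
  assumes "F \<in> interior_facets D"
  shows "minus_element D F \<in> mesh D" "F \<subseteq> minus_element D F"
proof -
  have "\<exists>K. K \<in> mesh D \<and> F facet_of K \<and> K \<noteq> plus_element D F"
    using assms by (auto simp: interior_facets_def)
  from someI_ex[OF this] show "minus_element D F \<in> mesh D" "F \<subseteq> minus_element D F"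
    unfolding minus_element_def[symmetric] by (auto dest: facet_of_imp_subset)
qed

text \<open>Averages and jumps are fixed combinations of traces from one or two elements, and each
  trace is the value of a continuous piece.\<close>

lemma mesh_op_avg_jump:
  assumes F: "F \<in> facets D" and Q: "pw_op Q"
  shows "mesh_op (surface_measure D F) F (\<lambda>v. avg D F (Q v))"
    and "mesh_op (surface_measure D F) F (\<lambda>v. jump D F (Q v))"
proof -
  note plus = plus_element_props[OF F] and minus = minus_element_props[of F]
  have Qc: "pw_cont (Q v)" if "pw_C1 v" for v using Q that by (simp add: pw_op_def)
  have cp: "continuous_on F (trace_from (plus_element D F) (Q v))" if "pw_C1 v" for v
    using trace_from_continuous[OF plus(1) Qc[OF that]] continuous_on_subset[OF _ plus(2)] by blast
  have cm: "continuous_on F (trace_from (minus_element D F) (Q v))"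
    if "pw_C1 v" "F \<in> interior_facets D" for v
    using trace_from_continuous[OF minus(1) Qc[OF that(1)]] continuous_on_subset[OF _ minus(2)] that by blast
  have lin: "trace_from K (Q v) x = r *\<^sub>R trace_from K (Q v1) x + s *\<^sub>R trace_from K (Q v2) x"
    if "pw_C1 v1" "pw_C1 v2" "\<forall>x\<in>G. v x = r *\<^sub>R v1 x + s *\<^sub>R v2 x" "K \<in> mesh D" "x \<in> K"
    for K v v1 v2 r s x
    using that Q by (intro trace_from_lincomb Qc) (auto simp: pw_op_def)
  have "continuous_on F (avg D F (Q v))" if "pw_C1 v" for v
    unfolding avg_def[abs_def]
    by (cases "F \<in> interior_facets D") (auto intro!: continuous_intros cp cm that)
  moreover have "avg D F (Q v) x = r *\<^sub>R avg D F (Q v1) x + s *\<^sub>R avg D F (Q v2) x"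
    if "pw_C1 v1" "pw_C1 v2" "\<forall>x\<in>G. v x = r *\<^sub>R v1 x + s *\<^sub>R v2 x" "x \<in> F" for v v1 v2 r s x
    using lin[OF that(1,2,3) plus(1)] lin[OF that(1,2,3) minus(1)] plus(2) minus(2) that(4)
    by (auto simp: avg_def algebra_simps subset_iff)
  ultimately show "mesh_op (surface_measure D F) F (\<lambda>v. avg D F (Q v))"
    by (simp add: mesh_op_def bdd_meas_surface F surface_measure_props(1))
  have "continuous_on F (jump D F (Q v))" if "pw_C1 v" for v
    unfolding jump_def[abs_def]
    by (cases "F \<in> interior_facets D") (auto intro!: continuous_intros cp cm that)
  moreover have "jump D F (Q v) x = r *\<^sub>R jump D F (Q v1) x + s *\<^sub>R jump D F (Q v2) x"
    if "pw_C1 v1" "pw_C1 v2" "\<forall>x\<in>G. v x = r *\<^sub>R v1 x + s *\<^sub>R v2 x" "x \<in> F" for v v1 v2 r s x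
    using lin[OF that(1,2,3) plus(1)] lin[OF that(1,2,3) minus(1)] plus(2) minus(2) that(4)
    by (auto simp: jump_def algebra_simps subset_iff)
  ultimately show "mesh_op (surface_measure D F) F (\<lambda>v. jump D F (Q v))"
    by (simp add: mesh_op_def bdd_meas_surface F surface_measure_props(1))
qed

text \<open>Serves for the product of a gradient with the facet normal, for the normal component and
  for the penalty weight.\<close>

lemma mesh_op_compose:
  assumes Q: "mesh_op M H Q" and l: "bounded_linear l"
  shows "mesh_op M H (\<lambda>v x. l (Q v x))"
proof -
  interpret bounded_linear l by fact
  have "bdd_meas M H (\<lambda>x. l (g x))" if "bdd_meas M H g" for g
  proof -
    have "l \<in> borel_measurable borel"
      by (intro borel_measurable_continuous_onI linear_continuous_on[OF l])
    then have "(\<lambda>x. l (g x)) \<in> borel_measurable M"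
      using that by (auto simp: bdd_meas_def intro: measurable_compose)
    moreover have "bounded ((\<lambda>x. l (g x)) ` H)"
      using bounded_linear_image[OF _ l, of "g ` H"] that by (simp add: bdd_meas_def image_image)
    ultimately show ?thesis by (simp add: bdd_meas_def)
  qed
  moreover have "l (Q v x) = r *\<^sub>R l (Q v1 x) + s *\<^sub>R l (Q v2 x)"
    if "pw_C1 v1" "pw_C1 v2" "\<forall>x\<in>G. v x = r *\<^sub>R v1 x + s *\<^sub>R v2 x" "x \<in> H" for v v1 v2 r s x
  proof -
    have "Q v x = r *\<^sub>R Q v1 x + s *\<^sub>R Q v2 x"
      using Q that unfolding mesh_op_def by blast
    then show ?thesis by (simp add: add scaleR)
  qed
  ultimately show ?thesis
    using Q unfolding mesh_op_def by blast
qed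

lemma pw_C1_lincomb:
  assumes "pw_C1 v1" "pw_C1 v2" "\<And>x. x \<in> G \<Longrightarrow> v x = r *\<^sub>R v1 x + s *\<^sub>R v2 x"
  shows "pw_C1 v"
  unfolding pw_C1_def
proof
  fix K assume K: "K \<in> mesh D"
  obtain p p' where p: "\<And>x. (p has_derivative (\<lambda>h. p' x *v h)) (at x)" "continuous_on UNIV p'"
    "\<And>x. x \<in> interior K \<Longrightarrow> v1 x = p x"
    using pw_C1E[OF assms(1) K] by metis
  obtain q q' where q: "\<And>x. (q has_derivative (\<lambda>h. q' x *v h)) (at x)" "continuous_on UNIV q'"
    "\<And>x. x \<in> interior K \<Longrightarrow> v2 x = q x"
    using pw_C1E[OF assms(2) K] by metis
  have "((\<lambda>x. r *\<^sub>R p x + s *\<^sub>R q x) has_derivative (\<lambda>h. (r *\<^sub>R p' x + s *\<^sub>R q' x) *v h)) (at x)" for x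
    using has_derivative_add[OF has_derivative_scaleR_right[OF p(1)[of x], of r]
        has_derivative_scaleR_right[OF q(1)[of x], of s]]
    by (simp add: matrix_vector_mult_add_rdistrib scaleR_matrix_vector_assoc)
  moreover have "continuous_on UNIV (\<lambda>x. r *\<^sub>R p' x + s *\<^sub>R q' x)"
    by (intro continuous_intros p q)
  moreover have "\<forall>x\<in>interior K. v x = r *\<^sub>R p x + s *\<^sub>R q x"
  proof
    fix x assume x: "x \<in> interior K"
    with K have "x \<in> G" by (auto simp: mesh_interior_def)
    from assms(3)[OF this] p(3)[OF x] q(3)[OF x] show "v x = r *\<^sub>R p x + s *\<^sub>R q x" by simp
  qed
  ultimately show "\<exists>p p'. (\<forall>x. (p has_derivative (\<lambda>h. p' x *v h)) (at x)) \<and>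
      continuous_on UNIV p' \<and> (\<forall>x\<in>interior K. v x = p x)"
    by (intro exI[of _ "\<lambda>x. r *\<^sub>R p x + s *\<^sub>R q x"] exI[of _ "\<lambda>x. r *\<^sub>R p' x + s *\<^sub>R q' x"] conjI allI)
qed

lemma pw_C1_zero: "pw_C1 (\<lambda>x. 0)"
proof -
  have d: "((\<lambda>x. 0) has_derivative (\<lambda>h. (0 :: real^'d^'d) *v h)) (at x)" for x :: "real^'d"
    by (simp add: matrix_vector_mult_0)
  show ?thesis unfolding pw_C1_def
    by (intro ballI exI[of _ "\<lambda>_. 0"] exI[of _ "\<lambda>_. 0 :: real^'d^'d"] conjI allI) (rule d | simp)+
qed

lemma pw_C1_sum:
  assumes "finite I" "\<And>i. i \<in> I \<Longrightarrow> pw_C1 (c i)"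
  shows "pw_C1 (\<lambda>x. \<Sum>i\<in>I. r i *\<^sub>R c i x)"
  using assms
proof induction
  case (insert i I)
  have "pw_C1 (c i)" "pw_C1 (\<lambda>x. \<Sum>i\<in>I. r i *\<^sub>R c i x)"
    using insert by auto
  then show ?case
    by (rule pw_C1_lincomb[where r="r i" and s=1]) (use insert.hyps in simp)
qed (simp add: pw_C1_zero)

text \<open>The binary relation in \<open>mesh_op\<close> is iterated; the empty sum is the relation
  with both coefficients 0.\<close>

lemma mesh_op_sum:
  assumes Q: "mesh_op M H Q" and "finite I" "\<And>i. i \<in> I \<Longrightarrow> pw_C1 (c i)"
    and "\<And>x. x \<in> G \<Longrightarrow> v x = (\<Sum>i\<in>I. r i *\<^sub>R c i x)" and "x \<in> H"
  shows "Q v x = (\<Sum>i\<in>I. r i *\<^sub>R Q (c i) x)"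
  using assms(2-4)
proof (induction I arbitrary: v)
  case empty
  have "Q v x = 0 *\<^sub>R Q (\<lambda>x. 0) x + 0 *\<^sub>R Q (\<lambda>x. 0) x"
  proof -
    have "\<forall>x\<in>G. v x = 0 *\<^sub>R (\<lambda>x. 0) x + 0 *\<^sub>R (\<lambda>x. 0) x" using empty by simp
    then show ?thesis using Q pw_C1_zero \<open>x \<in> H\<close> unfolding mesh_op_def by blast
  qed
  then show ?case by simp
next
  case (insert i I)
  let ?w = "\<lambda>x. \<Sum>i\<in>I. r i *\<^sub>R c i x"
  have "\<forall>x\<in>G. v x = r i *\<^sub>R c i x + 1 *\<^sub>R ?w x"
    using insert by simp
  then have "Q v x = r i *\<^sub>R Q (c i) x + 1 *\<^sub>R Q ?w x"
    using Q pw_C1_sum[of I c r] insert.hyps insert.prems(1) \<open>x \<in> H\<close>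
    unfolding mesh_op_def by blast
  then show ?case using insert by simp
qed

end

section \<open>Piecewise polynomials\<close>

text \<open>The derivative is represented by a continuous gradient vector, so that the gradients of
  the components, stacked as rows, form the Jacobian.\<close>

definition scalar_C1 :: "(real^'d::finite \<Rightarrow> real) \<Rightarrow> bool" where
  "scalar_C1 q \<longleftrightarrow> (\<exists>g. (\<forall>x. (q has_derivative (\<lambda>h. g x \<bullet> h)) (at x)) \<and> continuous_on UNIV g)"

lemma scalar_C1_const: "scalar_C1 (\<lambda>x :: real^'d::finite. c)"
proof -
  have "((\<lambda>x. c) has_derivative (\<lambda>h. 0 \<bullet> h)) (at x)" for x :: "real^'d"
    by simp
  then show ?thesis
    unfolding scalar_C1_def by (intro exI[of _ "\<lambda>_. 0"] conjI allI) (assumption | simp)+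
qed

lemma scalar_C1_component: "scalar_C1 (\<lambda>x :: real^'d::finite. x $ i)"
proof -
  have "((\<lambda>x. x $ i) has_derivative (\<lambda>h. axis i 1 \<bullet> h)) (at x)" for x :: "real^'d"
    using bounded_linear_imp_has_derivative[OF bounded_linear_vec_nth[of i], of "at x"]
    by (simp add: inner_axis' )
  then show ?thesis unfolding scalar_C1_def by (intro exI[of _ "\<lambda>_. axis i 1"]) auto
qed

lemma scalar_C1_add:
  assumes "scalar_C1 p" "scalar_C1 q"
  shows "scalar_C1 (\<lambda>x. p x + q x)"
proof -
  obtain g h where *: "\<And>x. (p has_derivative (\<lambda>y. g x \<bullet> y)) (at x)" "continuous_on UNIV g"
    "\<And>x. (q has_derivative (\<lambda>y. h x \<bullet> y)) (at x)" "continuous_on UNIV h"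
    using assms by (auto simp: scalar_C1_def)
  have "((\<lambda>x. p x + q x) has_derivative (\<lambda>y. (g x + h x) \<bullet> y)) (at x)" for x
    using has_derivative_add[OF *(1)[of x] *(3)[of x]] by (simp add: inner_add_left)
  with * show ?thesis unfolding scalar_C1_def
    by (intro exI[of _ "\<lambda>x. g x + h x"]) (auto intro!: continuous_intros)
qed

lemma scalar_C1_mult:
  assumes "scalar_C1 p" "scalar_C1 q"
  shows "scalar_C1 (\<lambda>x. p x * q x)"
proof -
  obtain g h where *: "\<And>x. (p has_derivative (\<lambda>y. g x \<bullet> y)) (at x)" "continuous_on UNIV g"
    "\<And>x. (q has_derivative (\<lambda>y. h x \<bullet> y)) (at x)" "continuous_on UNIV h"
    using assms by (auto simp: scalar_C1_def)
  then have "continuous_on UNIV p" "continuous_on UNIV q"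
    by (meson continuous_at_imp_continuous_on has_derivative_continuous)+
  moreover have "((\<lambda>x. p x * q x) has_derivative (\<lambda>y. (p x *\<^sub>R h x + q x *\<^sub>R g x) \<bullet> y)) (at x)" for x
    using has_derivative_mult[OF *(1)[of x] *(3)[of x]] by (simp add: inner_simps mult_ac)
  ultimately show ?thesis unfolding scalar_C1_def
    using *(2,4) by (intro exI[of _ "\<lambda>x. p x *\<^sub>R h x + q x *\<^sub>R g x"] conjI allI continuous_intros)
qed

lemma scalar_C1_sum: "(\<And>i. i \<in> I \<Longrightarrow> scalar_C1 (p i)) \<Longrightarrow> scalar_C1 (\<lambda>x. \<Sum>i\<in>I. p i x)"
  by (induction I rule: infinite_finite_induct) (auto intro: scalar_C1_const scalar_C1_add)

lemma scalar_C1_prod: "(\<And>i. i \<in> I \<Longrightarrow> scalar_C1 (p i)) \<Longrightarrow> scalar_C1 (\<lambda>x. \<Prod>i\<in>I. p i x)"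
  by (induction I rule: infinite_finite_induct) (auto intro: scalar_C1_const scalar_C1_mult)

lemma scalar_C1_power: "scalar_C1 p \<Longrightarrow> scalar_C1 (\<lambda>x. p x ^ n)"
  by (induction n) (auto intro: scalar_C1_const scalar_C1_mult)

lemma scalar_C1_monomial: "scalar_C1 (monomial \<alpha>)"
  unfolding monomial_def[abs_def] by (intro scalar_C1_prod scalar_C1_power scalar_C1_component)

lemma poly_space_scalar_C1: "p \<in> poly_space k \<Longrightarrow> scalar_C1 p"
  by (auto simp: poly_space_def intro!: scalar_C1_sum scalar_C1_mult scalar_C1_const scalar_C1_monomial)

lemma vector_C1:
  fixes p :: "real^'d::finite \<Rightarrow> real^'d"
  assumes "\<And>i. scalar_C1 (\<lambda>x. p x $ i)"
  shows "\<exists>p'. (\<forall>x. (p has_derivative (\<lambda>h. p' x *v h)) (at x)) \<and> continuous_on UNIV p'"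
proof -
  have "\<forall>i. \<exists>g. (\<forall>x. ((\<lambda>x. p x $ i) has_derivative (\<lambda>h. g x \<bullet> h)) (at x)) \<and> continuous_on UNIV g"
    using assms by (simp add: scalar_C1_def)
  then obtain g where g: "\<And>i x. ((\<lambda>x. p x $ i) has_derivative (\<lambda>h. g i x \<bullet> h)) (at x)"
    "\<And>i. continuous_on UNIV (g i)"
    unfolding choice_iff by blast
  have "(p has_derivative (\<lambda>h. (\<chi> i. g i x) *v h)) (at x)" for x
  proof (subst has_derivative_componentwise_within, rule ballI)
    fix b :: "real^'d" assume "b \<in> Basis"
    then obtain i where b: "b = axis i 1" by (auto simp: Basis_vec_def)
    show "((\<lambda>x. p x \<bullet> b) has_derivative (\<lambda>y. ((\<chi> i. g i x) *v y) \<bullet> b)) (at x)"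
      using g(1)[of i x] by (simp add: b inner_axis matrix_vector_mult_def) (simp add: inner_vec_def)
  qed
  moreover have "continuous_on UNIV (\<lambda>x. \<chi> i. g i x)"
    by (intro continuous_on_vec_lambda g)
  ultimately show ?thesis
    by (intro exI[of _ "\<lambda>x. \<chi> i. g i x"] conjI allI)
qed

definition multi_indices :: "nat \<Rightarrow> ('d::finite \<Rightarrow> nat) set" where
  "multi_indices k = {\<alpha>. (\<Sum>i\<in>UNIV. \<alpha> i) \<le> k}"

lemma finite_multi_indices: "finite (multi_indices k :: ('d::finite \<Rightarrow> nat) set)"
proof (rule finite_subset)
  show "(multi_indices k :: ('d \<Rightarrow> nat) set) \<subseteq> (UNIV :: 'd set) \<rightarrow>\<^sub>E {..k}"
  proof
    fix \<alpha> :: "'d \<Rightarrow> nat" assume "\<alpha> \<in> multi_indices k"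
    then have "(\<Sum>i\<in>UNIV. \<alpha> i) \<le> k" by (simp add: multi_indices_def)
    moreover have "\<alpha> i \<le> (\<Sum>i\<in>UNIV. \<alpha> i)" for i by (rule member_le_sum) auto
    ultimately show "\<alpha> \<in> UNIV \<rightarrow>\<^sub>E {..k}" by (auto intro: order_trans)
  qed
qed (auto intro: finite_PiE)

lemma poly_spaceI:
  "(\<And>x. p x = (\<Sum>\<alpha>\<in>multi_indices k. c \<alpha> * monomial \<alpha> x)) \<Longrightarrow> p \<in> poly_space k"
  unfolding poly_space_def multi_indices_def by blast

lemma poly_spaceE:
  assumes "p \<in> poly_space k"
  obtains c where "\<And>x. p x = (\<Sum>\<alpha>\<in>multi_indices k. c \<alpha> * monomial \<alpha> x)"
  using assms unfolding poly_space_def multi_indices_def by blast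

lemma poly_space_mono:
  fixes p :: "real^'d::finite \<Rightarrow> real"
  assumes "p \<in> poly_space k" "k \<le> m"
  shows "p \<in> poly_space m"
proof -
  obtain c where c: "\<And>x. p x = (\<Sum>\<alpha> \<in> multi_indices k. c \<alpha> * monomial \<alpha> x)"
    using poly_spaceE[OF assms(1)] by blast
  have sub: "multi_indices k \<subseteq> (multi_indices m :: ('d \<Rightarrow> nat) set)"
    using assms(2) by (auto simp: multi_indices_def)
  show ?thesis
  proof (rule poly_spaceI)
    fix x
    show "p x = (\<Sum>\<alpha>\<in>multi_indices m. (if \<alpha> \<in> multi_indices k then c \<alpha> else 0) * monomial \<alpha> x)"
      unfolding c using sub by (intro sum.mono_neutral_cong_left finite_multi_indices) auto
  qed
qed

lemma poly_space_add:
  assumes "p \<in> poly_space k" "q \<in> poly_space k"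
  shows "(\<lambda>x. p x + q x) \<in> poly_space k"
proof -
  obtain c where c: "\<And>x. p x = (\<Sum>\<alpha> \<in> multi_indices k. c \<alpha> * monomial \<alpha> x)"
    using poly_spaceE[OF assms(1)] by blast
  obtain d where d: "\<And>x. q x = (\<Sum>\<alpha> \<in> multi_indices k. d \<alpha> * monomial \<alpha> x)"
    using poly_spaceE[OF assms(2)] by blast
  show ?thesis
    by (rule poly_spaceI[where c="\<lambda>\<alpha>. c \<alpha> + d \<alpha>"]) (simp add: c d sum.distrib distrib_right)
qed

lemma poly_space_scale:
  assumes "p \<in> poly_space k"
  shows "(\<lambda>x. r * p x) \<in> poly_space k"
proof -
  obtain c where c: "\<And>x. p x = (\<Sum>\<alpha> \<in> multi_indices k. c \<alpha> * monomial \<alpha> x)"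
    using poly_spaceE[OF assms] by blast
  show ?thesis
    by (rule poly_spaceI[where c="\<lambda>\<alpha>. r * c \<alpha>"]) (simp add: c sum_distrib_left mult.assoc)
qed

lemma poly_space_zero: "(\<lambda>x. 0) \<in> poly_space k"
  unfolding poly_space_def by (auto intro!: exI[of _ "\<lambda>_. 0"])

lemma poly_space_sum:
  "(\<And>i. i \<in> I \<Longrightarrow> p i \<in> poly_space k) \<Longrightarrow> (\<lambda>x. \<Sum>i\<in>I. p i x) \<in> poly_space k"
  by (induction I rule: infinite_finite_induct) (auto intro: poly_space_zero poly_space_add)

lemma monomial_in_poly_space:
  fixes \<alpha> :: "'d::finite \<Rightarrow> nat"
  assumes "\<alpha> \<in> multi_indices k"
  shows "monomial \<alpha> \<in> poly_space k"
proof (rule poly_spaceI)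
  fix x :: "real^'d"
  have "(\<Sum>\<beta>\<in>multi_indices k. (if \<beta> = \<alpha> then 1 else 0) * monomial \<beta> x) =
      (\<Sum>\<beta>\<in>multi_indices k. if \<beta> = \<alpha> then monomial \<beta> x else 0)"
    by (intro sum.cong) auto
  also have "\<dots> = monomial \<alpha> x"
    using assms finite_multi_indices[where 'd='d] by simp
  finally show "monomial \<alpha> x = (\<Sum>\<beta>\<in>multi_indices k. (if \<beta> = \<alpha> then 1 else 0) * monomial \<beta> x)" ..
qed

lemma monomial_mult_component:
  "monomial \<alpha> x * x $ i = monomial (\<alpha>(i := Suc (\<alpha> i))) x"
proof -
  have "monomial (\<alpha>(i := Suc (\<alpha> i))) x = x $ i ^ Suc (\<alpha> i) * (\<Prod>j\<in>UNIV - {i}. x $ j ^ \<alpha> j)"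
    unfolding monomial_def by (subst prod.remove[of _ i]) (auto intro!: prod.cong)
  moreover have "monomial \<alpha> x = x $ i ^ \<alpha> i * (\<Prod>j\<in>UNIV - {i}. x $ j ^ \<alpha> j)"
    unfolding monomial_def by (subst prod.remove[of _ i]) auto
  ultimately show ?thesis by simp
qed

lemma homogeneous_mult_component:
  assumes "r \<in> homogeneous_poly_space k"
  shows "(\<lambda>x. r x * x $ i) \<in> poly_space (Suc k)"
proof -
  obtain c where c: "r = (\<lambda>x. \<Sum>\<alpha> | (\<Sum>i\<in>UNIV. \<alpha> i) = k. c \<alpha> * monomial \<alpha> x)"
    using assms unfolding homogeneous_poly_space_def by blast
  have "(\<lambda>x. r x * x $ i) = (\<lambda>x. \<Sum>\<alpha> | (\<Sum>i\<in>UNIV. \<alpha> i) = k. c \<alpha> * monomial (\<alpha>(i := Suc (\<alpha> i))) x)"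
    unfolding c by (simp add: sum_distrib_right mult.assoc monomial_mult_component)
  moreover have "\<alpha>(i := Suc (\<alpha> i)) \<in> multi_indices (Suc k)" if "(\<Sum>i\<in>UNIV. \<alpha> i) = k" for \<alpha>
  proof -
    have "(\<Sum>j\<in>UNIV. (\<alpha>(i := Suc (\<alpha> i))) j) = Suc (\<alpha> i) + (\<Sum>j\<in>UNIV - {i}. \<alpha> j)"
      by (subst sum.remove[of _ i]) (auto intro!: sum.cong)
    moreover have "(\<Sum>j\<in>UNIV. \<alpha> j) = \<alpha> i + (\<Sum>j\<in>UNIV - {i}. \<alpha> j)"
      by (subst sum.remove[of _ i]) auto
    ultimately show ?thesis using that by (simp add: multi_indices_def)
  qed
  ultimately show ?thesis
    by (auto intro!: poly_space_sum poly_space_scale monomial_in_poly_space)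
qed

text \<open>The radial term of the Raviart-Thomas space has degree at most \<open>k + 1\<close>. The
  same bound is used for both families, so that one finite set of monomials serves them all.\<close>

lemma local_space_component:
  assumes "p \<in> local_space fam k"
  shows "(\<lambda>x. p x $ i) \<in> poly_space (Suc k)"
proof (cases fam)
  case RT
  then obtain q r where q: "q \<in> vector_poly_space k" and r: "r \<in> homogeneous_poly_space k"
    and p: "p = (\<lambda>x. q x + r x *\<^sub>R x)"
    using assms by auto
  have "(\<lambda>x. q x $ i) \<in> poly_space (Suc k)"
    using q poly_space_mono[of _ k "Suc k"] by (auto simp: vector_poly_space_def)
  from poly_space_add[OF this homogeneous_mult_component[OF r]] show ?thesis by (simp add: p)
next
  case BDM
  then show ?thesis
    using assms poly_space_mono[of _ k "Suc k"] by (auto simp: vector_poly_space_def)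
qed

lemma (in valid_mesh) V_h_pw_C1:
  assumes "v \<in> V_h D"
  shows "pw_C1 v"
  unfolding pw_C1_def
proof
  fix K assume "K \<in> mesh D"
  then obtain p where p: "p \<in> local_space (family D) (space_degree D)" "\<forall>x\<in>interior K. v x = p x"
    using assms by (auto simp: V_h_def)
  have "scalar_C1 (\<lambda>x. p x $ i)" for i
    using local_space_component[OF p(1)] poly_space_scalar_C1 by blast
  from vector_C1[OF this] p(2)
  show "\<exists>p p'. (\<forall>x. (p has_derivative (\<lambda>h. p' x *v h)) (at x)) \<and>
      continuous_on UNIV p' \<and> (\<forall>x\<in>interior K. v x = p x)"
    by blast
qed

section \<open>Square-integrable fields and weak divergences\<close>

lemma L2_inner_integrable:
  assumes "f \<in> L2_space M" "g \<in> L2_space M"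
  shows "integrable M (\<lambda>x. f x \<bullet> g x)"
proof (rule Bochner_Integration.integrable_bound)
  show "integrable M (\<lambda>x. (norm (f x))\<^sup>2 + (norm (g x))\<^sup>2)"
    using assms by (auto simp: L2_space_def)
  show "(\<lambda>x. f x \<bullet> g x) \<in> borel_measurable M"
    using assms by (auto simp: L2_space_def)
  show "AE x in M. norm (f x \<bullet> g x) \<le> norm ((norm (f x))\<^sup>2 + (norm (g x))\<^sup>2)"
  proof (rule AE_I2)
    fix x
    have "\<bar>f x \<bullet> g x\<bar> \<le> norm (f x) * norm (g x)" by (rule Cauchy_Schwarz_ineq2)
    also have "\<dots> \<le> (norm (f x))\<^sup>2 + (norm (g x))\<^sup>2"
      using sum_squares_bound[of "norm (f x)" "norm (g x)"] by (simp add: algebra_simps)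
        (smt (verit) norm_ge_zero mult_nonneg_nonneg)
    finally show "norm (f x \<bullet> g x) \<le> norm ((norm (f x))\<^sup>2 + (norm (g x))\<^sup>2)" by simp
  qed
qed

lemma L2_space_lincomb:
  assumes f: "f \<in> L2_space M" and g: "g \<in> L2_space M"
  shows "(\<lambda>x. r *\<^sub>R f x + s *\<^sub>R g x) \<in> L2_space M"
proof -
  have "(norm (r *\<^sub>R f x + s *\<^sub>R g x))\<^sup>2 =
      r\<^sup>2 * (norm (f x))\<^sup>2 + (2 * r * s) * (f x \<bullet> g x) + s\<^sup>2 * (norm (g x))\<^sup>2" for x
    unfolding power2_norm_eq_inner by (simp add: inner_simps inner_commute power2_eq_square algebra_simps)
  moreover have "integrable M (\<lambda>x. r\<^sup>2 * (norm (f x))\<^sup>2 + (2 * r * s) * (f x \<bullet> g x) + s\<^sup>2 * (norm (g x))\<^sup>2)"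
    using f g L2_inner_integrable[OF f g]
    by (intro Bochner_Integration.integrable_add integrable_mult_right) (auto simp: L2_space_def)
  ultimately show ?thesis using f g by (auto simp: L2_space_def)
qed

lemma L2_space_good_cong:
  assumes "good_set M G" "f \<in> L2_space M" "\<And>x. x \<in> G \<Longrightarrow> f x = g x"
  shows "g \<in> L2_space M"
proof -
  have g: "g \<in> borel_measurable M"
    using assms good_set_measurable_cong[of M G f borel g] by (auto simp: L2_space_def)
  have "integrable M (\<lambda>x. (norm (f x))\<^sup>2) \<longleftrightarrow> integrable M (\<lambda>x. (norm (g x))\<^sup>2)"
    using g assms by (intro integrable_cong_AE good_set_AE[OF assms(1)]) (auto simp: L2_space_def)
  then show ?thesis using g assms by (auto simp: L2_space_def)
qed

text \<open>Counterpart of \<open>L2_inner_bdd_lincomb\<close> for fields that are merely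
  square-integrable, such as the data and weak divergences.\<close>

lemma L2_inner_L2_lincomb:
  assumes G: "good_set M G" and f: "f1 \<in> L2_space M" "f2 \<in> L2_space M" and g: "g \<in> L2_space M"
    and eq: "\<And>x. x \<in> G \<Longrightarrow> f x = r *\<^sub>R f1 x + s *\<^sub>R f2 x"
  shows "L2_inner M f g = r * L2_inner M f1 g + s * L2_inner M f2 g"
proof -
  have "f \<in> L2_space M"
    by (rule L2_space_good_cong[OF G L2_space_lincomb[OF f]]) (simp add: eq)
  then have "L2_inner M f g = (LINT x|M. r * (f1 x \<bullet> g x) + s * (f2 x \<bullet> g x))"
    unfolding L2_inner_def using f g
    by (intro integral_cong_AE good_set_AE[OF G]) (auto simp: L2_space_def eq inner_simps)
  also have "\<dots> = r * L2_inner M f1 g + s * L2_inner M f2 g"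
    unfolding L2_inner_def using L2_inner_integrable[OF f(1) g] L2_inner_integrable[OF f(2) g] by simp
  finally show ?thesis .
qed

lemma bdd_meas_L2_space:
  assumes "good_set M G" "bdd_meas M G f"
  shows "f \<in> L2_space M"
proof -
  have "integrable M (\<lambda>x. f x \<bullet> f x)"
    by (intro bdd_meas_integrable[OF assms(1)] bdd_meas_bilinear[OF bounded_bilinear_inner] assms)
  then show ?thesis using assms by (simp add: L2_space_def bdd_meas_def power2_norm_eq_inner)
qed

section \<open>Linear structure of the local and global discrete spaces\<close>

lemma homogeneous_poly_space_lincomb:
  assumes "p \<in> homogeneous_poly_space k" "q \<in> homogeneous_poly_space k"
  shows "(\<lambda>x. r * p x + s * q x) \<in> homogeneous_poly_space k"
proof -
  obtain c where "p = (\<lambda>x. \<Sum>\<alpha> | (\<Sum>i\<in>UNIV. \<alpha> i) = k. c \<alpha> * monomial \<alpha> x)"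
    using assms(1) unfolding homogeneous_poly_space_def by blast
  moreover obtain d where "q = (\<lambda>x. \<Sum>\<alpha> | (\<Sum>i\<in>UNIV. \<alpha> i) = k. d \<alpha> * monomial \<alpha> x)"
    using assms(2) unfolding homogeneous_poly_space_def by blast
  ultimately have "(\<lambda>x. r * p x + s * q x) = (\<lambda>x. \<Sum>\<alpha> | (\<Sum>i\<in>UNIV. \<alpha> i) = k. (r * c \<alpha> + s * d \<alpha>) * monomial \<alpha> x)"
    by (simp add: sum_distrib_left sum.distrib algebra_simps)
  then show ?thesis unfolding homogeneous_poly_space_def
    by (intro CollectI exI[of _ "\<lambda>\<alpha>. r * c \<alpha> + s * d \<alpha>"])
qed

lemma vector_poly_space_lincomb:
  assumes "p \<in> vector_poly_space k" "q \<in> vector_poly_space k"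
  shows "(\<lambda>x. r *\<^sub>R p x + s *\<^sub>R q x) \<in> vector_poly_space k"
  using assms by (auto simp: vector_poly_space_def intro!: poly_space_add poly_space_scale)

lemma local_space_lincomb:
  assumes "p \<in> local_space fam k" "q \<in> local_space fam k"
  shows "(\<lambda>x. r *\<^sub>R p x + s *\<^sub>R q x) \<in> local_space fam k"
proof (cases fam)
  case RT
  then obtain p1 p2 q1 q2 where *: "p1 \<in> vector_poly_space k" "q1 \<in> vector_poly_space k"
    "p2 \<in> homogeneous_poly_space k" "q2 \<in> homogeneous_poly_space k"
    "p = (\<lambda>x. p1 x + p2 x *\<^sub>R x)" "q = (\<lambda>x. q1 x + q2 x *\<^sub>R x)"
    using assms by auto
  have "(\<lambda>x. r *\<^sub>R p x + s *\<^sub>R q x) = (\<lambda>x. (r *\<^sub>R p1 x + s *\<^sub>R q1 x) + (r * p2 x + s * q2 x) *\<^sub>R x)"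
    by (auto simp: * algebra_simps)
  then show ?thesis
    unfolding RT local_space.simps
    by (intro CollectI bexI[OF _ vector_poly_space_lincomb[OF *(1,2), of r s]]
        bexI[OF _ homogeneous_poly_space_lincomb[OF *(3,4), of r s]])
next
  case BDM
  then show ?thesis using assms by (simp add: vector_poly_space_lincomb)
qed

lemma local_space_zero: "(\<lambda>x. 0) \<in> local_space fam k"
proof -
  have v: "(\<lambda>x. 0) \<in> vector_poly_space k"
    by (auto simp: vector_poly_space_def poly_space_zero)
  show ?thesis
  proof (cases fam)
    case RT
    have "(\<lambda>x. 0) \<in> homogeneous_poly_space k"
      by (auto simp: homogeneous_poly_space_def intro!: exI[of _ "\<lambda>_. 0"])
    with v RT show ?thesis by (auto intro!: bexI[of _ "\<lambda>x. 0"])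
  qed (simp add: v)
qed

context valid_mesh
begin

text \<open>Test functions for the normal trace need not have compact support, but a continuous
  function is bounded on the finitely many compact elements.\<close>

lemma smooth_L2:
  assumes "smooth \<phi>"
  shows "\<phi> \<in> L2_space (vol D)" "grad \<phi> \<in> L2_space (vol D)"
proof -
  have 1: "continuously_diff (Suc 0) \<phi>" and 0: "continuously_diff 0 \<phi>"
    using assms unfolding smooth_def by blast+
  have c: "continuous_on UNIV \<phi>" using 0 by simp
  have "continuous_on UNIV (\<lambda>x. frechet_derivative \<phi> (at x) (axis i 1))" for i
    using 1 by simp
  then have g: "continuous_on UNIV (grad \<phi>)"
    unfolding grad_def[abs_def] by (rule continuous_on_vec_lambda)
  have "pw_cont \<phi>" "pw_cont (grad \<phi>)" unfolding pw_cont_def using c g by blast+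
  then show "\<phi> \<in> L2_space (vol D)" "grad \<phi> \<in> L2_space (vol D)"
    by (auto intro: bdd_meas_L2_space[OF good_vol] pw_cont_bdd_meas)
qed

lemma has_weak_div_lincomb:
  assumes "has_weak_div \<Omega> v1 g1" "has_weak_div \<Omega> v2 g2"
    and eq: "\<And>x. x \<in> G \<Longrightarrow> v x = r *\<^sub>R v1 x + s *\<^sub>R v2 x"
  shows "has_weak_div \<Omega> v (\<lambda>x. r * g1 x + s * g2 x)"
proof -
  have L2: "v1 \<in> L2_space (vol D)" "v2 \<in> L2_space (vol D)" "g1 \<in> L2_space (vol D)" "g2 \<in> L2_space (vol D)"
    using assms by (auto simp: has_weak_div_def)
  have "v \<in> L2_space (vol D)"
    by (rule L2_space_good_cong[OF good_vol L2_space_lincomb[OF L2(1,2)]]) (simp add: eq)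
  moreover have "(\<lambda>x. r * g1 x + s * g2 x) \<in> L2_space (vol D)"
    using L2_space_lincomb[OF L2(3,4), of r s] by simp
  moreover have "L2_inner (vol D) v (grad \<phi>) = - L2_inner (vol D) (\<lambda>x. r * g1 x + s * g2 x) \<phi>"
    if \<phi>: "smooth \<phi>" "compact (closure {x. \<phi> x \<noteq> 0})" "closure {x. \<phi> x \<noteq> 0} \<subseteq> \<Omega>" for \<phi>
  proof -
    have "L2_inner (vol D) v (grad \<phi>) = r * L2_inner (vol D) v1 (grad \<phi>) + s * L2_inner (vol D) v2 (grad \<phi>)"
      by (rule L2_inner_L2_lincomb[OF good_vol L2(1,2) smooth_L2(2)[OF \<phi>(1)] eq])
    moreover have "L2_inner (vol D) (\<lambda>x. r * g1 x + s * g2 x) \<phi> =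
        r * L2_inner (vol D) g1 \<phi> + s * L2_inner (vol D) g2 \<phi>"
      by (rule L2_inner_L2_lincomb[OF good_vol L2(3,4) smooth_L2(1)[OF \<phi>(1)]]) simp
    moreover have "L2_inner (vol D) v1 (grad \<phi>) = - L2_inner (vol D) g1 \<phi>"
      "L2_inner (vol D) v2 (grad \<phi>) = - L2_inner (vol D) g2 \<phi>"
      using assms(1,2) \<phi> unfolding has_weak_div_def by blast+
    ultimately show ?thesis by simp
  qed
  ultimately show ?thesis by (auto simp: has_weak_div_def)
qed

lemma zero_normal_trace_lincomb:
  assumes "zero_normal_trace \<Omega> v1" "zero_normal_trace \<Omega> v2"
    and eq: "\<And>x. x \<in> G \<Longrightarrow> v x = r *\<^sub>R v1 x + s *\<^sub>R v2 x"
  shows "zero_normal_trace \<Omega> v"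
proof -
  obtain g1 g2 where g: "has_weak_div \<Omega> v1 g1" "has_weak_div \<Omega> v2 g2"
    and z1: "\<And>\<phi>. smooth \<phi> \<Longrightarrow> L2_inner (vol D) v1 (grad \<phi>) + L2_inner (vol D) g1 \<phi> = 0"
    and z2: "\<And>\<phi>. smooth \<phi> \<Longrightarrow> L2_inner (vol D) v2 (grad \<phi>) + L2_inner (vol D) g2 \<phi> = 0"
    using assms(1,2) by (auto simp: zero_normal_trace_def)
  then have L2: "v1 \<in> L2_space (vol D)" "v2 \<in> L2_space (vol D)" "g1 \<in> L2_space (vol D)" "g2 \<in> L2_space (vol D)"
    by (auto simp: has_weak_div_def)
  have "L2_inner (vol D) v (grad \<phi>) + L2_inner (vol D) (\<lambda>x. r * g1 x + s * g2 x) \<phi> = 0"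
    if \<phi>: "smooth \<phi>" for \<phi>
  proof -
    have "L2_inner (vol D) v (grad \<phi>) = r * L2_inner (vol D) v1 (grad \<phi>) + s * L2_inner (vol D) v2 (grad \<phi>)"
      by (rule L2_inner_L2_lincomb[OF good_vol L2(1,2) smooth_L2(2)[OF \<phi>(1)] eq])
    moreover have "L2_inner (vol D) (\<lambda>x. r * g1 x + s * g2 x) \<phi> =
        r * L2_inner (vol D) g1 \<phi> + s * L2_inner (vol D) g2 \<phi>"
      by (rule L2_inner_L2_lincomb[OF good_vol L2(3,4) smooth_L2(1)[OF \<phi>(1)]]) simp
    ultimately have "L2_inner (vol D) v (grad \<phi>) + L2_inner (vol D) (\<lambda>x. r * g1 x + s * g2 x) \<phi> =
        r * (L2_inner (vol D) v1 (grad \<phi>) + L2_inner (vol D) g1 \<phi>) +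
        s * (L2_inner (vol D) v2 (grad \<phi>) + L2_inner (vol D) g2 \<phi>)"
      by (simp add: algebra_simps)
    then show ?thesis using z1[OF \<phi>] z2[OF \<phi>] by simp
  qed
  then show ?thesis
    using has_weak_div_lincomb[OF g eq] unfolding zero_normal_trace_def by blast
qed

text \<open>Stationary version of \<open>Z_ht\<close>: it is the space of the coefficient fields in
  time.\<close>

definition Z_h :: "(real^'d \<Rightarrow> real^'d) set" where
  "Z_h = {v \<in> V_h D. has_weak_div \<Omega> v (\<lambda>_. 0) \<and> zero_normal_trace \<Omega> v}"

lemma V_h_lincomb:
  assumes v: "v1 \<in> V_h D" "v2 \<in> V_h D" and eq: "\<And>x. x \<in> G \<Longrightarrow> v x = r *\<^sub>R v1 x + s *\<^sub>R v2 x"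
  shows "v \<in> V_h D"
proof -
  have "v \<in> Hdiv \<Omega>"
  proof -
    obtain g1 g2 where "has_weak_div \<Omega> v1 g1" "has_weak_div \<Omega> v2 g2"
      using v by (auto simp: V_h_def Hdiv_def)
    from has_weak_div_lincomb[OF this eq] show ?thesis unfolding Hdiv_def by blast
  qed
  moreover have "\<exists>p\<in>local_space (family D) (space_degree D). \<forall>x\<in>interior K. v x = p x" if K: "K \<in> mesh D" for K
  proof -
    obtain p where p: "p \<in> local_space (family D) (space_degree D)" "\<forall>x\<in>interior K. v1 x = p x"
      using v K by (auto simp: V_h_def)
    obtain q where q: "q \<in> local_space (family D) (space_degree D)" "\<forall>x\<in>interior K. v2 x = q x"
      using v K by (auto simp: V_h_def)
    have "interior K \<subseteq> G" using K by (auto simp: mesh_interior_def)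
    then show ?thesis
      using p q eq by (intro bexI[OF _ local_space_lincomb[OF p(1) q(1), of r s]]) auto
  qed
  ultimately show ?thesis by (simp add: V_h_def)
qed

text \<open>With coefficients 1 and 0 this also says that values on the skeleton do not affect
  membership.\<close>

lemma Z_h_lincomb:
  assumes v: "v1 \<in> Z_h" "v2 \<in> Z_h" and eq: "\<And>x. x \<in> G \<Longrightarrow> v x = r *\<^sub>R v1 x + s *\<^sub>R v2 x"
  shows "v \<in> Z_h"
proof -
  have "has_weak_div \<Omega> v (\<lambda>x. r * 0 + s * 0)"
    by (rule has_weak_div_lincomb[OF _ _ eq]) (use v in \<open>auto simp: Z_h_def\<close>)
  moreover have "zero_normal_trace \<Omega> v"
    by (rule zero_normal_trace_lincomb[OF _ _ eq]) (use v in \<open>auto simp: Z_h_def\<close>)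
  moreover have "v \<in> V_h D"
    by (rule V_h_lincomb[OF _ _ eq]) (use v in \<open>auto simp: Z_h_def\<close>)
  ultimately show ?thesis by (simp add: Z_h_def)
qed

lemma has_weak_div_zero: "has_weak_div \<Omega> (\<lambda>x. 0) (\<lambda>x. 0)"
  by (simp add: has_weak_div_def L2_space_def L2_inner_def)

lemma zero_normal_trace_zero: "zero_normal_trace \<Omega> (\<lambda>x. 0)"
  unfolding zero_normal_trace_def
  by (intro exI[of _ "\<lambda>x. 0"]) (simp add: has_weak_div_zero L2_inner_def)

lemma Z_h_zero: "(\<lambda>x. 0) \<in> Z_h"
proof -
  have "(\<lambda>x. 0) \<in> V_h D"
    unfolding V_h_def Hdiv_def using has_weak_div_zero
    by (auto intro!: bexI[OF _ local_space_zero])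
  then show ?thesis by (simp add: Z_h_def has_weak_div_zero zero_normal_trace_zero)
qed

lemma V_h_zero: "(\<lambda>x. 0) \<in> V_h D"
  using Z_h_zero by (simp add: Z_h_def)

lemma V_h_sum:
  assumes "finite I" "\<And>i. i \<in> I \<Longrightarrow> c i \<in> V_h D" "\<And>x. x \<in> G \<Longrightarrow> v x = (\<Sum>i\<in>I. r i *\<^sub>R c i x)"
  shows "v \<in> V_h D"
  using assms
proof (induction I arbitrary: v)
  case empty
  show ?case by (rule V_h_lincomb[OF V_h_zero V_h_zero]) (use empty in simp)
next
  case (insert i I)
  have "(\<lambda>x. \<Sum>i\<in>I. r i *\<^sub>R c i x) \<in> V_h D" by (rule insert.IH) (use insert.prems in auto)
  then show ?case
    by (rule V_h_lincomb[of "c i" _ _ "r i" 1, rotated]) (use insert in auto)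
qed

lemma Z_h_sum:
  assumes "finite I" "\<And>i. i \<in> I \<Longrightarrow> c i \<in> Z_h" "\<And>x. x \<in> G \<Longrightarrow> v x = (\<Sum>i\<in>I. r i *\<^sub>R c i x)"
  shows "v \<in> Z_h"
  using assms
proof (induction I arbitrary: v)
  case empty
  show ?case by (rule Z_h_lincomb[OF Z_h_zero Z_h_zero]) (use empty in simp)
next
  case (insert i I)
  have "(\<lambda>x. \<Sum>i\<in>I. r i *\<^sub>R c i x) \<in> Z_h" by (rule insert.IH) (use insert.prems in auto)
  then show ?case
    by (rule Z_h_lincomb[of "c i" _ _ "r i" 1, rotated]) (use insert in auto)
qed

end

section \<open>Discrete divergence-free functions\<close>

text \<open>Lagrange interpolation at \<open>l + 1\<close> points: the weights \<open>a\<close>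
  depend on the points alone, so each coefficient is a fixed linear combination of values. This
  yields both the uniqueness of coefficients and the transfer of linear constraints from values to
  coefficients.\<close>

lemma poly_coeffs_from_values:
  fixes T :: "real set"
  assumes T: "finite T" "card T = Suc l"
  shows "\<exists>a. \<forall>c :: nat \<Rightarrow> 'v::real_vector. \<forall>k\<le>l. c k = (\<Sum>s\<in>T. a k s *\<^sub>R (\<Sum>i\<le>l. s ^ i *\<^sub>R c i))"
proof -
  \<comment> \<open>Lagrange polynomial of the point \<open>s\<close>; its coefficients are the
    weights sought.\<close>
  define L where "L s = (\<Prod>m\<in>T - {s}. smult (1 / (s - m)) [:- m, 1:])" for s :: real
  have L_val: "poly (L s) t = (if s = t then 1 else 0)" if "s \<in> T" "t \<in> T" for s t
  proof (cases "s = t")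
    case True
    then show ?thesis by (auto simp: L_def poly_prod diff_divide_distrib[symmetric] intro!: prod.neutral)
  next
    case False
    then have "t \<in> T - {s}" using that by auto
    then have "poly (L s) t = 0"
      unfolding L_def poly_prod using T(1) by (intro prod_zero) (auto intro!: bexI[of _ t])
    with False show ?thesis by simp
  qed
  have L_deg: "degree (L s) \<le> l" if "s \<in> T" for s
  proof -
    have "degree (L s) \<le> (\<Sum>m\<in>T - {s}. degree (smult (1 / (s - m)) [:- m, 1:]))"
      unfolding L_def
      using degree_prod_sum_le[of "T - {s}" "\<lambda>m. smult (1 / (s - m)) [:- m, 1:]"] T(1)
      unfolding comp_def by blast
    also have "\<dots> \<le> (\<Sum>m\<in>T - {s}. 1)" by (intro sum_mono) auto
    also have "\<dots> = l" using T that by simp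
    finally show ?thesis .
  qed
  \<comment> \<open>A monomial of degree at most \<open>l\<close> is its own interpolant; comparing
    coefficients gives the duality relation \<open>delta\<close>.\<close>
  have mon: "monom 1 i = (\<Sum>s\<in>T. smult (s ^ i) (L s))" if "i \<le> l" for i
  proof (rule poly_eqI_degree[of T])
    fix t assume "t \<in> T"
    have "poly (\<Sum>s\<in>T. smult (s ^ i) (L s)) t = (\<Sum>s\<in>T. if s = t then s ^ i else 0)"
      unfolding poly_sum by (intro sum.cong) (auto simp: L_val \<open>t \<in> T\<close>)
    also have "\<dots> = t ^ i" using T(1) \<open>t \<in> T\<close> by simp
    finally show "poly (monom 1 i) t = poly (\<Sum>s\<in>T. smult (s ^ i) (L s)) t"
      by (simp add: poly_monom)
  next
    show "degree (monom (1::real) i) < card T" using that T by (simp add: degree_monom_eq)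
    have "degree (\<Sum>s\<in>T. smult (s ^ i) (L s)) \<le> l"
      by (intro degree_sum_le T) (rule order_trans[OF degree_smult_le L_deg])
    then show "degree (\<Sum>s\<in>T. smult (s ^ i) (L s)) < card T" using T by simp
  qed
  have "c k = (\<Sum>s\<in>T. coeff (L s) k *\<^sub>R (\<Sum>i\<le>l. s ^ i *\<^sub>R c i))" if "k \<le> l" for c :: "nat \<Rightarrow> 'v" and k
  proof -
    have delta: "(\<Sum>s\<in>T. s ^ i * coeff (L s) k) = (if i = k then 1 else 0)" if "i \<le> l" for i
      using arg_cong[OF mon[OF that], of "\<lambda>p. coeff p k"] by (simp add: coeff_sum)
    have "(\<Sum>s\<in>T. coeff (L s) k *\<^sub>R (\<Sum>i\<le>l. s ^ i *\<^sub>R c i)) =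
        (\<Sum>s\<in>T. \<Sum>i\<le>l. (s ^ i * coeff (L s) k) *\<^sub>R c i)"
      by (simp add: scaleR_sum_right mult.commute)
    also have "\<dots> = (\<Sum>i\<le>l. \<Sum>s\<in>T. (s ^ i * coeff (L s) k) *\<^sub>R c i)" by (rule sum.swap)
    also have "\<dots> = (\<Sum>i\<le>l. (if i = k then 1 else 0) *\<^sub>R c i)"
      by (intro sum.cong) (auto simp: scaleR_sum_left[symmetric] delta)
    also have "\<dots> = (\<Sum>i\<le>l. if i = k then c i else 0)"
      by (intro sum.cong) auto
    also have "\<dots> = c k" using that by simp
    finally show ?thesis ..
  qed
  then show ?thesis by (intro exI[of _ "\<lambda>k s. coeff (L s) k"]) blast
qed

context valid_mesh
begin

abbreviation "steps \<equiv> {1..num_steps D}"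
abbreviation "deg \<equiv> time_degree D"

lemma time_pt_step: "n \<in> steps \<Longrightarrow> time_pt D (n - 1) < time_pt D n"
proof -
  assume "n \<in> steps"
  then have "n - 1 < num_steps D" "Suc (n - 1) = n" by auto
  then show ?thesis using valid unfolding valid_discretization_def by metis
qed

lemma time_pt_mono: "i \<le> j \<Longrightarrow> j \<le> num_steps D \<Longrightarrow> time_pt D i \<le> time_pt D j"
proof (induction rule: dec_induct)
  case (step k)
  then show ?case using time_pt_step[of "Suc k"] by auto
qed auto

lemma slab_infinite: "n \<in> steps \<Longrightarrow> infinite (slab D n)"
  using time_pt_step by (simp add: slab_def infinite_Ioo_iff)

lemma slab_unique: "n \<in> steps \<Longrightarrow> m \<in> steps \<Longrightarrow> t \<in> slab D n \<Longrightarrow> t \<in> slab D m \<Longrightarrow> n = m"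
proof (rule ccontr)
  assume *: "n \<in> steps" "m \<in> steps" "t \<in> slab D n" "t \<in> slab D m" "n \<noteq> m"
  then consider "n \<le> m - 1" | "m \<le> n - 1" by fastforce
  then show False
  proof cases
    case 1
    moreover have "m - 1 \<le> num_steps D" using *(2) by auto
    ultimately have "time_pt D n \<le> time_pt D (m - 1)" by (rule time_pt_mono)
    then show ?thesis using *(3,4) by (simp add: slab_def)
  next
    case 2
    moreover have "n - 1 \<le> num_steps D" using *(1) by auto
    ultimately have "time_pt D m \<le> time_pt D (n - 1)" by (rule time_pt_mono)
    then show ?thesis using *(3,4) by (simp add: slab_def)
  qed
qed

lemma slab_coeffs_unique:
  fixes c d :: "nat \<Rightarrow> 'v::real_vector"
  assumes "n \<in> steps" "\<And>t. t \<in> slab D n \<Longrightarrow> (\<Sum>i\<le>deg. t ^ i *\<^sub>R c i) = (\<Sum>i\<le>deg. t ^ i *\<^sub>R d i)" "i \<le> deg"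
  shows "c i = d i"
proof -
  obtain T where T: "finite T" "card T = Suc deg" "T \<subseteq> slab D n"
    using infinite_arbitrarily_large[OF slab_infinite[OF assms(1)]] by blast
  obtain a where a: "\<And>(c :: nat \<Rightarrow> 'v) k. k \<le> deg \<Longrightarrow> c k = (\<Sum>s\<in>T. a k s *\<^sub>R (\<Sum>i\<le>deg. s ^ i *\<^sub>R c i))"
    using poly_coeffs_from_values[OF T(1,2), where 'v='v] by blast
  have "c i = (\<Sum>s\<in>T. a i s *\<^sub>R (\<Sum>j\<le>deg. s ^ j *\<^sub>R c j))" by (rule a[OF assms(3)])
  also have "\<dots> = (\<Sum>s\<in>T. a i s *\<^sub>R (\<Sum>j\<le>deg. s ^ j *\<^sub>R d j))"
    using T(3) assms(2) by (intro sum.cong) auto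
  also have "\<dots> = d i" by (rule a[OF assms(3), symmetric])
  finally show ?thesis .
qed

text \<open>A slab contains infinitely many times, so the coefficients are unique and the definite
  description in \<open>slab_extension\<close> is well posed.\<close>

lemma slab_extension_eq:
  assumes "n \<in> steps" "\<And>t. t \<in> slab D n \<Longrightarrow> g t = (\<Sum>i\<le>deg. t ^ i *\<^sub>R c i)"
  shows "slab_extension D n g = (\<lambda>t. \<Sum>i\<le>deg. t ^ i *\<^sub>R c i)"
  unfolding slab_extension_def
proof (rule the_equality)
  show "(\<exists>c'. (\<lambda>t. \<Sum>i\<le>deg. t ^ i *\<^sub>R c i) = (\<lambda>t. \<Sum>i\<le>deg. t ^ i *\<^sub>R c' i)) \<and>
      (\<forall>t\<in>slab D n. (\<Sum>i\<le>deg. t ^ i *\<^sub>R c i) = g t)"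
    using assms(2) by auto
next
  fix q assume "(\<exists>c. q = (\<lambda>t. \<Sum>i\<le>deg. t ^ i *\<^sub>R c i)) \<and> (\<forall>t\<in>slab D n. q t = g t)"
  then obtain d where d: "q = (\<lambda>t. \<Sum>i\<le>deg. t ^ i *\<^sub>R d i)" and qg: "\<forall>t\<in>slab D n. q t = g t"
    by (elim conjE exE)
  have "(\<Sum>i\<le>deg. t ^ i *\<^sub>R d i) = (\<Sum>i\<le>deg. t ^ i *\<^sub>R c i)" if "t \<in> slab D n" for t
    using qg that assms(2)[OF that] unfolding d by simp
  from slab_coeffs_unique[OF assms(1) this] have "d i = c i" if "i \<le> deg" for i
    using that by blast
  then show "q = (\<lambda>t. \<Sum>i\<le>deg. t ^ i *\<^sub>R c i)" using d by simp
qed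

text \<open>\<open>Z_ht\<close> constrains the values in time and not the coefficients. Each
  coefficient is a combination of values at \<open>deg + 1\<close> times of the slab, and is
  therefore itself divergence-free with zero normal trace.\<close>

lemma Z_htD:
  assumes u: "u \<in> Z_ht D" and n: "n \<in> steps"
  shows "\<exists>c. (\<forall>i\<le>deg. c i \<in> Z_h) \<and>
    (\<forall>t\<in>slab D n. \<forall>x\<in>\<Omega>. u t x = (\<Sum>i\<le>deg. t ^ i *\<^sub>R c i x))"
proof -
  obtain c where c: "\<And>i. i \<le> deg \<Longrightarrow> c i \<in> V_h D"
    "\<And>t x. t \<in> slab D n \<Longrightarrow> x \<in> \<Omega> \<Longrightarrow> u t x = (\<Sum>i\<le>deg. t ^ i *\<^sub>R c i x)"
    using u n unfolding Z_ht_def V_ht_def by blast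
  have uZ: "u t \<in> Z_h" if "t \<in> slab D n" for t
  proof -
    have "u t \<in> V_h D"
      by (rule V_h_sum[of "{..deg}" c]) (use c that mesh_interior_subset in auto)
    moreover have "has_weak_div \<Omega> (u t) (\<lambda>_. 0)" "zero_normal_trace \<Omega> (u t)"
      using u n that by (auto simp: Z_ht_def V_ht_def)
    ultimately show ?thesis by (simp add: Z_h_def)
  qed
  obtain T where T: "finite T" "card T = Suc deg" "T \<subseteq> slab D n"
    using infinite_arbitrarily_large[OF slab_infinite[OF n]] by blast
  obtain a where a: "\<And>(c :: nat \<Rightarrow> real^'d) k. k \<le> deg \<Longrightarrow> c k = (\<Sum>s\<in>T. a k s *\<^sub>R (\<Sum>i\<le>deg. s ^ i *\<^sub>R c i))"
    using poly_coeffs_from_values[OF T(1,2), where 'v="real^'d"] by blast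
  have "c k \<in> Z_h" if "k \<le> deg" for k
  proof (rule Z_h_sum[OF T(1), of u])
    show "u s \<in> Z_h" if "s \<in> T" for s using uZ T(3) that by blast
    fix x assume "x \<in> G"
    then have "x \<in> \<Omega>" using mesh_interior_subset by blast
    have "c k x = (\<Sum>s\<in>T. a k s *\<^sub>R (\<Sum>i\<le>deg. s ^ i *\<^sub>R c i x))" by (rule a[OF that])
    also have "\<dots> = (\<Sum>s\<in>T. a k s *\<^sub>R u s x)"
      using T(3) c(2) \<open>x \<in> \<Omega>\<close> by (intro sum.cong) (auto simp: subset_iff)
    finally show "c k x = (\<Sum>s\<in>T. a k s *\<^sub>R u s x)" .
  qed
  with c(2) show ?thesis by (intro exI[of _ c] conjI allI impI ballI)
qed

lemma Z_htI:
  assumes "\<And>n. n \<in> steps \<Longrightarrow> \<exists>c. (\<forall>i\<le>deg. c i \<in> Z_h) \<and>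
    (\<forall>t\<in>slab D n. \<forall>x\<in>\<Omega>. u t x = (\<Sum>i\<le>deg. t ^ i *\<^sub>R c i x))"
  shows "u \<in> Z_ht D"
proof -
  have uZ: "u t \<in> Z_h" if n: "n \<in> steps" and t: "t \<in> slab D n" for n t
  proof -
    obtain c where c: "\<forall>i\<le>deg. c i \<in> Z_h" "\<forall>t\<in>slab D n. \<forall>x\<in>\<Omega>. u t x = (\<Sum>i\<le>deg. t ^ i *\<^sub>R c i x)"
      using assms[OF n] by blast
    show ?thesis
      by (rule Z_h_sum[of "{..deg}" c _ "\<lambda>i. t ^ i"]) (use c t mesh_interior_subset in auto)
  qed
  have "\<exists>c. (\<forall>i\<le>deg. c i \<in> V_h D) \<and> (\<forall>t\<in>slab D n. \<forall>x\<in>\<Omega>. u t x = (\<Sum>i\<le>deg. t ^ i *\<^sub>R c i x))"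
    if "n \<in> steps" for n
    using assms[OF that] unfolding Z_h_def by blast
  then show ?thesis
    using uZ unfolding Z_ht_def V_ht_def Z_h_def by blast
qed

text \<open>The forms see neither the time nodes nor the skeleton, so linear relations are required only
  away from them.\<close>

definition comb ::
  "real \<Rightarrow> (real \<Rightarrow> real^'d \<Rightarrow> real^'d) \<Rightarrow> real \<Rightarrow> (real \<Rightarrow> real^'d \<Rightarrow> real^'d) \<Rightarrow>
    (real \<Rightarrow> real^'d \<Rightarrow> real^'d) \<Rightarrow> bool" where
  "comb r u1 s u2 u \<longleftrightarrow>
     (\<forall>n\<in>steps. \<forall>t\<in>slab D n. \<forall>x\<in>G. u t x = r *\<^sub>R u1 t x + s *\<^sub>R u2 t x)"

lemma combD: "comb r u1 s u2 u \<Longrightarrow> n \<in> steps \<Longrightarrow> t \<in> slab D n \<Longrightarrow> x \<in> G \<Longrightarrow>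
    u t x = r *\<^sub>R u1 t x + s *\<^sub>R u2 t x"
  by (simp add: comb_def)

lemma tilde_eq:
  assumes n: "n \<in> steps" and t: "t \<in> slab D n"
  shows "tilde D u t x = (if 1 < n then slab_extension D (n - 1) (\<lambda>s. u s x) t else u t x)"
proof -
  have "(LEAST n. t \<le> time_pt D n) = n"
  proof (rule Least_equality)
    show "t \<le> time_pt D n" using t by (simp add: slab_def)
    fix m assume m: "t \<le> time_pt D m"
    show "n \<le> m"
    proof (rule ccontr)
      assume "\<not> n \<le> m"
      then have "time_pt D m \<le> time_pt D (n - 1)"
        using n by (intro time_pt_mono) auto
      then show False using m t by (simp add: slab_def)
    qed
  qed
  then show ?thesis using n by (simp add: tilde_def)
qed

text \<open>On a later slab the extension has the coefficient fields of the previous slab, which lie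
  in \<open>Z_h\<close>. Thus the shifted field is admissible as advection field in the stability
  estimate.\<close>

lemma tilde_Z_ht:
  assumes u: "u \<in> Z_ht D"
  shows "tilde D u \<in> Z_ht D"
proof (rule Z_htI)
  fix n assume n: "n \<in> steps"
  show "\<exists>c. (\<forall>i\<le>deg. c i \<in> Z_h) \<and>
    (\<forall>t\<in>slab D n. \<forall>x\<in>\<Omega>. tilde D u t x = (\<Sum>i\<le>deg. t ^ i *\<^sub>R c i x))"
  proof (cases "1 < n")
    case True
    then have n1: "n - 1 \<in> steps" using n by auto
    obtain c where c_all: "\<forall>i\<le>deg. c i \<in> Z_h"
      "\<forall>t\<in>slab D (n - 1). \<forall>x\<in>\<Omega>. u t x = (\<Sum>i\<le>deg. t ^ i *\<^sub>R c i x)"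
      using Z_htD[OF u n1] by blast
    note c = c_all[rule_format]
    have "tilde D u t x = (\<Sum>i\<le>deg. t ^ i *\<^sub>R c i x)" if "t \<in> slab D n" "x \<in> \<Omega>" for t x
      using tilde_eq[OF n that(1)] slab_extension_eq[OF n1, of "\<lambda>s. u s x" "\<lambda>i. c i x"] c(2) that True
      by simp
    with c(1) show ?thesis by (intro exI[of _ c]) auto
  next
    case False
    obtain c where c_all: "\<forall>i\<le>deg. c i \<in> Z_h"
      "\<forall>t\<in>slab D n. \<forall>x\<in>\<Omega>. u t x = (\<Sum>i\<le>deg. t ^ i *\<^sub>R c i x)"
      using Z_htD[OF u n] by blast
    note c = c_all[rule_format]
    with False show ?thesis using tilde_eq[OF n] c by (intro exI[of _ c]) auto
  qed
qed

text \<open>The coefficients of the previous slab combine linearly, and by uniqueness the extension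
  of the combination is the combination of the extensions.\<close>

lemma tilde_comb:
  assumes u: "u1 \<in> Z_ht D" "u2 \<in> Z_ht D" and c: "comb r u1 s u2 u"
  shows "comb r (tilde D u1) s (tilde D u2) (tilde D u)"
  unfolding comb_def
proof (intro ballI)
  fix n t x assume n: "n \<in> steps" and t: "t \<in> slab D n" and x: "x \<in> G"
  then have x\<Omega>: "x \<in> \<Omega>" using mesh_interior_subset by blast
  show "tilde D u t x = r *\<^sub>R tilde D u1 t x + s *\<^sub>R tilde D u2 t x"
  proof (cases "1 < n")
    case True
    then have n1: "n - 1 \<in> steps" using n by auto
    obtain c1 where c1_all: "\<forall>i\<le>deg. c1 i \<in> Z_h"
      "\<forall>t\<in>slab D (n - 1). \<forall>x\<in>\<Omega>. u1 t x = (\<Sum>i\<le>deg. t ^ i *\<^sub>R c1 i x)"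
      using Z_htD[OF u(1) n1] by blast
    note c1 = c1_all[rule_format]
    obtain c2 where c2_all: "\<forall>i\<le>deg. c2 i \<in> Z_h"
      "\<forall>t\<in>slab D (n - 1). \<forall>x\<in>\<Omega>. u2 t x = (\<Sum>i\<le>deg. t ^ i *\<^sub>R c2 i x)"
      using Z_htD[OF u(2) n1] by blast
    note c2 = c2_all[rule_format]
    have "u t' x = (\<Sum>i\<le>deg. t' ^ i *\<^sub>R (r *\<^sub>R c1 i x + s *\<^sub>R c2 i x))" if "t' \<in> slab D (n - 1)" for t'
      using combD[OF c n1 that x] c1(2)[OF that x\<Omega>] c2(2)[OF that x\<Omega>]
      by (simp add: scaleR_sum_right scaleR_add_right sum.distrib mult.commute)
    from slab_extension_eq[OF n1 this]
    show ?thesis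
      using slab_extension_eq[OF n1, of "\<lambda>s. u1 s x" "\<lambda>i. c1 i x"] c1(2)
        slab_extension_eq[OF n1, of "\<lambda>s. u2 s x" "\<lambda>i. c2 i x"] c2(2) x\<Omega> True
      by (simp add: tilde_eq[OF n t] scaleR_sum_right scaleR_add_right sum.distrib mult.commute)
  next
    case False
    then show ?thesis using combD[OF c n t x] by (simp add: tilde_eq[OF n t])
  qed
qed

lemma Z_ht_lincomb:
  assumes u: "u1 \<in> Z_ht D" "u2 \<in> Z_ht D"
  shows "(\<lambda>t x. r *\<^sub>R u1 t x + s *\<^sub>R u2 t x) \<in> Z_ht D"
proof (rule Z_htI)
  fix n assume n: "n \<in> steps"
  obtain c1 where c1_all: "\<forall>i\<le>deg. c1 i \<in> Z_h"
      "\<forall>t\<in>slab D n. \<forall>x\<in>\<Omega>. u1 t x = (\<Sum>i\<le>deg. t ^ i *\<^sub>R c1 i x)"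
      using Z_htD[OF u(1) n] by blast
    note c1 = c1_all[rule_format]
  obtain c2 where c2_all: "\<forall>i\<le>deg. c2 i \<in> Z_h"
      "\<forall>t\<in>slab D n. \<forall>x\<in>\<Omega>. u2 t x = (\<Sum>i\<le>deg. t ^ i *\<^sub>R c2 i x)"
      using Z_htD[OF u(2) n] by blast
    note c2 = c2_all[rule_format]
  have "(\<lambda>x. r *\<^sub>R c1 i x + s *\<^sub>R c2 i x) \<in> Z_h" if "i \<le> deg" for i
    by (rule Z_h_lincomb[OF c1(1)[OF that] c2(1)[OF that]]) simp
  moreover have "r *\<^sub>R u1 t x + s *\<^sub>R u2 t x = (\<Sum>i\<le>deg. t ^ i *\<^sub>R (r *\<^sub>R c1 i x + s *\<^sub>R c2 i x))"
    if "t \<in> slab D n" "x \<in> \<Omega>" for t x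
    using c1(2)[OF that] c2(2)[OF that]
    by (simp add: scaleR_sum_right scaleR_add_right sum.distrib mult.commute)
  ultimately show "\<exists>c. (\<forall>i\<le>deg. c i \<in> Z_h) \<and>
      (\<forall>t\<in>slab D n. \<forall>x\<in>\<Omega>. r *\<^sub>R u1 t x + s *\<^sub>R u2 t x = (\<Sum>i\<le>deg. t ^ i *\<^sub>R c i x))"
    by (intro exI[of _ "\<lambda>i x. r *\<^sub>R c1 i x + s *\<^sub>R c2 i x"] conjI allI impI ballI)
qed

lemma Z_ht_zero: "(\<lambda>t x. 0) \<in> Z_ht D"
  by (rule Z_htI) (auto intro!: exI[of _ "\<lambda>i x. 0"] Z_h_zero)

end

section \<open>Linearity of the forms\<close>

context valid_mesh
begin

lemma Z_h_pw_C1: "v \<in> Z_h \<Longrightarrow> pw_C1 v"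
  by (simp add: Z_h_def V_h_pw_C1)

lemma Z_ht_pw_C1:
  assumes "u \<in> Z_ht D" "n \<in> steps" "t \<in> slab D n"
  shows "pw_C1 (u t)"
proof -
  obtain c where c: "\<forall>i\<le>deg. c i \<in> Z_h" "\<forall>t\<in>slab D n. \<forall>x\<in>\<Omega>. u t x = (\<Sum>i\<le>deg. t ^ i *\<^sub>R c i x)"
    using Z_htD[OF assms(1,2)] by blast
  have "u t \<in> Z_h"
    by (rule Z_h_sum[of "{..deg}" c _ "\<lambda>i. t ^ i"]) (use c assms(3) mesh_interior_subset in auto)
  then show ?thesis by (rule Z_h_pw_C1)
qed

section \<open>Linear operators with space-time fields as values\<close>

text \<open>Every integrand of the forms is such an operator in each of its arguments, except that
  the upwind term is not linear in the advection field.\<close>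

definition field_op ::
  "(real^'d) measure \<Rightarrow> (real^'d) set \<Rightarrow> nat \<Rightarrow>
    ((real \<Rightarrow> real^'d \<Rightarrow> real^'d) \<Rightarrow> real \<Rightarrow> real^'d \<Rightarrow> 'b::euclidean_space) \<Rightarrow> bool" where
  "field_op M H n f \<longleftrightarrow> good_set M H \<and> n \<in> steps \<and> (\<forall>u\<in>Z_ht D. sep M H (slab D n) (f u)) \<and>
     (\<forall>u\<in>Z_ht D. \<forall>u1\<in>Z_ht D. \<forall>u2\<in>Z_ht D. \<forall>r s. comb r u1 s u2 u \<longrightarrow>
        (\<forall>t\<in>slab D n. \<forall>x\<in>H. f u t x = r *\<^sub>R f u1 t x + s *\<^sub>R f u2 t x))"

lemma field_opD:
  assumes "field_op M H n f"
  shows "good_set M H" "n \<in> steps" "u \<in> Z_ht D \<Longrightarrow> sep M H (slab D n) (f u)"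
    "\<lbrakk>u \<in> Z_ht D; u1 \<in> Z_ht D; u2 \<in> Z_ht D; comb r u1 s u2 u; t \<in> slab D n; x \<in> H\<rbrakk>
      \<Longrightarrow> f u t x = r *\<^sub>R f u1 t x + s *\<^sub>R f u2 t x"
  using assms by (auto simp: field_op_def)

text \<open>A polynomial in time with coefficients \<open>c i\<close> is mapped to the polynomial
  with coefficients \<open>Q (c i)\<close>, which is already of separated form.\<close>

lemma field_op_mesh_op:
  assumes Q: "mesh_op M H Q" and n: "n \<in> steps"
  shows "field_op M H n (\<lambda>u t x. Q (u t) x)"
  unfolding field_op_def
proof (intro conjI ballI allI impI n)
  show G: "good_set M H" using Q by (simp add: mesh_op_def)
  fix u assume u: "u \<in> Z_ht D"
  obtain c where c: "\<forall>i\<le>deg. c i \<in> Z_h" "\<forall>t\<in>slab D n. \<forall>x\<in>\<Omega>. u t x = (\<Sum>i\<le>deg. t ^ i *\<^sub>R c i x)"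
    using Z_htD[OF u n] by blast
  have pc: "pw_C1 (c i)" if "i \<in> {..deg}" for i using c(1) that Z_h_pw_C1 by auto
  have "sep M H (slab D n) (\<lambda>t x. \<Sum>i\<in>{..deg}. t ^ i *\<^sub>R Q (c i) x)"
  proof (rule sep_sum)
    fix i assume i: "i \<in> {..deg}"
    have "bdd_meas M H (Q (c i))" using Q pc[OF i] by (simp add: mesh_op_def)
    then show "sep M H (slab D n) (\<lambda>t x. t ^ i *\<^sub>R Q (c i) x)"
      by (rule sep_base[rotated]) (auto intro!: continuous_intros)
  qed
  then show "sep M H (slab D n) (\<lambda>t x. Q (u t) x)"
  proof (rule sep_cong)
    fix t x assume t: "t \<in> slab D n" and x: "x \<in> H"
    show "Q (u t) x = (\<Sum>i\<in>{..deg}. t ^ i *\<^sub>R Q (c i) x)"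
      by (rule mesh_op_sum[OF Q _ pc _ x]) (use c(2) t mesh_interior_subset in auto)
  qed
next
  fix u u1 u2 r s t x
  assume *: "u1 \<in> Z_ht D" "u2 \<in> Z_ht D" "comb r u1 s u2 u" "t \<in> slab D n" "x \<in> H"
  have "\<forall>x\<in>G. u t x = r *\<^sub>R u1 t x + s *\<^sub>R u2 t x"
    using combD[OF *(3) n *(4)] by blast
  with Q Z_ht_pw_C1[OF *(1) n *(4)] Z_ht_pw_C1[OF *(2) n *(4)] *(5)
  show "Q (u t) x = r *\<^sub>R Q (u1 t) x + s *\<^sub>R Q (u2 t) x"
    unfolding mesh_op_def by blast
qed

lemma slab_open: "open (slab D n)"
  by (simp add: slab_def)

lemma Z_ht_time_derivative:
  assumes c: "\<forall>t\<in>slab D n. \<forall>x\<in>\<Omega>. u t x = (\<Sum>i\<le>deg. t ^ i *\<^sub>R c i x)"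
    and t: "t \<in> slab D n" and x: "x \<in> \<Omega>"
  shows "((\<lambda>s. u s x) has_vector_derivative (\<Sum>i\<le>deg. (real i * t ^ (i - 1)) *\<^sub>R c i x)) (at t)"
proof (rule has_vector_derivative_transform_within_open[OF _ slab_open t])
  show "((\<lambda>s. \<Sum>i\<le>deg. s ^ i *\<^sub>R c i x) has_vector_derivative
      (\<Sum>i\<le>deg. (real i * t ^ (i - 1)) *\<^sub>R c i x)) (at t)"
    by (intro has_vector_derivative_sum) (auto intro!: derivative_eq_intros simp: has_vector_derivative_def)
qed (use c x in auto)

text \<open>The field is known to be a polynomial only inside the slab; the slab is open, and this
  suffices for a derivative at its points.\<close>

lemma field_op_derivative:
  assumes n: "n \<in> steps"
  shows "field_op (vol D) G n (\<lambda>u t x. vector_derivative (\<lambda>s. u s x) (at t))"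
  unfolding field_op_def
proof (intro conjI ballI allI impI n good_vol)
  fix u assume u: "u \<in> Z_ht D"
  obtain c where c: "\<forall>i\<le>deg. c i \<in> Z_h" "\<forall>t\<in>slab D n. \<forall>x\<in>\<Omega>. u t x = (\<Sum>i\<le>deg. t ^ i *\<^sub>R c i x)"
    using Z_htD[OF u n] by blast
  have "sep (vol D) G (slab D n) (\<lambda>t x. \<Sum>i\<in>{..deg}. (real i * t ^ (i - 1)) *\<^sub>R c i x)"
  proof (rule sep_sum)
    fix i assume "i \<in> {..deg}"
    then have "bdd_meas (vol D) G (c i)"
      using c(1) Z_h_pw_C1 pw_C1_imp_pw_cont pw_cont_bdd_meas by auto
    then show "sep (vol D) G (slab D n) (\<lambda>t x. (real i * t ^ (i - 1)) *\<^sub>R c i x)"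
      by (rule sep_base[rotated]) (auto intro!: continuous_intros)
  qed
  then show "sep (vol D) G (slab D n) (\<lambda>t x. vector_derivative (\<lambda>s. u s x) (at t))"
  proof (rule sep_cong)
    fix t x assume t: "t \<in> slab D n" and x: "x \<in> G"
    then have "x \<in> \<Omega>" using mesh_interior_subset by blast
    from vector_derivative_at[OF Z_ht_time_derivative[OF c(2) t this]]
    show "vector_derivative (\<lambda>s. u s x) (at t) = (\<Sum>i\<in>{..deg}. (real i * t ^ (i - 1)) *\<^sub>R c i x)" .
  qed
next
  fix u u1 u2 r s t x
  assume *: "u1 \<in> Z_ht D" "u2 \<in> Z_ht D" "comb r u1 s u2 u" "t \<in> slab D n" "x \<in> G"
  then have x: "x \<in> \<Omega>" using mesh_interior_subset by blast
  have d: "((\<lambda>s. v s x) has_vector_derivative vector_derivative (\<lambda>s. v s x) (at t)) (at t)"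
    if v: "v \<in> Z_ht D" for v
  proof -
    obtain c where "\<forall>t\<in>slab D n. \<forall>x\<in>\<Omega>. v t x = (\<Sum>i\<le>deg. t ^ i *\<^sub>R c i x)"
      using Z_htD[OF v n] by blast
    from Z_ht_time_derivative[OF this *(4) x] show ?thesis
      by (metis vector_derivative_at)
  qed
  have "((\<lambda>s'. r *\<^sub>R u1 s' x + s *\<^sub>R u2 s' x) has_vector_derivative
      r *\<^sub>R vector_derivative (\<lambda>s. u1 s x) (at t) + s *\<^sub>R vector_derivative (\<lambda>s. u2 s x) (at t)) (at t)"
    using has_vector_derivative_add[OF
        bounded_linear.has_vector_derivative[OF bounded_linear_scaleR_right[of r] d[OF *(1)]]
        bounded_linear.has_vector_derivative[OF bounded_linear_scaleR_right[of s] d[OF *(2)]]] .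
  then have "((\<lambda>s. u s x) has_vector_derivative
      r *\<^sub>R vector_derivative (\<lambda>s. u1 s x) (at t) + s *\<^sub>R vector_derivative (\<lambda>s. u2 s x) (at t)) (at t)"
    by (rule has_vector_derivative_transform_within_open[OF _ slab_open *(4)])
       (simp add: combD[OF *(3) n _ *(5)])
  then show "vector_derivative (\<lambda>s. u s x) (at t) =
      r *\<^sub>R vector_derivative (\<lambda>s. u1 s x) (at t) + s *\<^sub>R vector_derivative (\<lambda>s. u2 s x) (at t)"
    by (rule vector_derivative_at)
qed

text \<open>A product becomes a linear operator once one factor is frozen; convection is later
  treated once in each of its two factors.\<close>

lemma field_op_bilinear_left:
  assumes pr: "bounded_bilinear pr" and f: "field_op M H n f" and g: "sep M H (slab D n) g"
  shows "field_op M H n (\<lambda>u t x. pr (f u t x) (g t x))"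
  unfolding field_op_def
proof (intro conjI ballI allI impI field_opD(1,2)[OF f])
  interpret bounded_bilinear pr by fact
  show "sep M H (slab D n) (\<lambda>t x. pr (f u t x) (g t x))" if "u \<in> Z_ht D" for u
    by (rule sep_bilinear[OF pr field_opD(3)[OF f that] g]) (rule refl)
  show "pr (f u t x) (g t x) = r *\<^sub>R pr (f u1 t x) (g t x) + s *\<^sub>R pr (f u2 t x) (g t x)"
    if "u \<in> Z_ht D" "u1 \<in> Z_ht D" "u2 \<in> Z_ht D" "comb r u1 s u2 u" "t \<in> slab D n" "x \<in> H"
    for u u1 u2 r s t x
    using field_opD(4)[OF f that] by (simp add: add_left scaleR_left)
qed

lemma field_op_bilinear_right:
  assumes pr: "bounded_bilinear pr" and f: "field_op M H n f" and g: "sep M H (slab D n) g"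
  shows "field_op M H n (\<lambda>u t x. pr (g t x) (f u t x))"
  using field_op_bilinear_left[OF bounded_bilinear.flip[OF pr] f g] .

text \<open>End points are included because the first Radau node is the left end of the
  slab.\<close>

lemma slab_nontrivial:
  assumes n: "n \<in> steps" and s: "s \<in> {time_pt D (n - 1)..time_pt D n}"
  shows "at s within slab D n \<noteq> bot"
proof -
  have "s \<in> closure (slab D n)"
    using s time_pt_step[OF n] by (simp add: slab_def)
  moreover have "s islimpt slab D n" if "s \<in> slab D n"
    using that interior_limit_point[of s "slab D n"] by (simp add: slab_open interior_open)
  ultimately show ?thesis
    by (auto simp: trivial_limit_within closure_def)
qed

lemma radau_nodes:
  assumes n: "n \<in> steps" and i: "i \<in> {1..deg + 1}"
  shows "radau_node D n i \<in> {time_pt D (n - 1)..time_pt D n}"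
proof -
  have "left_gauss_radau (time_pt D (n - 1)) (time_pt D n) deg (radau_weight D n) (radau_node D n)"
    using valid n by (simp add: valid_discretization_def)
  then have "radau_node D n ` {1..deg + 1} \<subseteq> {time_pt D (n - 1)..time_pt D n}"
    unfolding left_gauss_radau_def by blast
  then show ?thesis using i by blast
qed

lemmas node_nontrivial = slab_nontrivial[OF _ radau_nodes]

text \<open>At a node the limit of the product splits, so the scalar factor enters the interpolant
  through its node limits alone. It may depend on time in any way that has these limits, as
  \<open>gamma_F\<close> does.\<close>

lemma interpolant_scaled_eq:
  assumes G: "good_set M H" and n: "n \<in> steps" and f: "sep M H (slab D n) f"
    and \<gamma>: "\<And>i. i \<in> {1..deg + 1} \<Longrightarrow> (\<gamma> \<longlongrightarrow> \<Gamma> i) (at (radau_node D n i) within slab D n)"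
    and x: "x \<in> H"
  shows "interpolant D n (\<lambda>s. \<gamma> s *\<^sub>R f s x) t = (\<Sum>i\<in>{1..deg + 1}.
    lagrange_basis D n i t *\<^sub>R (\<Gamma> i *\<^sub>R time_limit (slab D n) f (radau_node D n i) x))"
  unfolding interpolant_def
proof (intro sum.cong refl arg_cong[where f="scaleR _"])
  fix i assume i: "i \<in> {1..deg + 1}"
  note nt = node_nontrivial[OF n n i]
  show "inside_value D n (\<lambda>s. \<gamma> s *\<^sub>R f s x) (radau_node D n i) =
      \<Gamma> i *\<^sub>R time_limit (slab D n) f (radau_node D n i) x"
    unfolding inside_value_def using nt
    by (intro tendsto_Lim tendsto_scaleR \<gamma> i sep_time_limit(3)[OF G f nt x]) auto
qed

lemma sep_interpolant:
  assumes G: "good_set M H" and n: "n \<in> steps" and f: "sep M H (slab D n) f"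
  shows "sep M H (slab D n) (\<lambda>t x. \<Sum>i\<in>{1..deg + 1}.
    lagrange_basis D n i t *\<^sub>R (\<Gamma> i *\<^sub>R time_limit (slab D n) f (radau_node D n i) x))"
proof (rule sep_sum)
  fix i assume i: "i \<in> {1..deg + 1}"
  have "continuous_on UNIV (lagrange_basis D n i)"
    unfolding lagrange_basis_def[abs_def] divide_inverse by (intro continuous_intros)
  then show "sep M H (slab D n)
      (\<lambda>t x. lagrange_basis D n i t *\<^sub>R (\<Gamma> i *\<^sub>R time_limit (slab D n) f (radau_node D n i) x))"
    by (rule sep_base[OF _ bdd_meas_scale[OF sep_time_limit(2)[OF G f node_nontrivial[OF n n i]]]]) (rule refl)
qed

lemma field_op_interpolant_scaled:
  assumes f: "field_op M H n f"
    and \<gamma>: "\<And>i. i \<in> {1..deg + 1} \<Longrightarrow> (\<gamma> \<longlongrightarrow> \<Gamma> i) (at (radau_node D n i) within slab D n)"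
  shows "field_op M H n (\<lambda>u t x. interpolant D n (\<lambda>s. \<gamma> s *\<^sub>R f u s x) t)"
  unfolding field_op_def
proof (intro conjI ballI allI impI field_opD(1,2)[OF f])
  note G = field_opD(1)[OF f] and n = field_opD(2)[OF f]
  have eq: "interpolant D n (\<lambda>s. \<gamma> s *\<^sub>R f u s x) t = (\<Sum>i\<in>{1..deg + 1}.
      lagrange_basis D n i t *\<^sub>R (\<Gamma> i *\<^sub>R time_limit (slab D n) (f u) (radau_node D n i) x))"
    if "u \<in> Z_ht D" "x \<in> H" for u x t
    by (rule interpolant_scaled_eq[OF G n field_opD(3)[OF f that(1)] \<gamma> that(2)])
  show "sep M H (slab D n) (\<lambda>t x. interpolant D n (\<lambda>s. \<gamma> s *\<^sub>R f u s x) t)" if u: "u \<in> Z_ht D" for u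
    by (rule sep_cong[OF sep_interpolant[OF G n field_opD(3)[OF f u], of \<Gamma>] eq[OF u]])
  fix u u1 u2 r s t x
  assume *: "u \<in> Z_ht D" "u1 \<in> Z_ht D" "u2 \<in> Z_ht D" "comb r u1 s u2 u" "t \<in> slab D n" "x \<in> H"
  have "time_limit (slab D n) (f u) (radau_node D n i) x =
      r *\<^sub>R time_limit (slab D n) (f u1) (radau_node D n i) x +
      s *\<^sub>R time_limit (slab D n) (f u2) (radau_node D n i) x" if i: "i \<in> {1..deg + 1}" for i
    by (rule time_limit_lincomb[OF G field_opD(3)[OF f *(2)] field_opD(3)[OF f *(3)] node_nontrivial[OF n n i] _ *(6)])
       (rule field_opD(4)[OF f *(1-4)])
  then show "interpolant D n (\<lambda>s. \<gamma> s *\<^sub>R f u s x) t =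
      r *\<^sub>R interpolant D n (\<lambda>s. \<gamma> s *\<^sub>R f u1 s x) t + s *\<^sub>R interpolant D n (\<lambda>s. \<gamma> s *\<^sub>R f u2 s x) t"
    unfolding eq[OF *(1) *(6)] eq[OF *(2) *(6)] eq[OF *(3) *(6)]
    unfolding scaleR_sum_right sum.distrib[symmetric]
    by (intro sum.cong) (simp_all add: scaleR_add_right mult_ac)
qed

lemma field_op_interpolant:
  assumes f: "field_op M H n f"
  shows "field_op M H n (\<lambda>u t x. interpolant D n (\<lambda>s. f u s x) t)"
  using field_op_interpolant_scaled[OF f, of "\<lambda>_. 1" "\<lambda>_. 1"] by simp

section \<open>Linear and bilinear forms on discrete functions\<close>

text \<open>Linearity is phrased by relations that hold away from time nodes and skeleton; it thus
  includes independence of the values there.\<close>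

definition lin_form :: "((real \<Rightarrow> real^'d \<Rightarrow> real^'d) \<Rightarrow> real) \<Rightarrow> bool" where
  "lin_form T \<longleftrightarrow> (\<forall>u\<in>Z_ht D. \<forall>u1\<in>Z_ht D. \<forall>u2\<in>Z_ht D. \<forall>r s.
     comb r u1 s u2 u \<longrightarrow> T u = r * T u1 + s * T u2)"

lemma lin_formD:
  "\<lbrakk>lin_form T; u \<in> Z_ht D; u1 \<in> Z_ht D; u2 \<in> Z_ht D; comb r u1 s u2 u\<rbrakk> \<Longrightarrow> T u = r * T u1 + s * T u2"
  by (simp add: lin_form_def)

lemma lin_form_zero: "lin_form (\<lambda>u. 0)"
  by (simp add: lin_form_def)

lemma lin_form_add: "lin_form S \<Longrightarrow> lin_form T \<Longrightarrow> lin_form (\<lambda>u. S u + T u)"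
  unfolding lin_form_def by (simp add: algebra_simps)

lemma lin_form_diff: "lin_form S \<Longrightarrow> lin_form T \<Longrightarrow> lin_form (\<lambda>u. S u - T u)"
  unfolding lin_form_def by (simp add: algebra_simps)

lemma lin_form_uminus: "lin_form T \<Longrightarrow> lin_form (\<lambda>u. - T u)"
  unfolding lin_form_def by (simp add: algebra_simps)

lemma lin_form_scale: "lin_form T \<Longrightarrow> lin_form (\<lambda>u. c * T u)"
  unfolding lin_form_def by (simp add: algebra_simps)

lemma lin_form_sum: "(\<And>i. i \<in> I \<Longrightarrow> lin_form (T i)) \<Longrightarrow> lin_form (\<lambda>u. \<Sum>i\<in>I. T i u)"
  by (induction I rule: infinite_finite_induct) (auto intro: lin_form_zero lin_form_add)

lemma lin_form_left:
  assumes f: "field_op M H n f" and g: "sep M H (slab D n) g"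
  shows "lin_form (\<lambda>u. LINT t|lebesgue_on (slab D n). L2_inner M (f u t) (g t))"
  unfolding lin_form_def
proof (intro ballI allI impI)
  fix u u1 u2 r s
  assume *: "u \<in> Z_ht D" "u1 \<in> Z_ht D" "u2 \<in> Z_ht D" "comb r u1 s u2 u"
  show "(LINT t|lebesgue_on (slab D n). L2_inner M (f u t) (g t)) =
      r * (LINT t|lebesgue_on (slab D n). L2_inner M (f u1 t) (g t)) +
      s * (LINT t|lebesgue_on (slab D n). L2_inner M (f u2 t) (g t))"
    using field_opD(3)[OF f *(2)] field_opD(3)[OF f *(3)] g field_opD(4)[OF f *(1-4)]
    unfolding slab_def by (rule sep_form_lincomb[OF field_opD(1)[OF f]])
qed

definition bilin_form ::
  "((real \<Rightarrow> real^'d \<Rightarrow> real^'d) \<Rightarrow> (real \<Rightarrow> real^'d \<Rightarrow> real^'d) \<Rightarrow> real) \<Rightarrow> bool" where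
  "bilin_form B \<longleftrightarrow> (\<forall>v\<in>Z_ht D. lin_form (\<lambda>u. B u v) \<and> lin_form (B v))"

lemma bilin_formD:
  assumes "bilin_form B" "v \<in> Z_ht D"
  shows "lin_form (\<lambda>u. B u v)" "lin_form (B v)"
  using assms by (auto simp: bilin_form_def)

lemma bilin_form_add: "bilin_form A \<Longrightarrow> bilin_form B \<Longrightarrow> bilin_form (\<lambda>u v. A u v + B u v)"
  by (simp add: bilin_form_def lin_form_add)

lemma bilin_form_diff: "bilin_form A \<Longrightarrow> bilin_form B \<Longrightarrow> bilin_form (\<lambda>u v. A u v - B u v)"
  by (simp add: bilin_form_def lin_form_diff)

lemma bilin_form_uminus: "bilin_form B \<Longrightarrow> bilin_form (\<lambda>u v. - B u v)"
  by (simp add: bilin_form_def lin_form_uminus)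

lemma bilin_form_scale: "bilin_form B \<Longrightarrow> bilin_form (\<lambda>u v. c * B u v)"
  by (simp add: bilin_form_def lin_form_scale)

lemma bilin_form_sum: "(\<And>i. i \<in> I \<Longrightarrow> bilin_form (B i)) \<Longrightarrow> bilin_form (\<lambda>u v. \<Sum>i\<in>I. B i u v)"
  by (simp add: bilin_form_def lin_form_sum)

lemmas bilin_form_intros =
  bilin_form_add bilin_form_diff bilin_form_uminus bilin_form_scale bilin_form_sum

lemma bilin_form_fields:
  assumes f: "field_op M H n f" and g: "field_op M H n g"
  shows "bilin_form (\<lambda>u v. LINT t|lebesgue_on (slab D n). L2_inner M (f u t) (g v t))"
  unfolding bilin_form_def
proof
  fix v assume v: "v \<in> Z_ht D"
  show "lin_form (\<lambda>u. LINT t|lebesgue_on (slab D n). L2_inner M (f u t) (g v t)) \<and>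
      lin_form (\<lambda>u. LINT t|lebesgue_on (slab D n). L2_inner M (f v t) (g u t))"
    using lin_form_left[OF f field_opD(3)[OF g v]] lin_form_left[OF g field_opD(3)[OF f v]]
    by (simp add: L2_inner_commute)
qed

section \<open>Limits and jumps at the time nodes\<close>

text \<open>Counterpart of \<open>field_op\<close> for operators whose value is a single spatial
  field.\<close>

definition snap_op ::
  "(real^'d) measure \<Rightarrow> (real^'d) set \<Rightarrow>
    ((real \<Rightarrow> real^'d \<Rightarrow> real^'d) \<Rightarrow> real^'d \<Rightarrow> 'b::euclidean_space) \<Rightarrow> bool" where
  "snap_op M H f \<longleftrightarrow> good_set M H \<and> (\<forall>u\<in>Z_ht D. bdd_meas M H (f u)) \<and>
     (\<forall>u\<in>Z_ht D. \<forall>u1\<in>Z_ht D. \<forall>u2\<in>Z_ht D. \<forall>r s. comb r u1 s u2 u \<longrightarrow>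
        (\<forall>x\<in>H. f u x = r *\<^sub>R f u1 x + s *\<^sub>R f u2 x))"

lemma snap_opD:
  assumes "snap_op M H f"
  shows "good_set M H" "u \<in> Z_ht D \<Longrightarrow> bdd_meas M H (f u)"
    "\<lbrakk>u \<in> Z_ht D; u1 \<in> Z_ht D; u2 \<in> Z_ht D; comb r u1 s u2 u; x \<in> H\<rbrakk>
      \<Longrightarrow> f u x = r *\<^sub>R f u1 x + s *\<^sub>R f u2 x"
  using assms by (auto simp: snap_op_def)

lemma snap_op_time_limit:
  assumes f: "field_op M H n f" and s: "at s within slab D n \<noteq> bot"
  shows "snap_op M H (\<lambda>u. time_limit (slab D n) (f u) s)"
  unfolding snap_op_def
proof (intro conjI ballI allI impI field_opD(1)[OF f])
  note G = field_opD(1)[OF f]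
  show "bdd_meas M H (time_limit (slab D n) (f u) s)" if "u \<in> Z_ht D" for u
    by (rule sep_time_limit(2)[OF G field_opD(3)[OF f that] s])
  fix u u1 u2 r q x
  assume *: "u \<in> Z_ht D" "u1 \<in> Z_ht D" "u2 \<in> Z_ht D" "comb r u1 q u2 u" "x \<in> H"
  show "time_limit (slab D n) (f u) s x = r *\<^sub>R time_limit (slab D n) (f u1) s x + q *\<^sub>R time_limit (slab D n) (f u2) s x"
    by (rule time_limit_lincomb[OF G field_opD(3)[OF f *(2)] field_opD(3)[OF f *(3)] s _ *(5)])
       (rule field_opD(4)[OF f *(1-4)])
qed

lemma snap_op_diff:
  assumes f: "snap_op M H f" and g: "snap_op M H g"
  shows "snap_op M H (\<lambda>u x. f u x - g u x)"
  unfolding snap_op_def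
proof (intro conjI ballI allI impI snap_opD(1)[OF f])
  show "bdd_meas M H (\<lambda>x. f u x - g u x)" if "u \<in> Z_ht D" for u
    by (rule bdd_meas_lincomb[OF snap_opD(1)[OF f] snap_opD(2)[OF f that] snap_opD(2)[OF g that], of _ 1 "-1"]) simp
  fix u u1 u2 r q x
  assume *: "u \<in> Z_ht D" "u1 \<in> Z_ht D" "u2 \<in> Z_ht D" "comb r u1 q u2 u" "x \<in> H"
  show "f u x - g u x = r *\<^sub>R (f u1 x - g u1 x) + q *\<^sub>R (f u2 x - g u2 x)"
    using snap_opD(3)[OF f *] snap_opD(3)[OF g *] by (simp add: algebra_simps)
qed

lemma snap_lin_form_left:
  assumes f: "snap_op M H f" and g: "g \<in> L2_space M"
  shows "lin_form (\<lambda>u. L2_inner M (f u) g)"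
  unfolding lin_form_def
proof (intro ballI allI impI)
  note G = snap_opD(1)[OF f]
  fix u u1 u2 r s
  assume *: "u \<in> Z_ht D" "u1 \<in> Z_ht D" "u2 \<in> Z_ht D" "comb r u1 s u2 u"
  show "L2_inner M (f u) g = r * L2_inner M (f u1) g + s * L2_inner M (f u2) g"
    by (rule L2_inner_L2_lincomb[OF G bdd_meas_L2_space[OF G snap_opD(2)[OF f *(2)]]
          bdd_meas_L2_space[OF G snap_opD(2)[OF f *(3)]] g snap_opD(3)[OF f *]])
qed

lemma snap_lin_form_right:
  assumes "snap_op M H f" "g \<in> L2_space M"
  shows "lin_form (\<lambda>u. L2_inner M g (f u))"
  using snap_lin_form_left[OF assms] by (simp add: L2_inner_commute)

lemma left_lim_eq: "n \<in> steps \<Longrightarrow> left_lim u (time_pt D n) = time_limit (slab D n) u (time_pt D n)"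
proof -
  assume "n \<in> steps"
  then have "at_left (time_pt D n) = at (time_pt D n) within slab D n"
    using time_pt_step by (intro at_within_nhd[of _ "{time_pt D (n - 1)<..}"]) (auto simp: slab_def)
  then show ?thesis by (simp add: left_lim_def[abs_def] time_limit_def[abs_def])
qed

text \<open>Near the start of slab \<open>n\<close> the one-sided filter and the filter within the
  slab agree; the starting time carries the index \<open>n - 1\<close>.\<close>

lemma right_lim_eq:
  "n \<in> steps \<Longrightarrow> right_lim u (time_pt D (n - 1)) = time_limit (slab D n) u (time_pt D (n - 1))"
proof -
  assume "n \<in> steps"
  then have "at_right (time_pt D (n - 1)) = at (time_pt D (n - 1)) within slab D n"
    using time_pt_step by (intro at_within_nhd[of _ "{..<time_pt D n}"]) (auto simp: slab_def)
  then show ?thesis by (simp add: right_lim_def[abs_def] time_limit_def[abs_def])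
qed

lemma field_op_id: "n \<in> steps \<Longrightarrow> field_op (vol D) G n (\<lambda>u. u)"
  using field_op_mesh_op[OF mesh_op_vol[OF pw_op_id]] by simp

lemma snap_op_left_lim:
  assumes n: "n \<in> steps"
  shows "snap_op (vol D) G (\<lambda>u. left_lim u (time_pt D n))"
  unfolding left_lim_eq[OF n]
  using n time_pt_step[OF n] by (intro snap_op_time_limit field_op_id slab_nontrivial) auto

lemma snap_op_right_lim:
  assumes n: "n \<in> steps"
  shows "snap_op (vol D) G (\<lambda>u. right_lim u (time_pt D (n - 1)))"
  unfolding right_lim_eq[OF n]
  using n time_pt_step[OF n] by (intro snap_op_time_limit field_op_id slab_nontrivial) auto

text \<open>The right limit at the end of slab \<open>n\<close> is taken in slab
  \<open>Suc n\<close>, which is why \<open>n\<close> stops one short of the last step.\<close>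

lemma snap_op_right_lim_interior:
  assumes "n \<in> {1..num_steps D - 1}"
  shows "snap_op (vol D) G (\<lambda>u. right_lim u (time_pt D n))"
  using snap_op_right_lim[of "Suc n"] assms by auto

lemma snap_op_right_lim_initial: "snap_op (vol D) G (\<lambda>u. right_lim u 0)"
proof -
  have "num_steps D \<ge> 1" "time_pt D 0 = 0"
    using valid by (auto simp: valid_discretization_def)
  then show ?thesis using snap_op_right_lim[of 1] by auto
qed

lemma snap_op_time_jump:
  assumes "n \<in> {1..num_steps D - 1}"
  shows "snap_op (vol D) G (\<lambda>u. time_jump D u n)"
  unfolding time_jump_def[abs_def]
  using assms by (intro snap_op_diff snap_op_left_lim snap_op_right_lim_interior) auto

lemma snap_op_L2: "snap_op M H f \<Longrightarrow> u \<in> Z_ht D \<Longrightarrow> f u \<in> L2_space M"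
  by (intro bdd_meas_L2_space[of M H] snap_opD(1)[of M H f] snap_opD(2)[of M H f])

lemma bilin_form_snaps:
  assumes f: "snap_op M H f" and g: "snap_op M H g"
  shows "bilin_form (\<lambda>u v. L2_inner M (f u) (g v))"
  unfolding bilin_form_def
  using snap_lin_form_left[OF f snap_op_L2[OF g]] snap_lin_form_right[OF g snap_op_L2[OF f]] by blast

lemma m_form_bilin: "bilin_form (m_form D)"
  unfolding m_form_def[abs_def]
  by (intro bilin_form_intros;
      (rule bilin_form_fields[OF field_op_derivative field_op_id]
         bilin_form_snaps[OF snap_op_time_jump snap_op_right_lim_interior]
         bilin_form_snaps[OF snap_op_right_lim_initial snap_op_right_lim_initial]; assumption))

lemma bounded_linear_mult_vec: "bounded_linear (\<lambda>A :: real^'d^'d. A *v (y :: real^'d))"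
  by (intro linear_conv_bounded_linear[THEN iffD1] linearI)
     (simp_all add: matrix_vector_mult_add_rdistrib scaleR_matrix_vector_assoc)

lemma bounded_bilinear_matrix_vector: "bounded_bilinear (\<lambda>(A :: real^'d^'d) (y :: real^'d). A *v y)"
proof -
  have "bilinear (\<lambda>(A :: real^'d^'d) (y :: real^'d). A *v y)"
    unfolding bilinear_def
    by (auto intro!: linearI simp: matrix_vector_mult_add_rdistrib matrix_vector_right_distrib
        scaleR_matrix_vector_assoc matrix_vector_mult_scaleR)
  then show ?thesis by (simp add: bilinear_conv_bounded_bilinear)
qed

lemma field_op_broken_grad: "n \<in> steps \<Longrightarrow> field_op (vol D) G n (\<lambda>u t. broken_grad (u t))"
  using field_op_mesh_op[OF mesh_op_vol[OF pw_op_broken_grad]] by simp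

lemma field_op_facet:
  assumes "n \<in> steps" "F \<in> facets D"
  shows "field_op (surface_measure D F) F n (\<lambda>u t x. avg D F (broken_grad (u t)) x *v facet_normal D F)"
    and "field_op (surface_measure D F) F n (\<lambda>u t. jump D F (u t))"
    and "field_op (surface_measure D F) F n (\<lambda>u t. avg D F (u t))"
    and "field_op (surface_measure D F) F n (\<lambda>u t x. c *\<^sub>R jump D F (u t) x)"
    and "field_op (surface_measure D F) F n (\<lambda>u t. normal_component D F (u t))"
proof -
  note op = field_op_mesh_op[OF _ assms(1)] and aj = mesh_op_avg_jump[OF assms(2)]
  note grad = aj[OF pw_op_broken_grad] and id = aj[OF pw_op_id]
  show "field_op (surface_measure D F) F n (\<lambda>u t x. avg D F (broken_grad (u t)) x *v facet_normal D F)"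
    using op[OF mesh_op_compose[OF grad(1) bounded_linear_mult_vec]] .
  show "field_op (surface_measure D F) F n (\<lambda>u t. jump D F (u t))"
    using op[OF id(2)] .
  show "field_op (surface_measure D F) F n (\<lambda>u t. avg D F (u t))"
    using op[OF id(1)] .
  show "field_op (surface_measure D F) F n (\<lambda>u t x. c *\<^sub>R jump D F (u t) x)"
    using op[OF mesh_op_compose[OF id(2) bounded_linear_scaleR_right[of c]]] .
  show "field_op (surface_measure D F) F n (\<lambda>u t. normal_component D F (u t))"
    unfolding normal_component_def[abs_def]
    using op[OF mesh_op_compose[OF id(1) bounded_linear_inner_left[of "facet_normal D F"]]] .
qed

lemma a_form_bilin: "bilin_form (a_form D)"
  unfolding a_form_def[abs_def]
  by (intro bilin_form_intros;
      (rule bilin_form_fields[OF field_op_broken_grad field_op_broken_grad]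
         bilin_form_fields[OF field_op_facet(1) field_op_facet(2)]
         bilin_form_fields[OF field_op_facet(2) field_op_facet(1)]
         bilin_form_fields[OF field_op_facet(4) field_op_facet(2)]; assumption))

section \<open>The convective form\<close>

text \<open>Node value of \<open>gamma_F\<close>, with the limit in time taken before the supremum
  over the facet. The field inside is linear in \<open>w\<close>, which is what continuity in the
  coordinates rests on.\<close>

definition gamma_limit ::
  "(real^'d) set \<Rightarrow> nat \<Rightarrow> real \<Rightarrow> (real \<Rightarrow> real^'d \<Rightarrow> real^'d) \<Rightarrow> real" where
  "gamma_limit F n s w = max (c_S D) (Linf_norm (surface_measure D F)
     (time_limit (slab D n) (\<lambda>t. normal_component D F (w t)) s))"

lemma Linf_norm_dist_le:
  fixes f g :: "'a \<Rightarrow> real"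
  assumes G: "good_set M H" and f: "bdd_meas M H f" and g: "bdd_meas M H g"
    and e: "\<And>x. x \<in> H \<Longrightarrow> \<bar>f x - g x\<bar> \<le> e" "0 \<le> e"
  shows "\<bar>Linf_norm M f - Linf_norm M g\<bar> \<le> e"
proof -
  obtain A where A: "\<And>x. x \<in> H \<Longrightarrow> norm (f x) \<le> A"
    using f by (auto simp: bdd_meas_def bounded_iff)
  obtain B where B: "\<And>x. x \<in> H \<Longrightarrow> norm (g x) \<le> B"
    using g by (auto simp: bdd_meas_def bounded_iff)
  have "Linf_norm M f \<le> Linf_norm M g + e"
    using f g e B by (intro Linf_norm_lipschitz[of _ _ _ B] good_set_AE[OF G]) (auto simp: bdd_meas_def)
  moreover have "Linf_norm M g \<le> Linf_norm M f + e"
    using f g e A by (intro Linf_norm_lipschitz[of _ _ _ A] good_set_AE[OF G])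
      (auto simp: bdd_meas_def abs_minus_commute)
  ultimately show ?thesis by simp
qed

text \<open>The normal component converges uniformly on the facet, and the essential supremum is
  1-Lipschitz for the uniform distance; so limit and supremum may be exchanged.\<close>

lemma gamma_F_tendsto:
  assumes w: "w \<in> Z_ht D" and F: "F \<in> facets D" and n: "n \<in> steps" and s: "at s within slab D n \<noteq> bot"
  shows "((\<lambda>t. gamma_F D F (w t)) \<longlongrightarrow> gamma_limit F n s w) (at s within slab D n)"
proof -
  note op = field_op_facet(5)[OF n F]
  note G = field_opD(1)[OF op] and sp = field_opD(3)[OF op w]
  let ?f = "\<lambda>t. normal_component D F (w t)"
  note ul = sep_time_limit(1)[OF G sp s] and bm = sep_time_limit(2)[OF G sp s]
  have "((\<lambda>t. Linf_norm (surface_measure D F) (?f t)) \<longlongrightarrow>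
      Linf_norm (surface_measure D F) (time_limit (slab D n) ?f s)) (at s within slab D n)"
    unfolding tendsto_iff
  proof (intro allI impI)
    fix e :: real assume "0 < e"
    then have "\<forall>\<^sub>F t in at s within slab D n. \<forall>x\<in>F. dist (?f t x) (time_limit (slab D n) ?f s x) < e / 2"
      using ul unfolding uniform_limit_iff by (meson half_gt_zero)
    moreover have "\<forall>\<^sub>F t in at s within slab D n. t \<in> slab D n"
      by (simp add: eventually_at_filter)
    ultimately show "\<forall>\<^sub>F t in at s within slab D n.
        dist (Linf_norm (surface_measure D F) (?f t))
          (Linf_norm (surface_measure D F) (time_limit (slab D n) ?f s)) < e"
    proof eventually_elim
      case (elim t)
      then have "\<bar>Linf_norm (surface_measure D F) (?f t) -
          Linf_norm (surface_measure D F) (time_limit (slab D n) ?f s)\<bar> \<le> e / 2"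
        using \<open>0 < e\<close>
        by (intro Linf_norm_dist_le[OF G sep_bdd_meas[OF G sp] bm]) (auto simp: dist_real_def less_imp_le)
      then show ?case using \<open>0 < e\<close> by (simp add: dist_real_def)
    qed
  qed
  then show ?thesis
    unfolding gamma_F_def gamma_limit_def by (intro tendsto_max tendsto_const)
qed

text \<open>Linearity in \<open>u\<close> is for the linear system, linearity in \<open>w\<close>
  for continuity with respect to the advection field. The numerical flux admits the same pair, the
  upwind term only the first member.\<close>

lemma field_op_convection:
  assumes n: "n \<in> steps"
  shows "w \<in> Z_ht D \<Longrightarrow> field_op (vol D) G n (\<lambda>u t x. interpolant D n (\<lambda>s. broken_grad (u s) x *v w s x) t)"
    and "u \<in> Z_ht D \<Longrightarrow> field_op (vol D) G n (\<lambda>w t x. interpolant D n (\<lambda>s. broken_grad (u s) x *v w s x) t)"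
  by (intro field_op_interpolant field_op_bilinear_left[OF bounded_bilinear_matrix_vector]
      field_op_broken_grad[OF n] field_opD(3)[OF field_op_id[OF n]], assumption)
     (intro field_op_interpolant field_op_bilinear_right[OF bounded_bilinear_matrix_vector]
      field_op_id[OF n] field_opD(3)[OF field_op_broken_grad[OF n]])

lemma field_op_flux:
  assumes n: "n \<in> steps" and F: "F \<in> facets D"
  shows "w \<in> Z_ht D \<Longrightarrow> field_op (surface_measure D F) F n
      (\<lambda>u t x. interpolant D n (\<lambda>s. normal_component D F (w s) x *\<^sub>R jump D F (u s) x) t)"
    and "u \<in> Z_ht D \<Longrightarrow> field_op (surface_measure D F) F n
      (\<lambda>w t x. interpolant D n (\<lambda>s. normal_component D F (w s) x *\<^sub>R jump D F (u s) x) t)"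
  by (intro field_op_interpolant field_op_bilinear_right[OF bounded_bilinear_scaleR]
      field_op_facet(2)[OF n F] field_opD(3)[OF field_op_facet(5)[OF n F]], assumption)
     (intro field_op_interpolant field_op_bilinear_left[OF bounded_bilinear_scaleR]
      field_op_facet(5)[OF n F] field_opD(3)[OF field_op_facet(2)[OF n F]])

lemma field_op_upwind:
  assumes n: "n \<in> steps" and F: "F \<in> facets D" and w: "w \<in> Z_ht D"
  shows "field_op (surface_measure D F) F n
      (\<lambda>u t x. interpolant D n (\<lambda>s. gamma_F D F (w s) *\<^sub>R jump D F (u s) x) t)"
  by (rule field_op_interpolant_scaled[OF field_op_facet(2)[OF n F],
        where \<Gamma>="\<lambda>i. gamma_limit F n (radau_node D n i) w"])
     (rule gamma_F_tendsto[OF w F n node_nontrivial[OF n n]])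

lemma interior_facet: "F \<in> interior_facets D \<Longrightarrow> F \<in> facets D"
  using interior_facets_subset by blast

lemma c_form_bilin:
  assumes w: "w \<in> Z_ht D"
  shows "bilin_form (c_form D w)"
  unfolding c_form_def[abs_def]
  by (intro bilin_form_intros;
      (rule bilin_form_fields[OF field_op_convection(1) field_op_id]
         bilin_form_fields[OF field_op_flux(1) field_op_facet(3)]
         bilin_form_fields[OF field_op_upwind field_op_facet(2)];
       (assumption | rule w | erule interior_facet)))

section \<open>Coordinates and continuity in the advection field\<close>

text \<open>The family may be linearly dependent, so \<open>a\<close> need not be determined by
  \<open>w\<close>.\<close>

definition combs ::
  "nat \<Rightarrow> (nat \<Rightarrow> real \<Rightarrow> real^'d \<Rightarrow> real^'d) \<Rightarrow> (nat \<Rightarrow> real) \<Rightarrow> (real \<Rightarrow> real^'d \<Rightarrow> real^'d) \<Rightarrow> bool"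
where
  "combs m b a w \<longleftrightarrow> (\<forall>n\<in>steps. \<forall>t\<in>slab D n. \<forall>x\<in>G. w t x = (\<Sum>p<m. a p *\<^sub>R b p t x))"

lemma Z_ht_sum:
  fixes m :: nat
  assumes "\<And>p. p < m \<Longrightarrow> b p \<in> Z_ht D"
  shows "(\<lambda>t x. \<Sum>p<m. a p *\<^sub>R b p t x) \<in> Z_ht D"
  using assms
proof (induction m)
  case (Suc m)
  then have "(\<lambda>t x. \<Sum>p<m. a p *\<^sub>R b p t x) \<in> Z_ht D" "b m \<in> Z_ht D" by auto
  from Z_ht_lincomb[OF this, of 1 "a m"] show ?case by simp
qed (simp add: Z_ht_zero)

lemma combs_induct_step:
  assumes b: "\<And>p. p < Suc m \<Longrightarrow> b p \<in> Z_ht D" and w: "combs (Suc m) b a w"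
  defines "w' \<equiv> \<lambda>t x. \<Sum>p<m. a p *\<^sub>R b p t x"
  shows "w' \<in> Z_ht D" "combs m b a w'" "comb 1 w' (a m) (b m) w"
proof -
  show "w' \<in> Z_ht D" unfolding w'_def using b by (intro Z_ht_sum) auto
  show "combs m b a w'" by (simp add: combs_def w'_def)
  show "comb 1 w' (a m) (b m) w" using w by (simp add: combs_def comb_def w'_def)
qed

text \<open>An empty combination vanishes wherever the forms look; written as zero times itself
  twice, it fits the binary relation.\<close>

lemma comb_zero: "combs 0 b a w \<Longrightarrow> comb 0 w 0 w w"
  by (simp add: combs_def comb_def)

lemma lin_form_combs:
  assumes T: "lin_form T" and "\<And>p. p < m \<Longrightarrow> b p \<in> Z_ht D" "w \<in> Z_ht D" "combs m b a w"
  shows "T w = (\<Sum>p<m. a p * T (b p))"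
  using assms(2-4)
proof (induction m arbitrary: w)
  case 0
  then show ?case using lin_formD[OF T 0(2) 0(2) 0(2) comb_zero[OF 0(3)]] by simp
next
  case (Suc m)
  note st = combs_induct_step[OF Suc.prems(1) Suc.prems(3)]
  have "b m \<in> Z_ht D" using Suc.prems(1) by simp
  from lin_formD[OF T Suc.prems(2) st(1) this st(3)]
  have "T w = T (\<lambda>t x. \<Sum>p<m. a p *\<^sub>R b p t x) + a m * T (b m)" by simp
  also have "T (\<lambda>t x. \<Sum>p<m. a p *\<^sub>R b p t x) = (\<Sum>p<m. a p * T (b p))"
    by (rule Suc.IH[OF _ st(1,2)]) (simp add: Suc.prems(1))
  finally show ?case by simp
qed

lemma snap_op_combs:
  assumes f: "snap_op M H f" and "\<And>p. p < m \<Longrightarrow> b p \<in> Z_ht D" "w \<in> Z_ht D" "combs m b a w" and x: "x \<in> H"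
  shows "f w x = (\<Sum>p<m. a p *\<^sub>R f (b p) x)"
  using assms(2-4)
proof (induction m arbitrary: w)
  case 0
  then show ?case using snap_opD(3)[OF f 0(2) 0(2) 0(2) comb_zero[OF 0(3)] x] by simp
next
  case (Suc m)
  note st = combs_induct_step[OF Suc.prems(1) Suc.prems(3)]
  have "b m \<in> Z_ht D" using Suc.prems(1) by simp
  from snap_opD(3)[OF f Suc.prems(2) st(1) this st(3) x]
  have "f w x = f (\<lambda>t x. \<Sum>p<m. a p *\<^sub>R b p t x) x + a m *\<^sub>R f (b m) x" by simp
  also have "f (\<lambda>t x. \<Sum>p<m. a p *\<^sub>R b p t x) x = (\<Sum>p<m. a p *\<^sub>R f (b p) x)"
    by (rule Suc.IH[OF _ st(1,2)]) (simp add: Suc.prems(1))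
  finally show ?case by simp
qed

text \<open>The discrete functions carry no topology here: continuity is sequential continuity in the
  coordinates with respect to any finite family.\<close>

definition seq_cont :: "((real \<Rightarrow> real^'d \<Rightarrow> real^'d) \<Rightarrow> real) \<Rightarrow> bool" where
  "seq_cont T \<longleftrightarrow> (\<forall>m b w a l. (\<forall>p<m. b p \<in> Z_ht D) \<longrightarrow> (\<forall>a. w a \<in> Z_ht D \<and> combs m b a (w a)) \<longrightarrow>
     (\<forall>p<m. (\<lambda>k. a k p) \<longlonglongrightarrow> l p) \<longrightarrow> (\<lambda>k :: nat. T (w (a k))) \<longlonglongrightarrow> T (w l))"

lemma seq_contI:
  assumes "\<And>m b w a l. \<lbrakk>\<And>p. p < m \<Longrightarrow> b p \<in> Z_ht D; \<And>a. w a \<in> Z_ht D; \<And>a. combs m b a (w a);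
    \<And>p. p < m \<Longrightarrow> (\<lambda>k :: nat. a k p) \<longlonglongrightarrow> l p\<rbrakk> \<Longrightarrow> (\<lambda>k. T (w (a k))) \<longlonglongrightarrow> T (w l)"
  shows "seq_cont T"
  unfolding seq_cont_def
proof (intro allI impI)
  fix m b w a l
  assume "\<forall>p<m. b p \<in> Z_ht D" "\<forall>a. w a \<in> Z_ht D \<and> combs m b a (w a)"
    "\<forall>p<m. (\<lambda>k :: nat. a k p :: real) \<longlonglongrightarrow> l p"
  then show "(\<lambda>k. T (w (a k))) \<longlonglongrightarrow> T (w l)"
    using assms[of m b w a l] by blast
qed

lemma seq_contD:
  assumes "seq_cont T" "\<And>p. p < m \<Longrightarrow> b p \<in> Z_ht D" "\<And>a. w a \<in> Z_ht D" "\<And>a. combs m b a (w a)"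
    "\<And>p. p < m \<Longrightarrow> (\<lambda>k :: nat. a k p) \<longlonglongrightarrow> l p"
  shows "(\<lambda>k. T (w (a k))) \<longlonglongrightarrow> T (w l)"
  using assms(1)[unfolded seq_cont_def, rule_format, of m b w a l] assms(2-5) by blast

lemma seq_cont_lin_form:
  assumes T: "lin_form T"
  shows "seq_cont T"
proof (rule seq_contI)
  fix m b w a l
  assume b: "\<And>p. p < m \<Longrightarrow> b p \<in> Z_ht D" and w: "\<And>a. w a \<in> Z_ht D" "\<And>a. combs m b a (w a)"
    and a: "\<And>p. p < m \<Longrightarrow> (\<lambda>k :: nat. a k p :: real) \<longlonglongrightarrow> l p"
  have "T (w a) = (\<Sum>p<m. a p * T (b p))" for a
    by (rule lin_form_combs[OF T b w])
  then show "(\<lambda>k. T (w (a k))) \<longlonglongrightarrow> T (w l)"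
    using a by (auto intro!: tendsto_sum tendsto_mult_right)
qed

lemma seq_cont_const: "seq_cont (\<lambda>w. c)"
  by (rule seq_contI) simp

lemma seq_cont_add: "seq_cont S \<Longrightarrow> seq_cont T \<Longrightarrow> seq_cont (\<lambda>w. S w + T w)"
  by (rule seq_contI) (rule tendsto_add; rule seq_contD; assumption)

lemma seq_cont_mult: "seq_cont S \<Longrightarrow> seq_cont T \<Longrightarrow> seq_cont (\<lambda>w. S w * T w)"
  by (rule seq_contI) (rule tendsto_mult; rule seq_contD; assumption)

lemma seq_cont_uminus: "seq_cont T \<Longrightarrow> seq_cont (\<lambda>w. - T w)"
  by (rule seq_contI) (rule tendsto_minus; rule seq_contD; assumption)

lemma seq_cont_sum: "(\<And>i. i \<in> I \<Longrightarrow> seq_cont (T i)) \<Longrightarrow> seq_cont (\<lambda>w. \<Sum>i\<in>I. T i w)"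
  by (induction I rule: infinite_finite_induct) (auto intro: seq_cont_const seq_cont_add)

text \<open>The field inside the supremum is linear in \<open>w\<close> and bounded on the facet for
  each member of the family. Hence the suprema differ by at most the sum of coordinate differences
  times these bounds.\<close>

lemma seq_cont_gamma_limit:
  assumes F: "F \<in> facets D" and n: "n \<in> steps" and s: "at s within slab D n \<noteq> bot"
  shows "seq_cont (gamma_limit F n s)"
proof (rule seq_contI)
  fix m b w a l
  assume b: "\<And>p. p < m \<Longrightarrow> b p \<in> Z_ht D" and w: "\<And>a. w a \<in> Z_ht D" "\<And>a. combs m b a (w a)"
    and a: "\<And>p. p < m \<Longrightarrow> (\<lambda>k :: nat. a k p :: real) \<longlonglongrightarrow> l p"
  define N where "N v = time_limit (slab D n) (\<lambda>t. normal_component D F (v t)) s" for v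
  have op: "snap_op (surface_measure D F) F N"
    unfolding N_def[abs_def] by (rule snap_op_time_limit[OF field_op_facet(5)[OF n F] s])
  have "\<exists>C. \<forall>x\<in>F. \<bar>N (b p) x\<bar> \<le> C" if "p < m" for p
    using snap_opD(2)[OF op b[OF that]] by (auto simp: bdd_meas_def bounded_iff)
  then obtain C where C: "\<And>p x. p < m \<Longrightarrow> x \<in> F \<Longrightarrow> \<bar>N (b p) x\<bar> \<le> C p"
    by metis
  define E where "E k = (\<Sum>p<m. \<bar>a k p - l p\<bar> * \<bar>C p\<bar>)" for k
  have "(\<lambda>k. Linf_norm (surface_measure D F) (N (w (a k)))) \<longlonglongrightarrow> Linf_norm (surface_measure D F) (N (w l))"
  proof (rule LIM_zero_cancel, rule Lim_null_comparison)
    have "(\<lambda>k. \<Sum>p<m. \<bar>a k p - l p\<bar> * \<bar>C p\<bar>) \<longlonglongrightarrow> (\<Sum>p<m. \<bar>l p - l p\<bar> * \<bar>C p\<bar>)"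
      by (intro tendsto_intros a) auto
    then show "E \<longlonglongrightarrow> 0" by (simp add: E_def[abs_def])
    have "\<bar>N (w (a k)) x - N (w l) x\<bar> \<le> E k" if x: "x \<in> F" for k x
    proof -
      have "N (w a) x = (\<Sum>p<m. a p * N (b p) x)" for a
        using snap_op_combs[OF op b w x] by simp
      then have "N (w (a k)) x - N (w l) x = (\<Sum>p<m. (a k p - l p) * N (b p) x)"
        by (simp add: left_diff_distrib sum_subtractf)
      also have "\<bar>\<dots>\<bar> \<le> (\<Sum>p<m. \<bar>(a k p - l p) * N (b p) x\<bar>)" by (rule sum_abs)
      also have "\<dots> \<le> E k"
        unfolding E_def abs_mult
      proof (intro sum_mono mult_left_mono)
        fix p assume "p \<in> {..<m}"
        then show "\<bar>N (b p) x\<bar> \<le> \<bar>C p\<bar>" using C[of p x] x by simp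
      qed simp
      finally show ?thesis .
    qed
    then have "\<bar>Linf_norm (surface_measure D F) (N (w (a k))) - Linf_norm (surface_measure D F) (N (w l))\<bar> \<le> E k" for k
      by (intro Linf_norm_dist_le[OF snap_opD(1)[OF op] snap_opD(2)[OF op w(1)] snap_opD(2)[OF op w(1)]])
         (auto simp: E_def sum_nonneg)
    then show "\<forall>\<^sub>F k in sequentially. norm (Linf_norm (surface_measure D F) (N (w (a k))) -
        Linf_norm (surface_measure D F) (N (w l))) \<le> E k"
      by simp
  qed
  then show "(\<lambda>k. gamma_limit F n s (w (a k))) \<longlonglongrightarrow> gamma_limit F n s (w l)"
    unfolding gamma_limit_def N_def[symmetric] by (intro tendsto_max tendsto_const)
qed

lemma sep_form_sum:
  assumes G: "good_set M H" and f: "\<And>i. i \<in> I \<Longrightarrow> sep M H {a<..<b} (f i)" and g: "sep M H {a<..<b} g"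
    and h: "\<And>t x. t \<in> {a<..<b} \<Longrightarrow> x \<in> H \<Longrightarrow> h t x = (\<Sum>i\<in>I. r i *\<^sub>R f i t x)" and "finite I"
  shows "(LINT t|lebesgue_on {a<..<b}. L2_inner M (h t) (g t)) =
    (\<Sum>i\<in>I. r i * (LINT t|lebesgue_on {a<..<b}. L2_inner M (f i t) (g t)))"
  using \<open>finite I\<close> f h
proof (induction I arbitrary: h)
  case empty
  have "(LINT t|lebesgue_on {a<..<b}. L2_inner M (h t) (g t)) =
      0 * (LINT t|lebesgue_on {a<..<b}. L2_inner M (g t) (g t)) +
      0 * (LINT t|lebesgue_on {a<..<b}. L2_inner M (g t) (g t))"
    by (rule sep_form_lincomb[OF G g g g]) (simp add: empty)
  then show ?case by simp
next
  case (insert i I)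
  let ?h = "\<lambda>t x. \<Sum>i\<in>I. r i *\<^sub>R f i t x"
  have s: "sep M H {a<..<b} ?h"
  proof (rule sep_sum)
    show "sep M H {a<..<b} (\<lambda>t x. r j *\<^sub>R f j t x)" if "j \<in> I" for j
      by (rule sep_scale[of _ _ _ "f j" "\<lambda>_. r j"]) (use insert.prems that in auto)
  qed
  have "(LINT t|lebesgue_on {a<..<b}. L2_inner M (h t) (g t)) =
      r i * (LINT t|lebesgue_on {a<..<b}. L2_inner M (f i t) (g t)) +
      1 * (LINT t|lebesgue_on {a<..<b}. L2_inner M (?h t) (g t))"
    by (rule sep_form_lincomb[OF G insert.prems(1)[OF insertI1] s g]) (use insert in simp)
  moreover have "(LINT t|lebesgue_on {a<..<b}. L2_inner M (?h t) (g t)) =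
      (\<Sum>i\<in>I. r i * (LINT t|lebesgue_on {a<..<b}. L2_inner M (f i t) (g t)))"
    by (rule insert.IH) (use insert.prems in auto)
  ultimately show ?case using insert.hyps by simp
qed

text \<open>Isolates the nonlinearity: the upwind term is a sum of node values of
  \<open>gamma_F\<close> times integrals that do not contain \<open>w\<close>.\<close>

lemma upwind_form_eq:
  assumes n: "n \<in> steps" and F: "F \<in> facets D" and w: "w \<in> Z_ht D" and u: "u \<in> Z_ht D" and v: "v \<in> Z_ht D"
  shows "(LINT t|lebesgue_on (slab D n). L2_inner (surface_measure D F)
      (\<lambda>x. interpolant D n (\<lambda>s. gamma_F D F (w s) *\<^sub>R jump D F (u s) x) t) (jump D F (v t))) =
    (\<Sum>i\<in>{1..deg + 1}. gamma_limit F n (radau_node D n i) w *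
      (LINT t|lebesgue_on (slab D n). L2_inner (surface_measure D F)
        (\<lambda>x. lagrange_basis D n i t *\<^sub>R
          time_limit (slab D n) (\<lambda>t. jump D F (u t)) (radau_node D n i) x) (jump D F (v t))))"
proof -
  note op = field_op_facet(2)[OF n F]
  note G = field_opD(1)[OF op] and su = field_opD(3)[OF op u] and sv = field_opD(3)[OF op v]
  let ?f = "\<lambda>i t x. lagrange_basis D n i t *\<^sub>R
    time_limit (slab D n) (\<lambda>t. jump D F (u t)) (radau_node D n i) x"
  have sf: "sep (surface_measure D F) F (slab D n) (?f i)" if i: "i \<in> {1..deg + 1}" for i
  proof -
    have "continuous_on UNIV (lagrange_basis D n i)"
      unfolding lagrange_basis_def[abs_def] divide_inverse by (intro continuous_intros)
    then show ?thesis
      by (rule sep_base[OF _ sep_time_limit(2)[OF G su node_nontrivial[OF n n i]]]) (rule refl)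
  qed
  have eq: "interpolant D n (\<lambda>s. gamma_F D F (w s) *\<^sub>R jump D F (u s) x) t =
      (\<Sum>i\<in>{1..deg + 1}. gamma_limit F n (radau_node D n i) w *\<^sub>R ?f i t x)" if "x \<in> F" for t x
    using interpolant_scaled_eq[OF G n su gamma_F_tendsto[OF w F n node_nontrivial[OF n n]] that]
    by (simp add: mult.commute)
  show ?thesis
    using sf sv eq unfolding slab_def by (intro sep_form_sum[OF G]) auto
qed

text \<open>\<open>T\<close> is the convective form with the upwind term expanded at the nodes.
  Volume and flux terms are linear in \<open>w\<close>; the upwind term is a sum of continuous node
  values times constants.\<close>

lemma c_form_seq_cont:
  assumes u: "u \<in> Z_ht D" and v: "v \<in> Z_ht D"
  shows "\<exists>T. seq_cont T \<and> (\<forall>w\<in>Z_ht D. c_form D w u v = T w)"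
proof -
  define B where "B n F i = (LINT t|lebesgue_on (slab D n). L2_inner (surface_measure D F)
        (\<lambda>x. lagrange_basis D n i t *\<^sub>R
          time_limit (slab D n) (\<lambda>t. jump D F (u t)) (radau_node D n i) x) (jump D F (v t)))" for n F i
  define T where "T w = (\<Sum>n=1..num_steps D.
     (LINT t|lebesgue_on (slab D n).
        L2_inner (vol D) (\<lambda>x. interpolant D n (\<lambda>s. broken_grad (u s) x *v w s x) t) (v t))
     + (\<Sum>F\<in>interior_facets D.
          - (LINT t|lebesgue_on (slab D n). L2_inner (surface_measure D F)
               (\<lambda>x. interpolant D n (\<lambda>s. normal_component D F (w s) x *\<^sub>R jump D F (u s) x) t)
               (avg D F (v t)))
          + 1/2 * (\<Sum>i\<in>{1..deg + 1}. gamma_limit F n (radau_node D n i) w * B n F i)))" for w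
  have "seq_cont T"
    unfolding T_def[abs_def]
  proof (intro seq_cont_sum seq_cont_add)
    fix n assume n: "n \<in> {1..num_steps D}"
    show "seq_cont (\<lambda>w. LINT t|lebesgue_on (slab D n).
        L2_inner (vol D) (\<lambda>x. interpolant D n (\<lambda>s. broken_grad (u s) x *v w s x) t) (v t))"
      by (rule seq_cont_lin_form, rule lin_form_left[OF field_op_convection(2)[OF n u] field_opD(3)[OF field_op_id[OF n] v]])
    fix F assume "F \<in> interior_facets D"
    then have F: "F \<in> facets D" using interior_facets_subset by blast
    show "seq_cont (\<lambda>w. - (LINT t|lebesgue_on (slab D n). L2_inner (surface_measure D F)
        (\<lambda>x. interpolant D n (\<lambda>s. normal_component D F (w s) x *\<^sub>R jump D F (u s) x) t) (avg D F (v t))))"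
      by (rule seq_cont_uminus, rule seq_cont_lin_form,
          rule lin_form_left[OF field_op_flux(2)[OF n F u] field_opD(3)[OF field_op_facet(3)[OF n F] v]])
    show "seq_cont (\<lambda>w. 1/2 * (\<Sum>i\<in>{1..deg + 1}. gamma_limit F n (radau_node D n i) w * B n F i))"
      by (intro seq_cont_mult seq_cont_const seq_cont_sum seq_cont_gamma_limit F n node_nontrivial)
  qed
  moreover have "c_form D w u v = T w" if w: "w \<in> Z_ht D" for w
    unfolding c_form_def T_def B_def
    using interior_facets_subset
    by (intro sum.cong refl arg_cong2[where f=plus] arg_cong2[where f=times] upwind_form_eq w u v) auto
  ultimately show ?thesis by blast
qed

end

section \<open>The load functional\<close>

lemma L2_Cauchy_Schwarz:
  assumes f: "f \<in> L2_space M" and g: "g \<in> L2_space M"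
  shows "\<bar>L2_inner M f g\<bar> \<le> L2_norm M f * L2_norm M g"
proof -
  define A B C where "A = (LINT x|M. (norm (f x))\<^sup>2)" and "B = L2_inner M f g"
    and "C = (LINT x|M. (norm (g x))\<^sup>2)"
  have nn: "0 \<le> A" "0 \<le> C" by (simp_all add: A_def C_def)
  have quad: "0 \<le> A - 2 * r * B + r\<^sup>2 * C" for r
  proof -
    have "0 \<le> (LINT x|M. (norm (f x - r *\<^sub>R g x))\<^sup>2)" by simp
    also have "\<dots> = (LINT x|M. (norm (f x))\<^sup>2 - (2 * r) * (f x \<bullet> g x) + r\<^sup>2 * (norm (g x))\<^sup>2)"
      unfolding power2_norm_eq_inner
      by (intro Bochner_Integration.integral_cong refl)
         (simp add: inner_simps inner_commute power2_eq_square algebra_simps)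
    also have "\<dots> = A - 2 * r * B + r\<^sup>2 * C"
      using f g L2_inner_integrable[OF f g] unfolding A_def B_def C_def L2_inner_def
      by (simp add: L2_space_def)
    finally show ?thesis .
  qed
  have "B\<^sup>2 \<le> A * C"
  proof (cases "C = 0")
    case True
    have "B = 0"
    proof (rule ccontr)
      assume "B \<noteq> 0"
      \<comment> \<open>For \<open>C = 0\<close> the quadratic is affine in \<open>r\<close>; this
        \<open>r\<close> is chosen to give it the value -1.\<close>
      then have "A - 2 * ((A + 1) / (2 * B)) * B + ((A + 1) / (2 * B))\<^sup>2 * C = - 1"
        by (simp add: True field_simps)
      then show False using quad[of "(A + 1) / (2 * B)"] by linarith
    qed
    then show ?thesis using nn by simp
  next
    case False
    \<comment> \<open>\<open>B / C\<close> minimizes the quadratic.\<close>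
    have "0 \<le> A - 2 * (B / C) * B + (B / C)\<^sup>2 * C" by (rule quad)
    also have "\<dots> = A - B\<^sup>2 / C" using False by (simp add: power2_eq_square field_simps)
    finally show ?thesis using False nn by (simp add: field_simps)
  qed
  then have "\<bar>B\<bar> \<le> sqrt (A * C)"
    by (metis real_sqrt_abs real_sqrt_le_mono)
  then show ?thesis by (simp add: L2_norm_def A_def B_def C_def real_sqrt_mult)
qed

section \<open>Measurability of the load in time\<close>

text \<open>Joint measurability of the load refers to the completed measure, whereas parameter
  integrals are measurable for products of Borel structures. Componentwise Borel versions bridge the
  two, up to a null set.\<close>

lemma lebesgue_Borel_version:
  fixes g :: "'a::euclidean_space \<Rightarrow> 'b::euclidean_space"
  assumes S: "S \<in> sets lebesgue" and g: "g \<in> borel_measurable (lebesgue_on S)"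
  shows "\<exists>h\<in>borel_measurable lborel. AE x in lborel. x \<in> S \<longrightarrow> g x = h x"
proof -
  have "(\<lambda>x. if x \<in> S then g x else 0) \<in> borel_measurable lebesgue"
    by (rule borel_measurable_if_I[OF g S])
  then have m: "(\<lambda>x. (if x \<in> S then g x else 0) \<bullet> b) \<in> borel_measurable (completion lborel)" for b
    by auto
  have "\<forall>b. \<exists>h\<in>borel_measurable lborel. AE x in lborel. (if x \<in> S then g x else 0) \<bullet> b = h x"
    using completion_ex_borel_measurable_real[OF m] by blast
  then obtain h where h: "\<And>b. h b \<in> borel_measurable lborel"
    "\<And>b. AE x in lborel. (if x \<in> S then g x else 0) \<bullet> b = h b x"
    unfolding Bex_def choice_iff by blast
  have "AE x in lborel. \<forall>b\<in>Basis. (if x \<in> S then g x else 0) \<bullet> b = h b x"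
    using h(2) by (intro AE_finite_allI) auto
  then have "AE x in lborel. x \<in> S \<longrightarrow> g x = (\<Sum>b\<in>Basis. h b x *\<^sub>R b)"
  proof eventually_elim
    case (elim x)
    show ?case
    proof
      assume "x \<in> S"
      have "g x = (\<Sum>b\<in>Basis. (g x \<bullet> b) *\<^sub>R b)" by (rule euclidean_representation[symmetric])
      also have "\<dots> = (\<Sum>b\<in>Basis. h b x *\<^sub>R b)"
        using elim \<open>x \<in> S\<close> by (intro sum.cong) auto
      finally show "g x = (\<Sum>b\<in>Basis. h b x *\<^sub>R b)" .
    qed
  qed
  moreover have "(\<lambda>x. \<Sum>b\<in>Basis. h b x *\<^sub>R b) \<in> borel_measurable lborel"
    by (intro borel_measurable_sum borel_measurable_scaleR h(1) borel_measurable_const)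
  ultimately show ?thesis by (rule bexI[where x="\<lambda>x. \<Sum>b\<in>Basis. h b x *\<^sub>R b"])
qed

text \<open>The parameter integral of the Borel versions is measurable in \<open>t\<close>. For
  almost every \<open>t\<close> the section of \<open>f\<close> agrees almost everywhere with that
  of its version, so the two integrals coincide for almost every \<open>t\<close>, and completeness
  carries measurability over.\<close>

lemma measurable_L2_inner_section:
  fixes f :: "real \<Rightarrow> 'a::euclidean_space \<Rightarrow> 'b::euclidean_space"
  assumes I: "I \<in> sets borel" and S: "S \<in> sets borel"
    and f: "(\<lambda>(t, x). f t x) \<in> borel_measurable (lebesgue_on (I \<times> S))"
    and ft: "AE t in lebesgue_on I. f t \<in> borel_measurable (lebesgue_on S)"
    and c: "c \<in> borel_measurable (lebesgue_on S)"
  shows "(\<lambda>t. L2_inner (lebesgue_on S) (f t) c) \<in> borel_measurable (lebesgue_on I)"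
proof -
  have IS: "I \<times> S \<in> sets lebesgue"
    using I S by (simp add: borel_Times)
  have Il: "I \<in> sets lebesgue" and Sl: "S \<in> sets lebesgue" using I S by auto
  obtain F where F: "F \<in> borel_measurable lborel" "AE z in lborel. z \<in> I \<times> S \<longrightarrow> (\<lambda>(t, x). f t x) z = F z"
    using lebesgue_Borel_version[OF IS f] by blast
  obtain \<gamma> where \<gamma>: "\<gamma> \<in> borel_measurable lborel" "AE x in lborel. x \<in> S \<longrightarrow> c x = \<gamma> x"
    using lebesgue_Borel_version[OF Sl c] by blast
  have Fm: "F \<in> borel_measurable (lborel \<Otimes>\<^sub>M lborel)" using F(1) by (simp add: lborel_prod)
  have "AE z in lborel \<Otimes>\<^sub>M lborel. z \<in> I \<times> S \<longrightarrow> (\<lambda>(t, x). f t x) z = F z"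
    unfolding lborel_prod by (rule F(2))
  from lborel_pair.AE_pair[OF this]
  have ae: "AE t in lborel. AE x in lborel. (t, x) \<in> I \<times> S \<longrightarrow> f t x = F (t, x)" by simp
  define H where "H t = (LINT x|lborel. indicator S x *\<^sub>R (F (t, x) \<bullet> \<gamma> x))" for t
  have "H \<in> borel_measurable lborel"
    unfolding H_def
  proof (rule lborel.borel_measurable_lebesgue_integral)
    show "(\<lambda>(t, x). indicator S x *\<^sub>R (F (t, x) \<bullet> \<gamma> x)) \<in> borel_measurable (lborel \<Otimes>\<^sub>M lborel)"
      using Fm \<gamma>(1) S by measurable
  qed
  then have Hm: "H \<in> borel_measurable (lebesgue_on I)"
    by (simp add: measurable_completion measurable_restrict_space1)
  have "AE t in lebesgue. AE x in lborel. (t, x) \<in> I \<times> S \<longrightarrow> f t x = F (t, x)"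
    using ae by (rule AE_completion)
  then have "AE t in lebesgue_on I. AE x in lborel. (t, x) \<in> I \<times> S \<longrightarrow> f t x = F (t, x)"
    by (subst AE_restrict_space_iff) (use Il in \<open>auto elim: eventually_mono\<close>)
  moreover have "AE t in lebesgue_on I. t \<in> I" by (rule AE_I2) simp
  ultimately have eq: "AE t in lebesgue_on I. H t = L2_inner (lebesgue_on S) (f t) c"
    using ft
  proof eventually_elim
    case (elim t)
    have "AE x in lborel. x \<in> S \<longrightarrow> f t x \<bullet> c x = F (t, x) \<bullet> \<gamma> x"
      using elim(1) \<gamma>(2) by eventually_elim (use elim(2) in auto)
    then have ae': "AE x in lebesgue. x \<in> S \<longrightarrow> f t x \<bullet> c x = F (t, x) \<bullet> \<gamma> x"
      by (rule AE_completion)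
    have Ft: "(\<lambda>x. F (t, x) \<bullet> \<gamma> x) \<in> borel_measurable lborel"
      using Fm \<gamma>(1) by measurable
    have "L2_inner (lebesgue_on S) (f t) c = (LINT x|lebesgue_on S. F (t, x) \<bullet> \<gamma> x)"
      unfolding L2_inner_def
    proof (rule integral_cong_AE)
      show "(\<lambda>x. F (t, x) \<bullet> \<gamma> x) \<in> borel_measurable (lebesgue_on S)"
        using Ft by (simp add: measurable_completion measurable_restrict_space1)
      show "AE x in lebesgue_on S. f t x \<bullet> c x = F (t, x) \<bullet> \<gamma> x"
        using ae' Sl by (simp add: AE_restrict_space_iff)
    qed (use elim(3) c in auto)
    also have "\<dots> = (LINT x|lebesgue. indicator S x *\<^sub>R (F (t, x) \<bullet> \<gamma> x))"
      using Sl by (simp add: integral_restrict_space)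
    also have "\<dots> = H t"
      unfolding H_def by (rule integral_completion) (use Ft S in measurable)
    finally show ?case ..
  qed
  have "(\<lambda>t. if t \<in> I then H t else 0) \<in> borel_measurable lebesgue"
    by (rule borel_measurable_if_I[OF Hm Il])
  moreover have "AE t in lebesgue. (if t \<in> I then H t else 0) =
      (if t \<in> I then L2_inner (lebesgue_on S) (f t) c else 0)"
    using eq Il by (auto simp: AE_restrict_space_iff elim: eventually_mono)
  ultimately have "(\<lambda>t. if t \<in> I then L2_inner (lebesgue_on S) (f t) c else 0) \<in> borel_measurable lebesgue"
    by (rule borel_measurable_AE)
  then show ?thesis by (rule borel_measurable_if_D)
qed

context valid_mesh
begin

definition time_span :: "real set" where
  "time_span = {0<..<final_time D}"

definition slabs :: "real set" where
  "slabs = (\<Union>n\<in>steps. slab D n)"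

lemma slab_subset: "n \<in> steps \<Longrightarrow> slab D n \<subseteq> time_span"
proof -
  assume n: "n \<in> steps"
  have "time_pt D 0 \<le> time_pt D (n - 1)" "time_pt D n \<le> time_pt D (num_steps D)" "time_pt D 0 = 0"
    using n valid time_pt_mono[of 0 "n - 1"] time_pt_mono[of n "num_steps D"]
    by (auto simp: valid_discretization_def)
  then show ?thesis by (auto simp: slab_def time_span_def final_time_def)
qed

lemma nodes_or_slabs: "t \<in> time_span \<Longrightarrow> t \<notin> slabs \<Longrightarrow> t \<in> time_pt D ` {..num_steps D}"
proof -
  assume t: "t \<in> time_span" "t \<notin> slabs"
  define n where "n = (LEAST n. t \<le> time_pt D n)"
  have ex: "t \<le> time_pt D (num_steps D)" using t by (simp add: time_span_def final_time_def)
  have n1: "t \<le> time_pt D n" unfolding n_def by (rule LeastI[of "\<lambda>n. t \<le> time_pt D n", OF ex])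
  have n2: "n \<le> num_steps D" unfolding n_def by (rule Least_le[of "\<lambda>n. t \<le> time_pt D n", OF ex])
  have "time_pt D 0 = 0" using valid by (simp add: valid_discretization_def)
  then have "n \<noteq> 0" using n1 t by (intro notI) (simp add: time_span_def)
  then have n: "n \<in> steps" using n2 by auto
  have "\<not> t \<le> time_pt D (n - 1)"
    using not_less_Least[of "n - 1" "\<lambda>n. t \<le> time_pt D n"] \<open>n \<noteq> 0\<close> unfolding n_def[symmetric] by simp
  moreover have "t \<notin> slab D n" using t n by (auto simp: slabs_def)
  ultimately have "t = time_pt D n" using n1 by (simp add: slab_def)
  then show ?thesis using n2 by auto
qed

text \<open>The exceptional set consists of finitely many time nodes.\<close>

lemma good_time: "good_set (lebesgue_on time_span) slabs"
  unfolding good_set_def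
proof (intro conjI allI impI)
  show "finite_measure (lebesgue_on time_span)"
    by (intro finite_measure_lebesgue_on) (auto simp: time_span_def)
  show "slabs \<subseteq> space (lebesgue_on time_span)"
    using slab_subset unfolding slabs_def by fastforce
  fix A assume "A \<subseteq> space (lebesgue_on time_span) - slabs"
  then have A: "A \<subseteq> time_span" "A \<subseteq> time_pt D ` {..num_steps D}"
    using nodes_or_slabs by auto
  then have "finite A" using finite_subset by blast
  then have "A \<in> null_sets lebesgue"
    using negligible_finite negligible_iff_null_sets by blast
  then show "A \<in> null_sets (lebesgue_on time_span)"
    using A by (subst null_sets_restrict_space) (auto simp: time_span_def)
qed

lemma integrable_slab_indicator:
  assumes g: "integrable (lebesgue_on time_span) g" and \<theta>: "continuous_on UNIV \<theta>" and n: "n \<in> steps"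
  shows "integrable (lebesgue_on time_span) (\<lambda>t. indicator (slab D n) t * \<theta> t * g t :: real)"
proof -
  have "compact (\<theta> ` {time_pt D (n - 1)..time_pt D n})"
    by (rule compact_continuous_image[OF continuous_on_subset[OF \<theta>]]) auto
  then obtain B where B: "\<And>t. t \<in> {time_pt D (n - 1)..time_pt D n} \<Longrightarrow> norm (\<theta> t) \<le> B"
    by (meson bounded_iff compact_imp_bounded imageI)
  have \<theta>m: "\<theta> \<in> borel_measurable (lebesgue_on time_span)"
    using borel_measurable_continuous_onI[OF \<theta>]
    by (simp add: measurable_completion measurable_restrict_space1)
  have im: "indicator (slab D n) \<in> borel_measurable (lebesgue_on time_span)"
    by (rule borel_measurable_indicator) (use slab_subset[OF n] in \<open>auto simp: sets_restrict_space slab_def image_iff intro!: bexI[of _ "slab D n"]\<close>)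
  show ?thesis
  proof (rule Bochner_Integration.integrable_bound)
    show "integrable (lebesgue_on time_span) (\<lambda>t. \<bar>B\<bar> * g t)" using g by simp
    show "(\<lambda>t. indicator (slab D n) t * \<theta> t * g t) \<in> borel_measurable (lebesgue_on time_span)"
      using im \<theta>m borel_measurable_integrable[OF g] by measurable
    show "AE t in lebesgue_on time_span. norm (indicator (slab D n) t * \<theta> t * g t) \<le> norm (\<bar>B\<bar> * g t)"
    proof (rule AE_I2)
      fix t
      have "\<bar>indicator (slab D n) t * \<theta> t\<bar> \<le> \<bar>B\<bar>"
        using B[of t] by (auto simp: indicator_def slab_def)
      then show "norm (indicator (slab D n) t * \<theta> t * g t) \<le> norm (\<bar>B\<bar> * g t)"
        by (simp add: abs_mult mult_right_mono)
    qed
  qed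
qed

text \<open>By Cauchy-Schwarz the pairing is dominated by a product of norms, which membership in
  \<open>L1L2_space\<close> makes integrable in time.\<close>

lemma L1L2_pairing_integrable:
  assumes f: "f \<in> L1L2_space (final_time D) \<Omega>" and c: "c \<in> L2_space (vol D)"
  shows "integrable (lebesgue_on time_span) (\<lambda>t. L2_inner (vol D) (f t) c)"
proof (rule Bochner_Integration.integrable_bound)
  have ft: "AE t in lebesgue_on time_span. f t \<in> L2_space (vol D)"
    and fn: "integrable (lebesgue_on time_span) (\<lambda>t. L2_norm (vol D) (f t))"
    and fm: "(\<lambda>(t, x). f t x) \<in> borel_measurable (lebesgue_on (time_span \<times> \<Omega>))"
    using f unfolding L1L2_space_def time_span_def by blast+
  show "integrable (lebesgue_on time_span) (\<lambda>t. L2_norm (vol D) (f t) * L2_norm (vol D) c)"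
    using fn by simp
  show "(\<lambda>t. L2_inner (vol D) (f t) c) \<in> borel_measurable (lebesgue_on time_span)"
  proof (rule measurable_L2_inner_section[OF _ _ fm])
    show "AE t in lebesgue_on time_span. f t \<in> borel_measurable (vol D)"
      using ft by eventually_elim (simp add: L2_space_def)
  qed (use c domain_open in \<open>auto simp: L2_space_def time_span_def\<close>)
  show "AE t in lebesgue_on time_span. norm (L2_inner (vol D) (f t) c) \<le>
      norm (L2_norm (vol D) (f t) * L2_norm (vol D) c)"
    using ft
  proof eventually_elim
    case (elim t)
    from L2_Cauchy_Schwarz[OF elim c] show ?case by simp
  qed
qed

lemma Z_ht_L2: "u \<in> Z_ht D \<Longrightarrow> n \<in> steps \<Longrightarrow> t \<in> slab D n \<Longrightarrow> u t \<in> L2_space (vol D)"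
  by (rule bdd_meas_L2_space[OF good_vol sep_bdd_meas[OF good_vol field_opD(3)[OF field_op_id]]])

lemma L2_inner_sum_right:
  assumes f: "f \<in> L2_space (vol D)" and "finite I" "\<And>i. i \<in> I \<Longrightarrow> c i \<in> L2_space (vol D)"
    and "\<And>x. x \<in> G \<Longrightarrow> v x = (\<Sum>i\<in>I. r i *\<^sub>R c i x)"
  shows "v \<in> L2_space (vol D) \<and> L2_inner (vol D) f v = (\<Sum>i\<in>I. r i * L2_inner (vol D) f (c i))"
  using assms(2-4)
proof (induction I arbitrary: v)
  case empty
  have "v \<in> L2_space (vol D)"
    by (rule L2_space_good_cong[OF good_vol L2_space_lincomb[OF f f, of 0 0]]) (use empty in simp)
  moreover have "L2_inner (vol D) v f = 0 * L2_inner (vol D) f f + 0 * L2_inner (vol D) f f"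
    by (rule L2_inner_L2_lincomb[OF good_vol f f f]) (use empty in simp)
  ultimately show ?case by (simp add: L2_inner_commute)
next
  case (insert i I)
  let ?w = "\<lambda>x. \<Sum>i\<in>I. r i *\<^sub>R c i x"
  have w: "?w \<in> L2_space (vol D)" "L2_inner (vol D) f ?w = (\<Sum>i\<in>I. r i * L2_inner (vol D) f (c i))"
    using insert.IH[of ?w] insert.prems by auto
  have ci: "c i \<in> L2_space (vol D)" using insert.prems by simp
  have eq: "v x = r i *\<^sub>R c i x + 1 *\<^sub>R ?w x" if "x \<in> G" for x
    using insert that by simp
  have "v \<in> L2_space (vol D)"
    by (rule L2_space_good_cong[OF good_vol L2_space_lincomb[OF ci w(1), of "r i" 1]]) (use eq in simp)
  moreover have "L2_inner (vol D) v f = r i * L2_inner (vol D) (c i) f + 1 * L2_inner (vol D) ?w f"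
    by (rule L2_inner_L2_lincomb[OF good_vol ci w(1) f eq])
  ultimately show ?case using insert.hyps w(2) by (simp add: L2_inner_commute[of _ _ f])
qed

text \<open>The load is only integrable in time, hence outside the separated class. Expanding the
  discrete factor on each slab reduces the pairing to bounded functions of time multiplied by
  pairings of \<open>f t\<close> with fixed fields.\<close>

lemma load_integrable:
  assumes f: "f \<in> L1L2_space (final_time D) \<Omega>" and u: "u \<in> Z_ht D"
  shows "integrable (lebesgue_on time_span) (\<lambda>t. L2_inner (vol D) (f t) (u t))"
proof -
  have ft: "AE t in lebesgue_on time_span. f t \<in> L2_space (vol D)"
    using f unfolding L1L2_space_def time_span_def by blast
  have "\<forall>n. \<exists>c. n \<in> steps \<longrightarrow> (\<forall>i\<le>deg. c i \<in> Z_h) \<and>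
      (\<forall>t\<in>slab D n. \<forall>x\<in>\<Omega>. u t x = (\<Sum>i\<le>deg. t ^ i *\<^sub>R c i x))"
    using Z_htD[OF u] by blast
  from choice[OF this] obtain c where c: "\<And>n. n \<in> steps \<Longrightarrow> \<forall>i\<le>deg. c n i \<in> Z_h"
    "\<And>n. n \<in> steps \<Longrightarrow> \<forall>t\<in>slab D n. \<forall>x\<in>\<Omega>. u t x = (\<Sum>i\<le>deg. t ^ i *\<^sub>R c n i x)"
    by blast
  have cL2: "c n i \<in> L2_space (vol D)" if "n \<in> steps" "i \<le> deg" for n i
  proof -
    have "c n i \<in> Z_h" using c(1)[OF that(1)] that(2) by blast
    then show ?thesis by (simp add: Z_h_def has_weak_div_def)
  qed
  \<comment> \<open>The indicators glue the slabs together; off the time nodes exactly one of them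
    is nonzero.\<close>
  define h where "h t = (\<Sum>n\<in>steps. \<Sum>i\<le>deg. indicator (slab D n) t * t ^ i * L2_inner (vol D) (f t) (c n i))" for t
  have "integrable (lebesgue_on time_span) h"
    unfolding h_def[abs_def]
  proof (intro Bochner_Integration.integrable_sum)
    fix n i assume ni: "n \<in> steps" "i \<in> {..deg}"
    show "integrable (lebesgue_on time_span) (\<lambda>t. indicator (slab D n) t * t ^ i * L2_inner (vol D) (f t) (c n i))"
      by (rule integrable_slab_indicator[OF L1L2_pairing_integrable[OF f cL2] _ ni(1)])
         (use ni in \<open>auto intro!: continuous_intros\<close>)
  qed
  moreover have ae: "AE t in lebesgue_on time_span. h t = L2_inner (vol D) (f t) (u t)"
    using ft good_set_AE[OF good_time, of "\<lambda>t. t \<in> slabs", simplified]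
  proof eventually_elim
    case (elim t)
    then obtain n where n: "n \<in> steps" "t \<in> slab D n" unfolding slabs_def by blast
    have "h t = (\<Sum>m\<in>steps. if m = n then \<Sum>i\<le>deg. t ^ i * L2_inner (vol D) (f t) (c n i) else 0)"
      unfolding h_def using n slab_unique by (intro sum.cong) (auto simp: indicator_def)
    also have "\<dots> = (\<Sum>i\<le>deg. t ^ i * L2_inner (vol D) (f t) (c n i))"
      using n(1) by simp
    also have "\<dots> = L2_inner (vol D) (f t) (u t)"
      using L2_inner_sum_right[OF elim(1), of "{..deg}" "c n" "u t" "\<lambda>i. t ^ i"] cL2 c(2)[OF n(1)] n
        mesh_interior_subset by (auto simp: subset_iff)
    finally show ?case .
  qed
  moreover have "(\<lambda>t. L2_inner (vol D) (f t) (u t)) \<in> borel_measurable (lebesgue_on time_span)"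
  proof -
    have "(\<lambda>t. if t \<in> time_span then h t else 0) \<in> borel_measurable lebesgue"
      using borel_measurable_integrable[OF calculation(1)]
      by (rule borel_measurable_if_I) (simp add: time_span_def)
    moreover have "AE t in lebesgue. (if t \<in> time_span then h t else 0) =
        (if t \<in> time_span then L2_inner (vol D) (f t) (u t) else 0)"
      using ae by (auto simp: AE_restrict_space_iff time_span_def elim: eventually_mono)
    ultimately show ?thesis by (rule borel_measurable_if_D[OF borel_measurable_AE])
  qed
  ultimately show ?thesis
    using integrable_cong_AE[of h "lebesgue_on time_span"] borel_measurable_integrable by blast
qed

lemma rhs_form_lin:
  assumes f: "f \<in> L1L2_space (final_time D) \<Omega>" and u0: "u0 \<in> Z_space \<Omega>"
  shows "lin_form (rhs_form D f u0)"
  unfolding rhs_form_def[abs_def]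
proof (intro lin_form_add)
  have "u0 \<in> L2_space (vol D)" using u0 by (simp add: Z_space_def has_weak_div_def)
  then show "lin_form (\<lambda>z. L2_inner (vol D) u0 (right_lim z 0))"
    by (rule snap_lin_form_right[OF snap_op_right_lim_initial])
  show "lin_form (\<lambda>z. LINT t|lebesgue_on {0<..<final_time D}. L2_inner (vol D) (f t) (z t))"
    unfolding lin_form_def time_span_def[symmetric]
  proof (intro ballI allI impI)
    fix u u1 u2 r s
    assume *: "u \<in> Z_ht D" "u1 \<in> Z_ht D" "u2 \<in> Z_ht D" "comb r u1 s u2 u"
    note int = load_integrable[OF f]
    have ft: "AE t in lebesgue_on time_span. f t \<in> L2_space (vol D)"
      using f unfolding L1L2_space_def time_span_def by blast
    have "(LINT t|lebesgue_on time_span. L2_inner (vol D) (f t) (u t)) =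
        (LINT t|lebesgue_on time_span. r * L2_inner (vol D) (f t) (u1 t) + s * L2_inner (vol D) (f t) (u2 t))"
    proof (rule integral_cong_AE)
      show "AE t in lebesgue_on time_span. L2_inner (vol D) (f t) (u t) =
          r * L2_inner (vol D) (f t) (u1 t) + s * L2_inner (vol D) (f t) (u2 t)"
        using ft good_set_AE[OF good_time, of "\<lambda>t. t \<in> slabs", simplified]
      proof eventually_elim
        case (elim t)
        then obtain n where n: "n \<in> steps" "t \<in> slab D n" unfolding slabs_def by blast
        have "L2_inner (vol D) (u t) (f t) = r * L2_inner (vol D) (u1 t) (f t) + s * L2_inner (vol D) (u2 t) (f t)"
          by (rule L2_inner_L2_lincomb[OF good_vol Z_ht_L2[OF *(2) n] Z_ht_L2[OF *(3) n] elim(1)])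
             (rule combD[OF *(4) n])
        then show ?case by (simp add: L2_inner_commute)
      qed
    qed (use int[OF *(1)] int[OF *(2)] int[OF *(3)] borel_measurable_integrable in
        \<open>auto intro!: borel_measurable_integrable Bochner_Integration.integrable_add integrable_mult_right\<close>)
    also have "\<dots> = r * (LINT t|lebesgue_on time_span. L2_inner (vol D) (f t) (u1 t)) +
        s * (LINT t|lebesgue_on time_span. L2_inner (vol D) (f t) (u2 t))"
      using int[OF *(2)] int[OF *(3)] by simp
    finally show "(LINT t|lebesgue_on time_span. L2_inner (vol D) (f t) (u t)) =
        r * (LINT t|lebesgue_on time_span. L2_inner (vol D) (f t) (u1 t)) +
        s * (LINT t|lebesgue_on time_span. L2_inner (vol D) (f t) (u2 t))" .
  qed
qed

section \<open>The energy norm controls the coordinates\<close>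

text \<open>The L2 inner product over the space-time cylinder, slab by slab. It is the definite form
  through which the stability estimate bounds coordinates.\<close>

definition st_inner :: "(real \<Rightarrow> real^'d \<Rightarrow> real^'d) \<Rightarrow> (real \<Rightarrow> real^'d \<Rightarrow> real^'d) \<Rightarrow> real" where
  "st_inner u v = (\<Sum>n\<in>steps. LINT t|lebesgue_on (slab D n). L2_inner (vol D) (u t) (v t))"

lemma st_inner_bilin: "bilin_form st_inner"
  unfolding st_inner_def[abs_def]
  by (intro bilin_form_sum bilin_form_fields[OF field_op_id field_op_id])

lemma L2_inner_self_nonneg: "0 \<le> L2_inner M f f"
  unfolding L2_inner_def by simp

lemma st_inner_nonneg: "0 \<le> st_inner u u"
  unfolding st_inner_def by (intro sum_nonneg integral_nonneg_AE AE_I2 L2_inner_self_nonneg)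

lemma continuous_L2_inner:
  assumes "u \<in> Z_ht D" "n \<in> steps"
  shows "\<exists>\<phi>. continuous_on UNIV \<phi> \<and> (\<forall>t\<in>slab D n. \<phi> t = L2_inner (vol D) (u t) (u t))"
  by (rule sep_L2_inner[OF good_vol]) (rule field_opD(3)[OF field_op_id[OF assms(2)] assms(1)])+

lemma integrable_slab_L2_inner:
  assumes "u \<in> Z_ht D" "n \<in> steps"
  shows "integrable (lebesgue_on (slab D n)) (\<lambda>t. L2_inner (vol D) (u t) (u t))"
proof -
  obtain \<phi> where "continuous_on UNIV \<phi>" "\<forall>t\<in>slab D n. \<phi> t = L2_inner (vol D) (u t) (u t)"
    using continuous_L2_inner[OF assms] by blast
  then show ?thesis unfolding slab_def by (intro integrable_continuous_on_slab[of \<phi>]) auto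
qed

text \<open>Vanishing almost everywhere is upgraded twice, by continuity in time on the open slab
  and by continuity of the piece on the open element.\<close>

lemma st_inner_zero_imp:
  assumes u: "u \<in> Z_ht D" and z: "st_inner u u = 0" and n: "n \<in> steps" "t \<in> slab D n" "x \<in> G"
  shows "u t x = 0"
proof -
  have "(LINT t|lebesgue_on (slab D n). L2_inner (vol D) (u t) (u t)) = 0"
    using z n(1) unfolding st_inner_def
    by (subst (asm) sum_nonneg_eq_0_iff) (auto intro!: integral_nonneg_AE L2_inner_self_nonneg)
  then have "AE t in lebesgue_on (slab D n). L2_inner (vol D) (u t) (u t) = 0"
    by (subst (asm) integral_nonneg_eq_0_iff_AE[OF integrable_slab_L2_inner[OF u n(1)]])
       (auto intro: L2_inner_self_nonneg)
  then have ae: "AE t in lebesgue. t \<in> slab D n \<longrightarrow> L2_inner (vol D) (u t) (u t) = 0"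
    by (simp add: AE_restrict_space_iff slab_def)
  obtain \<phi> where \<phi>: "continuous_on UNIV \<phi>" "\<forall>t\<in>slab D n. \<phi> t = L2_inner (vol D) (u t) (u t)"
    using continuous_L2_inner[OF u n(1)] by blast
  have "t \<in> {t. \<phi> t = 0}"
  proof (rule mem_closed_if_AE_lebesgue_open[OF slab_open _ _ n(2)])
    show "closed {t. \<phi> t = 0}" using \<phi>(1) by (intro closed_Collect_eq) auto
    show "AE t\<in>slab D n in lebesgue. t \<in> {t. \<phi> t = 0}"
      using ae \<phi>(2) by (auto elim: eventually_mono)
  qed
  then have z: "L2_inner (vol D) (u t) (u t) = 0" using \<phi>(2) n(2) by simp
  have "AE y in vol D. u t y \<bullet> u t y = 0"
    using z L2_inner_integrable[OF Z_ht_L2[OF u n(1,2)] Z_ht_L2[OF u n(1,2)]]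
    unfolding L2_inner_def by (subst (asm) integral_nonneg_eq_0_iff_AE) auto
  then have ae: "AE y in lebesgue. y \<in> \<Omega> \<longrightarrow> u t y = 0"
    using domain_sets by (simp add: AE_restrict_space_iff)
  obtain K where K: "K \<in> mesh D" "x \<in> interior K" using n(3) by (auto simp: mesh_interior_def)
  obtain p where p: "continuous_on UNIV p" "\<And>x. x \<in> interior K \<Longrightarrow> u t x = p x"
    using pw_contE[OF pw_C1_imp_pw_cont[OF Z_ht_pw_C1[OF u n(1,2)]] K(1)] by blast
  have "interior K \<subseteq> \<Omega>" using K(1) mesh_interior_subset by (auto simp: mesh_interior_def)
  have "x \<in> {x. p x = 0}"
  proof (rule mem_closed_if_AE_lebesgue_open[OF open_interior _ _ K(2)])
    show "closed {x. p x = 0}" using p(1) by (intro closed_Collect_eq) auto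
    show "AE x\<in>interior K in lebesgue. x \<in> {x. p x = 0}"
      using ae by eventually_elim (use p(2) \<open>interior K \<subseteq> \<Omega>\<close> in auto)
  qed
  then show ?thesis using p(2)[OF K(2)] by simp
qed

lemma L2_norm_square: "(L2_norm M f)\<^sup>2 = L2_inner M f f"
  by (simp add: L2_norm_def L2_inner_def power2_norm_eq_inner)

text \<open>The essential supremum bounds its function here once measurability and an essential
  bound are known, since \<open>Linf_norm\<close> maps infinite values to 0. Both come from the
  continuity of the squared norm on every slab.\<close>

lemma Linf_L2_AE:
  assumes u: "u \<in> Z_ht D"
  shows "AE t in lebesgue_on time_span. L2_norm (vol D) (u t) \<le>
    Linf_norm (lebesgue_on time_span) (\<lambda>t. L2_norm (vol D) (u t))"
proof -
  have "\<forall>n. \<exists>\<phi>. n \<in> steps \<longrightarrow> continuous_on UNIV \<phi> \<and> (\<forall>t\<in>slab D n. \<phi> t = L2_inner (vol D) (u t) (u t))"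
    using continuous_L2_inner[OF u] by blast
  from choice[OF this] obtain \<phi> where \<phi>: "\<And>n. n \<in> steps \<Longrightarrow> continuous_on UNIV (\<phi> n)"
    "\<And>n t. n \<in> steps \<Longrightarrow> t \<in> slab D n \<Longrightarrow> \<phi> n t = L2_inner (vol D) (u t) (u t)"
    by blast
  have eq: "sqrt (\<phi> n t) = L2_norm (vol D) (u t)" if "n \<in> steps" "t \<in> slab D n" for n t
    unfolding \<phi>(2)[OF that] by (simp add: L2_norm_def L2_inner_def power2_norm_eq_inner)
  \<comment> \<open>A version that is 0 at the time nodes, glued from continuous square roots;
    measurability is read off from it.\<close>
  define g where "g t = (\<Sum>n\<in>steps. indicator (slab D n) t * sqrt (\<phi> n t))" for t
  have "integrable (lebesgue_on time_span) g"
    unfolding g_def[abs_def]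
  proof (rule Bochner_Integration.integrable_sum)
    fix n assume n: "n \<in> steps"
    interpret finite_measure "lebesgue_on time_span"
      using good_time by (simp add: good_set_def)
    have "integrable (lebesgue_on time_span) (\<lambda>t. indicator (slab D n) t * sqrt (\<phi> n t) * 1)"
      by (rule integrable_slab_indicator[OF _ _ n]) (auto intro!: continuous_intros \<phi> n)
    then show "integrable (lebesgue_on time_span) (\<lambda>t. indicator (slab D n) t * sqrt (\<phi> n t))"
      by simp
  qed
  then have gm: "g \<in> borel_measurable (lebesgue_on time_span)" by simp
  have g: "g t = L2_norm (vol D) (u t)" if t: "t \<in> slabs" for t
  proof -
    obtain n where n: "n \<in> steps" "t \<in> slab D n" using t unfolding slabs_def by blast
    have "g t = (\<Sum>m\<in>steps. if m = n then sqrt (\<phi> n t) else 0)"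
      unfolding g_def using n slab_unique by (intro sum.cong) (auto simp: indicator_def)
    also have "\<dots> = L2_norm (vol D) (u t)" using n(1) eq[OF n] by simp
    finally show ?thesis .
  qed
  have m: "(\<lambda>t. L2_norm (vol D) (u t)) \<in> borel_measurable (lebesgue_on time_span)"
    by (rule good_set_measurable_cong[OF good_time gm]) (auto simp: g)
  have "\<exists>B. \<forall>t\<in>slab D n. sqrt (\<phi> n t) \<le> B" if n: "n \<in> steps" for n
  proof -
    have "compact ((\<lambda>t. sqrt (\<phi> n t)) ` {time_pt D (n - 1)..time_pt D n})"
      by (rule compact_continuous_image) (auto intro!: continuous_intros continuous_on_subset[OF \<phi>(1)[OF n]])
    then obtain B where "\<And>t. t \<in> {time_pt D (n - 1)..time_pt D n} \<Longrightarrow> norm (sqrt (\<phi> n t)) \<le> B"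
      by (meson bounded_iff compact_imp_bounded imageI)
    then show ?thesis by (intro exI[of _ B]) (auto simp: slab_def abs_le_iff)
  qed
  then obtain B where B: "\<And>n t. n \<in> steps \<Longrightarrow> t \<in> slab D n \<Longrightarrow> sqrt (\<phi> n t) \<le> B n"
    by metis
  have "AE t in lebesgue_on time_span. norm (L2_norm (vol D) (u t)) \<le> (\<Sum>n\<in>steps. \<bar>B n\<bar>)"
  proof (rule good_set_AE[OF good_time])
    fix t assume "t \<in> slabs"
    then obtain n where n: "n \<in> steps" "t \<in> slab D n" unfolding slabs_def by blast
    have "norm (L2_norm (vol D) (u t)) = L2_norm (vol D) (u t)" by (simp add: L2_norm_def)
    also have "\<dots> \<le> \<bar>B n\<bar>" using B[OF n] eq[OF n] by linarith
    also have "\<dots> \<le> (\<Sum>n\<in>steps. \<bar>B n\<bar>)" using n(1) by (intro member_le_sum) auto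
    finally show "norm (L2_norm (vol D) (u t)) \<le> (\<Sum>n\<in>steps. \<bar>B n\<bar>)" .
  qed
  from Linf_norm_AE[OF m this] show ?thesis
    by eventually_elim simp
qed

text \<open>The essential supremum in time contained in the energy norm, integrated over the slabs,
  contributes the sum of their lengths. This factor does not involve \<open>w\<close>, which makes
  the bound uniform in the advection field.\<close>

lemma st_inner_le_energy:
  assumes u: "u \<in> Z_ht D" and \<nu>: "0 \<le> \<nu>"
  shows "st_inner u u \<le> (\<Sum>n\<in>steps. measure (lebesgue_on (slab D n)) (slab D n)) * (energy_norm D \<nu> w u)\<^sup>2"
proof -
  define E where "E = (Linf_norm (lebesgue_on time_span) (\<lambda>t. L2_norm (vol D) (u t)))\<^sup>2"
  have "E \<le> (energy_norm D \<nu> w u)\<^sup>2"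
    using \<nu> unfolding energy_norm_def E_def time_span_def by simp
  have "(LINT t|lebesgue_on (slab D n). L2_inner (vol D) (u t) (u t)) \<le>
      measure (lebesgue_on (slab D n)) (slab D n) * E" if n: "n \<in> steps" for n
  proof -
    have sl: "slab D n \<in> sets lebesgue" by (simp add: slab_def)
    have fin: "finite_measure (lebesgue_on (slab D n))"
      by (intro finite_measure_lebesgue_on) (auto simp: slab_def)
    have "AE t in lebesgue. t \<in> time_span \<longrightarrow> L2_norm (vol D) (u t) \<le>
        Linf_norm (lebesgue_on time_span) (\<lambda>t. L2_norm (vol D) (u t))"
      using Linf_L2_AE[OF u] by (simp add: AE_restrict_space_iff time_span_def)
    then have "AE t in lebesgue_on (slab D n). L2_norm (vol D) (u t) \<le>
        Linf_norm (lebesgue_on time_span) (\<lambda>t. L2_norm (vol D) (u t))"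
      using sl slab_subset[OF n] by (auto simp: AE_restrict_space_iff elim: eventually_mono)
    then have "AE t in lebesgue_on (slab D n). L2_inner (vol D) (u t) (u t) \<le> E"
    proof eventually_elim
      case (elim t)
      then show ?case unfolding E_def L2_norm_square[symmetric]
        by (rule power_mono) (simp add: L2_norm_def)
    qed
    then have "(LINT t|lebesgue_on (slab D n). L2_inner (vol D) (u t) (u t)) \<le> (LINT t|lebesgue_on (slab D n). E)"
      using fin by (intro integral_mono_AE integrable_slab_L2_inner[OF u n]) (auto simp: finite_measure.integrable_const)
    then show ?thesis by simp
  qed
  then have "st_inner u u \<le> (\<Sum>n\<in>steps. measure (lebesgue_on (slab D n)) (slab D n) * E)"
    unfolding st_inner_def by (intro sum_mono)
  also have "\<dots> = (\<Sum>n\<in>steps. measure (lebesgue_on (slab D n)) (slab D n)) * E"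
    by (simp add: sum_distrib_right)
  also have "\<dots> \<le> (\<Sum>n\<in>steps. measure (lebesgue_on (slab D n)) (slab D n)) * (energy_norm D \<nu> w u)\<^sup>2"
    using \<open>E \<le> _\<close> by (intro mult_left_mono sum_nonneg) auto
  finally show ?thesis .
qed

end

section \<open>A finite basis of the discrete space\<close>

context valid_mesh
begin

definition seen :: "(real \<times> (real^'d)) set" where
  "seen = slabs \<times> G"

text \<open>Discrete functions are arbitrary at the time nodes and on the skeleton, so that only normalized
  representatives span a finite-dimensional space.\<close>

definition Z_rep :: "(real \<times> (real^'d) \<Rightarrow> real^'d) set" where
  "Z_rep = {U. curry U \<in> Z_ht D \<and> (\<forall>z. z \<notin> seen \<longrightarrow> U z = 0)}"

text \<open>Setting the coefficient fields to 0 on the skeleton keeps them in \<open>Z_h\<close>, so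
  the normalized function is still a discrete one.\<close>

lemma Z_rep_exists:
  assumes u: "u \<in> Z_ht D"
  shows "(\<lambda>z. if z \<in> seen then case_prod u z else 0) \<in> Z_rep"
proof -
  let ?U = "\<lambda>z. if z \<in> seen then case_prod u z else 0"
  have "curry ?U \<in> Z_ht D"
  proof (rule Z_htI)
    fix n assume n: "n \<in> steps"
    obtain c where c: "\<forall>i\<le>deg. c i \<in> Z_h" "\<forall>t\<in>slab D n. \<forall>x\<in>\<Omega>. u t x = (\<Sum>i\<le>deg. t ^ i *\<^sub>R c i x)"
      using Z_htD[OF u n] by blast
    define c' where "c' i x = (if x \<in> G then c i x else 0)" for i x
    have "c' i \<in> Z_h" if "i \<le> deg" for i
    proof -
      have ci: "c i \<in> Z_h" using c(1) that by blast
      show ?thesis by (rule Z_h_lincomb[OF ci ci, of _ 1 0]) (simp add: c'_def)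
    qed
    moreover have "curry ?U t x = (\<Sum>i\<le>deg. t ^ i *\<^sub>R c' i x)" if "t \<in> slab D n" "x \<in> \<Omega>" for t x
    proof -
      have "t \<in> slabs" using n that by (auto simp: slabs_def)
      then show ?thesis using c(2) that by (auto simp: seen_def c'_def)
    qed
    ultimately show "\<exists>c. (\<forall>i\<le>deg. c i \<in> Z_h) \<and>
        (\<forall>t\<in>slab D n. \<forall>x\<in>\<Omega>. curry ?U t x = (\<Sum>i\<le>deg. t ^ i *\<^sub>R c i x))"
      by (intro exI[of _ c'] conjI allI impI ballI)
  qed
  then show ?thesis by (simp add: Z_rep_def)
qed

text \<open>A choice of element for each point, so that sums over the mesh count every point of
  \<open>G\<close> exactly once.\<close>

definition cell :: "real^'d \<Rightarrow> (real^'d) set" where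
  "cell x = (SOME K. K \<in> mesh D \<and> x \<in> interior K)"

lemma cell: "x \<in> G \<Longrightarrow> cell x \<in> mesh D \<and> x \<in> interior (cell x)"
  unfolding cell_def by (rule someI_ex) (auto simp: mesh_interior_def)

text \<open>Monomials in time and space times a unit vector, cut off to one slab and one element.
  They may be neither divergence-free nor normally continuous: their purpose is to bound the
  dimension from above.\<close>

definition mono_field ::
  "nat \<times> (real^'d) set \<times> nat \<times> ('d \<Rightarrow> nat) \<times> 'd \<Rightarrow> real \<times> (real^'d) \<Rightarrow> real^'d" where
  "mono_field = (\<lambda>(n, K, i, \<alpha>, j) (t, x).
     if t \<in> slab D n \<and> x \<in> G \<and> cell x = K then (t ^ i * monomial \<alpha> x) *\<^sub>R axis j 1 else 0)"

definition mono_fields :: "(real \<times> (real^'d) \<Rightarrow> real^'d) set" where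
  "mono_fields = mono_field ` (steps \<times> mesh D \<times> {..deg} \<times> multi_indices (Suc (space_degree D)) \<times> UNIV)"

lemma finite_mono_fields: "finite mono_fields"
  unfolding mono_fields_def
  by (intro finite_imageI finite_cartesian_product finite_mesh finite_multi_indices) auto

lemma vec_sum_axis: "v = (\<Sum>j\<in>UNIV. (v $ j) *\<^sub>R axis j (1::real))"
  by (simp add: vec_eq_iff axis_def if_distrib[of "\<lambda>x. _ * x"] cong: if_cong)

text \<open>A normalized function is the sum of its restrictions \<open>P n K\<close> to pairs of a
  slab and an element, and each restriction is a combination of cut-off monomials.\<close>

lemma Z_rep_span: "Z_rep \<subseteq> fun_space.span mono_fields"
proof
  fix U assume U: "U \<in> Z_rep"
  define P where "P n K = (\<lambda>(t, x). if t \<in> slab D n \<and> x \<in> G \<and> cell x = K then U (t, x) else 0)" for n K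
  have "P n K \<in> fun_space.span mono_fields" if n: "n \<in> steps" and K: "K \<in> mesh D" for n K
  proof -
    obtain c where c: "\<forall>i\<le>deg. c i \<in> Z_h"
      "\<forall>t\<in>slab D n. \<forall>x\<in>\<Omega>. curry U t x = (\<Sum>i\<le>deg. t ^ i *\<^sub>R c i x)"
      using Z_htD[of "curry U" n] U n by (auto simp: Z_rep_def)
    have "\<exists>d. \<forall>x\<in>interior K. c i x $ j = (\<Sum>\<alpha>\<in>multi_indices (Suc (space_degree D)). d \<alpha> * monomial \<alpha> x)"
      if "i \<le> deg" for i j
    proof -
      have "c i \<in> V_h D" using c(1) that by (simp add: Z_h_def)
      then obtain p where p: "p \<in> local_space (family D) (space_degree D)" "\<forall>x\<in>interior K. c i x = p x"
        using K by (auto simp: V_h_def)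
      obtain d where "\<And>x. p x $ j = (\<Sum>\<alpha>\<in>multi_indices (Suc (space_degree D)). d \<alpha> * monomial \<alpha> x)"
        using poly_spaceE[OF local_space_component[OF p(1), of j]] by blast
      then show ?thesis using p(2) by (intro exI[of _ d]) simp
    qed
    then have "\<forall>i j. \<exists>d. i \<le> deg \<longrightarrow> (\<forall>x\<in>interior K. c i x $ j =
        (\<Sum>\<alpha>\<in>multi_indices (Suc (space_degree D)). d \<alpha> * monomial \<alpha> x))"
      by blast
    then obtain d where d: "\<And>i j x. i \<le> deg \<Longrightarrow> x \<in> interior K \<Longrightarrow> c i x $ j =
        (\<Sum>\<alpha>\<in>multi_indices (Suc (space_degree D)). d i j \<alpha> * monomial \<alpha> x)"
      unfolding choice_iff by blast
    have "P n K = (\<Sum>i\<le>deg. \<Sum>j\<in>UNIV. \<Sum>\<alpha>\<in>multi_indices (Suc (space_degree D)).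
        fun_scale (d i j \<alpha>) (mono_field (n, K, i, \<alpha>, j)))" (is "_ = ?R")
    proof (rule ext, clarify)
      fix t x
      have R: "?R (t, x) = (\<Sum>i\<le>deg. \<Sum>j\<in>UNIV. \<Sum>\<alpha>\<in>multi_indices (Suc (space_degree D)).
          d i j \<alpha> *\<^sub>R mono_field (n, K, i, \<alpha>, j) (t, x))"
        by (simp add: sum_fun_apply fun_scale_def)
      show "P n K (t, x) = ?R (t, x)"
      proof (cases "t \<in> slab D n \<and> x \<in> G \<and> cell x = K")
        case True
        then have x: "x \<in> interior K" "x \<in> \<Omega>" using cell mesh_interior_subset by auto
        have "P n K (t, x) = (\<Sum>i\<le>deg. t ^ i *\<^sub>R c i x)"
          using True c(2) x by (simp add: P_def)
        also have "\<dots> = (\<Sum>i\<le>deg. \<Sum>j\<in>UNIV. \<Sum>\<alpha>\<in>multi_indices (Suc (space_degree D)).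
            d i j \<alpha> *\<^sub>R mono_field (n, K, i, \<alpha>, j) (t, x))"
        proof (intro sum.cong refl)
          fix i assume i: "i \<in> {..deg}"
          have "t ^ i *\<^sub>R c i x = t ^ i *\<^sub>R (\<Sum>j\<in>UNIV. (c i x $ j) *\<^sub>R axis j 1)"
            using vec_sum_axis[of "c i x"] by simp
          also have "\<dots> = (\<Sum>j\<in>UNIV. \<Sum>\<alpha>\<in>multi_indices (Suc (space_degree D)).
              d i j \<alpha> *\<^sub>R mono_field (n, K, i, \<alpha>, j) (t, x))"
            using i True x
            by (simp add: d mono_field_def scaleR_sum_right scaleR_sum_left mult.commute mult.left_commute)
          finally show "t ^ i *\<^sub>R c i x = (\<Sum>j\<in>UNIV. \<Sum>\<alpha>\<in>multi_indices (Suc (space_degree D)).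
              d i j \<alpha> *\<^sub>R mono_field (n, K, i, \<alpha>, j) (t, x))" .
        qed
        finally show ?thesis using R by simp
      next
        case False
        then have "mono_field (n, K, i, \<alpha>, j) (t, x) = 0" for i \<alpha> j by (auto simp: mono_field_def)
        moreover have "P n K (t, x) = 0" using False by (auto simp: P_def)
        ultimately show ?thesis using R by simp
      qed
    qed
    also have "\<dots> \<in> fun_space.span mono_fields"
      using n K unfolding mono_fields_def
      by (intro fun_space.span_sum fun_space.span_scale fun_space.span_base imageI) auto
    finally show ?thesis .
  qed
  then have "(\<Sum>n\<in>steps. \<Sum>K\<in>mesh D. P n K) \<in> fun_space.span mono_fields"
    by (intro fun_space.span_sum)
  also have "(\<Sum>n\<in>steps. \<Sum>K\<in>mesh D. P n K) = U"
  proof (rule ext, clarify)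
    fix t x
    have *: "(\<Sum>n\<in>steps. \<Sum>K\<in>mesh D. P n K) (t, x) = (\<Sum>n\<in>steps. \<Sum>K\<in>mesh D. P n K (t, x))"
      by (simp add: sum_fun_apply)
    show "(\<Sum>n\<in>steps. \<Sum>K\<in>mesh D. P n K) (t, x) = U (t, x)"
    proof (cases "(t, x) \<in> seen")
      case True
      then obtain n where n: "n \<in> steps" "t \<in> slab D n" and x: "x \<in> G"
        unfolding seen_def slabs_def by blast
      have "(\<Sum>K\<in>mesh D. P m K (t, x)) = (if m = n then U (t, x) else 0)" if m: "m \<in> steps" for m
      proof (cases "m = n")
        case True
        have "(\<Sum>K\<in>mesh D. P m K (t, x)) = (\<Sum>K\<in>mesh D. if cell x = K then U (t, x) else 0)"
          using True n x by (intro sum.cong) (auto simp: P_def)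
        then show ?thesis using True cell[OF x] finite_mesh by simp
      next
        case False
        then have "t \<notin> slab D m" using slab_unique[OF m n(1) _ n(2)] by blast
        then show ?thesis using False by (simp add: P_def)
      qed
      then show ?thesis unfolding * using n(1) by simp
    next
      case False
      then have "P n K (t, x) = 0" if "n \<in> steps" for n K
        using that by (auto simp: P_def seen_def slabs_def)
      then show ?thesis unfolding * using U False by (simp add: Z_rep_def)
    qed
  qed
  finally show "U \<in> fun_space.span mono_fields" .
qed

text \<open>A maximal independent subset of \<open>Z_rep\<close> is finite because it lies in the
  span of finitely many fields. Its members vanish outside \<open>seen\<close>, so independence as
  functions gives independence on slabs and open elements.\<close>

lemma finite_basis:
  obtains m :: nat and b where "\<And>p. p < m \<Longrightarrow> b p \<in> Z_ht D"
    and "\<And>z. z \<in> Z_ht D \<Longrightarrow> \<exists>a. combs m b a z"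
    and "\<And>a p. (\<And>n t x. n \<in> steps \<Longrightarrow> t \<in> slab D n \<Longrightarrow> x \<in> G \<Longrightarrow> (\<Sum>p<m. a p *\<^sub>R b p t x) = 0)
      \<Longrightarrow> p < m \<Longrightarrow> a p = 0"
proof -
  obtain B where B: "B \<subseteq> Z_rep" "fun_space.independent B" "Z_rep \<subseteq> fun_space.span B"
    using fun_space.maximal_independent_subset by blast
  have "finite B"
    using fun_space.independent_span_bound[OF finite_mono_fields B(2)] B(1) Z_rep_span by blast
  then obtain e where "bij_betw e {0..<card B} B"
    using ex_bij_betw_nat_finite by blast
  then have e: "inj_on e {..<card B}" "e ` {..<card B} = B"
    by (auto simp: bij_betw_def lessThan_atLeast0)
  define b where "b p = curry (e p)" for p
  have eB: "e p \<in> Z_rep" if "p < card B" for p using e(2) B(1) that by auto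
  show thesis
  proof (rule that[of "card B" b])
    show "b p \<in> Z_ht D" if "p < card B" for p
      using eB[OF that] by (simp add: b_def Z_rep_def)
    fix z assume z: "z \<in> Z_ht D"
    let ?U = "\<lambda>y. if y \<in> seen then case_prod z y else 0"
    have "?U \<in> fun_space.span B" using Z_rep_exists[OF z] B(3) by blast
    then obtain c where "?U = (\<Sum>v\<in>B. fun_scale (c v) v)"
      unfolding fun_space.span_finite[OF \<open>finite B\<close>] by auto
    also have "\<dots> = (\<Sum>p<card B. fun_scale (c (e p)) (e p))"
      using sum.reindex[OF e(1), of "\<lambda>v. fun_scale (c v) v"] unfolding e(2) by simp
    finally have eq: "?U = (\<Sum>p<card B. fun_scale (c (e p)) (e p))" .
    have "z t x = (\<Sum>p<card B. c (e p) *\<^sub>R b p t x)" if "n \<in> steps" "t \<in> slab D n" "x \<in> G" for n t x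
    proof -
      have "(t, x) \<in> seen" using that unfolding seen_def slabs_def by blast
      then show ?thesis
        using fun_cong[OF eq, of "(t, x)"] by (simp add: sum_fun_scale_apply b_def)
    qed
    then show "\<exists>a. combs (card B) b a z"
      unfolding combs_def by (intro exI[of _ "\<lambda>p. c (e p)"] ballI)
  next
    fix a p
    assume zero: "\<And>n t x. n \<in> steps \<Longrightarrow> t \<in> slab D n \<Longrightarrow> x \<in> G \<Longrightarrow> (\<Sum>p<card B. a p *\<^sub>R b p t x) = 0"
      and p: "p < card B"
    define g where "g v = a (inv_into {..<card B} e v)" for v
    have "(\<Sum>v\<in>B. fun_scale (g v) v) = (\<Sum>p<card B. fun_scale (g (e p)) (e p))"
      using sum.reindex[OF e(1), of "\<lambda>v. fun_scale (g v) v"] unfolding e(2) by simp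
    also have "\<dots> = (\<Sum>p<card B. fun_scale (a p) (e p))"
      using e(1) by (intro sum.cong) (auto simp: g_def)
    also have "\<dots> = 0"
    proof (rule ext, clarify)
      fix t x
      have "(\<Sum>p<card B. a p *\<^sub>R e p (t, x)) = 0"
      proof (cases "(t, x) \<in> seen")
        case True
        then show ?thesis using zero by (auto simp: seen_def slabs_def b_def)
      next
        case False
        then show ?thesis using eB by (auto simp: Z_rep_def intro!: sum.neutral)
      qed
      then show "(\<Sum>p<card B. fun_scale (a p) (e p)) (t, x) = 0 (t, x)"
        by (simp add: sum_fun_scale_apply)
    qed
    finally have "(\<Sum>v\<in>B. fun_scale (g v) v) = 0" .
    then have "g (e p) = 0"
      using fun_space.independentD[OF B(2) \<open>finite B\<close> subset_refl] e(2) p by blast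
    then show "a p = 0" using e(1) p by (simp add: g_def)
  qed
qed

text \<open>The shift in time keeps the coordinates and changes only the family. The shifted family
  may be dependent, as a function living on the last of several slabs is shifted to zero;
  \<open>seq_cont\<close> therefore allows arbitrary finite families.\<close>

lemma tilde_combs:
  assumes "\<And>p. p < m \<Longrightarrow> b p \<in> Z_ht D" "u \<in> Z_ht D" "combs m b a u"
  shows "combs m (\<lambda>p. tilde D (b p)) a (tilde D u)"
  using assms
proof (induction m arbitrary: u)
  case 0
  then show ?case
    using combD[OF tilde_comb[OF 0(2) 0(2) comb_zero[OF 0(3)]]] by (simp add: combs_def)
next
  case (Suc m)
  note st = combs_induct_step[OF Suc.prems(1) Suc.prems(3)]
  have bm: "b m \<in> Z_ht D" using Suc.prems(1) by simp
  have "combs m (\<lambda>p. tilde D (b p)) a (tilde D (\<lambda>t x. \<Sum>p<m. a p *\<^sub>R b p t x))"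
    by (rule Suc.IH[OF _ st(1,2)]) (simp add: Suc.prems(1))
  with combD[OF tilde_comb[OF st(1) bm st(3)]] show ?case
    by (simp add: combs_def)
qed

section \<open>Existence of a discrete solution\<close>

definition full_form ::
  "real \<Rightarrow> (real \<Rightarrow> real^'d \<Rightarrow> real^'d) \<Rightarrow> (real \<Rightarrow> real^'d \<Rightarrow> real^'d) \<Rightarrow> (real \<Rightarrow> real^'d \<Rightarrow> real^'d) \<Rightarrow> real"
where
  "full_form \<nu> w u z = m_form D u z + \<nu> * a_form D u z + c_form D w u z"

lemma full_form_bilin: "w \<in> Z_ht D \<Longrightarrow> bilin_form (full_form \<nu> w)"
  unfolding full_form_def[abs_def]
  by (intro bilin_form_add bilin_form_scale m_form_bilin a_form_bilin c_form_bilin)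

lemma zero_data:
  "(\<lambda>t x. 0) \<in> L1L2_space (final_time D) \<Omega>" "(\<lambda>x. 0) \<in> Z_space \<Omega>"
  "rhs_form D (\<lambda>t x. 0) (\<lambda>x. 0) z = 0"
  "L1L2_norm (final_time D) \<Omega> (\<lambda>t x. 0) = 0" "L2_norm (vol D) (\<lambda>x. 0 :: real^'d) = 0"
proof -
  have L: "L2_norm (vol D) (\<lambda>x. 0 :: real^'d) = 0" by (simp add: L2_norm_def)
  then show "L2_norm (vol D) (\<lambda>x. 0 :: real^'d) = 0" "L1L2_norm (final_time D) \<Omega> (\<lambda>t x. 0) = 0"
    by (simp_all add: L1L2_norm_def)
  have "(\<lambda>x. 0) \<in> L2_space (vol D)" by (simp add: L2_space_def)
  then have "AE t in lebesgue_on {0<..<final_time D}. (\<lambda>x. 0) \<in> L2_space (vol D)"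
    by (intro AE_I2)
  then show "(\<lambda>t x. 0) \<in> L1L2_space (final_time D) \<Omega>"
    using L by (simp add: L1L2_space_def case_prod_beta)
  show "(\<lambda>x. 0) \<in> Z_space \<Omega>"
    using has_weak_div_zero zero_normal_trace_zero by (auto simp: Z_space_def Hdiv_def)
  show "rhs_form D (\<lambda>t x. 0) (\<lambda>x. 0) z = 0"
    by (simp add: rhs_form_def L2_inner_def)
qed

lemma solution_exists:
  assumes \<nu>: "0 < \<nu>" and stab: "linear_stability_constant D \<nu> C"
    and f: "f \<in> L1L2_space (final_time D) \<Omega>" and u0: "u0 \<in> Z_space \<Omega>"
  shows "\<exists>u\<in>Z_ht D. \<forall>z\<in>Z_ht D. full_form \<nu> (tilde D u) u z = rhs_form D f u0 z"
proof -
  obtain m :: nat and b where b: "\<And>p. p < m \<Longrightarrow> b p \<in> Z_ht D"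
    and cover: "\<And>z. z \<in> Z_ht D \<Longrightarrow> \<exists>a. combs m b a z"
    and indep: "\<And>a p. (\<And>n t x. n \<in> steps \<Longrightarrow> t \<in> slab D n \<Longrightarrow> x \<in> G \<Longrightarrow> (\<Sum>p<m. a p *\<^sub>R b p t x) = 0)
      \<Longrightarrow> p < m \<Longrightarrow> a p = 0"
    using finite_basis by blast
  define U where "U a = (\<lambda>t x. \<Sum>p<m. a p *\<^sub>R b p t x)" for a :: "nat \<Rightarrow> real"
  have U: "U a \<in> Z_ht D" "combs m b a (U a)" for a
    unfolding U_def using b by (intro Z_ht_sum) (auto simp: combs_def)
  define w where "w a = tilde D (U a)" for a
  have w: "w a \<in> Z_ht D" "combs m (\<lambda>p. tilde D (b p)) a (w a)" for a
    unfolding w_def using tilde_Z_ht[OF U(1)] tilde_combs[OF b U] by auto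
  \<comment> \<open>Rows belong to test functions and columns to trial functions; \<open>a\<close>
    enters through the advection field.\<close>
  define M where "M a p q = full_form \<nu> (w a) (b q) (b p)" for a p q
  define T where "T = (\<Sum>n\<in>steps. measure (lebesgue_on (slab D n)) (slab D n))"
  have T: "0 \<le> T" by (simp add: T_def sum_nonneg)
  have M_sum: "(\<Sum>q<m. M a p q * x q) = full_form \<nu> (w a) (U x) (b p)" if "p < m" for a x p
    unfolding M_def using lin_form_combs[OF bilin_formD(1)[OF full_form_bilin[OF w(1)] b[OF that]] b U] by (simp add: mult.commute)
  \<comment> \<open>Testing with the basis suffices because both sides are linear in the test
    function.\<close>
  have test: "full_form \<nu> (w a) u z = rhs_form D g v0 z"
    if eq: "\<And>p. p < m \<Longrightarrow> full_form \<nu> (w a) u (b p) = rhs_form D g v0 (b p)"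
      and u: "u \<in> Z_ht D" and z: "z \<in> Z_ht D"
      and g: "g \<in> L1L2_space (final_time D) \<Omega>" "v0 \<in> Z_space \<Omega>" for a u z g v0
  proof -
    obtain y where y: "combs m b y z" using cover[OF z] by blast
    have "full_form \<nu> (w a) u z = (\<Sum>p<m. y p * full_form \<nu> (w a) u (b p))"
      by (rule lin_form_combs[OF bilin_formD(2)[OF full_form_bilin[OF w(1)] u] b z y])
    also have "\<dots> = (\<Sum>p<m. y p * rhs_form D g v0 (b p))"
      using eq by (intro sum.cong) auto
    also have "\<dots> = rhs_form D g v0 z"
      by (rule lin_form_combs[OF rhs_form_lin[OF g] b z y, symmetric])
    finally show ?thesis .
  qed
  \<comment> \<open>The right-hand side is free of \<open>a\<close>. It is used with zero data for
    injectivity and with the given data for the coordinate bound.\<close>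
  have energy: "st_inner (U x) (U x) \<le> T * (C * ((L1L2_norm (final_time D) \<Omega> g)\<^sup>2 + (L2_norm (vol D) v0)\<^sup>2))"
    if eq: "\<And>p. p < m \<Longrightarrow> (\<Sum>q<m. M a p q * x q) = rhs_form D g v0 (b p)"
      and g: "g \<in> L1L2_space (final_time D) \<Omega>" "v0 \<in> Z_space \<Omega>" for a x g v0
  proof -
    have "full_form \<nu> (w a) (U x) (b p) = rhs_form D g v0 (b p)" if "p < m" for p
      using eq[OF that] M_sum[OF that] by simp
    from test[OF this U(1) _ g] have "\<forall>z\<in>Z_ht D. full_form \<nu> (w a) (U x) z = rhs_form D g v0 z"
      by blast
    then have "(energy_norm D \<nu> (w a) (U x))\<^sup>2 \<le> C * ((L1L2_norm (final_time D) \<Omega> g)\<^sup>2 + (L2_norm (vol D) v0)\<^sup>2)"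
      using stab w(1) U(1) g unfolding linear_stability_constant_def full_form_def by blast
    from mult_left_mono[OF this T] show ?thesis
      using st_inner_le_energy[OF U(1), of \<nu> x "w a"] \<nu> unfolding T_def by simp
  qed
  have zero: "x q = 0" if "st_inner (U x) (U x) = 0" "q < m" for x q
    by (rule indep[OF _ that(2)]) (use st_inner_zero_imp[OF U(1) that(1)] in \<open>simp add: U_def\<close>)
  \<comment> \<open>Gram matrix of the basis; its quadratic form is definite by
    \<open>zero\<close>.\<close>
  define Gm where "Gm p q = st_inner (b p) (b q)" for p q
  have quad: "st_inner (U x) (U x) = (\<Sum>p<m. \<Sum>q<m. x p * x q * Gm p q)" for x
  proof -
    have "st_inner (U x) (U x) = (\<Sum>p<m. x p * st_inner (b p) (U x))"
      by (rule lin_form_combs[OF bilin_formD(1)[OF st_inner_bilin U(1)] b U])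
    also have "\<dots> = (\<Sum>p<m. x p * (\<Sum>q<m. x q * Gm p q))"
      unfolding Gm_def
      by (intro sum.cong refl) (use lin_form_combs[OF bilin_formD(2)[OF st_inner_bilin] b U] b in simp)
    finally show ?thesis by (simp add: sum_distrib_left mult.assoc)
  qed
  have "\<exists>c>0. \<forall>x. \<forall>q<m. c * (x q)\<^sup>2 \<le> (\<Sum>p<m. \<Sum>q<m. x p * x q * Gm p q)"
    by (rule quadratic_form_coercive) (use st_inner_nonneg zero in \<open>simp_all add: quad[symmetric]\<close>)
  then obtain c where c: "0 < c" "\<And>x q. q < m \<Longrightarrow> c * (x q)\<^sup>2 \<le> st_inner (U x) (U x)"
    unfolding quad by blast
  define R where "R = T * (C * ((L1L2_norm (final_time D) \<Omega> f)\<^sup>2 + (L2_norm (vol D) u0)\<^sup>2))"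
  have "\<exists>a. \<forall>p<m. (\<Sum>q<m. M a p q * a q) = rhs_form D f u0 (b p)"
  proof (rule quasilinear_system_solvable)
    fix a x q
    assume "\<And>p. p < m \<Longrightarrow> (\<Sum>q<m. M a p q * x q) = 0" and q: "q < m"
    then have "st_inner (U x) (U x) \<le> T * (C * ((L1L2_norm (final_time D) \<Omega> (\<lambda>t x. 0 :: real^'d))\<^sup>2 + (L2_norm (vol D) (\<lambda>x. 0 :: real^'d))\<^sup>2))"
      by (intro energy[of a x]) (auto simp: zero_data)
    then have "st_inner (U x) (U x) \<le> 0" by (simp add: zero_data)
    then show "x q = 0" using zero[OF _ q] st_inner_nonneg[of "U x"] by simp
  next
    fix a x q
    assume eq: "\<And>p. p < m \<Longrightarrow> (\<Sum>q<m. M a p q * x q) = rhs_form D f u0 (b p)" and q: "q < m"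
    \<comment> \<open>Energy bounds the Gram form and coercivity bounds the coordinates, so
      \<open>sqrt (R / c)\<close> is the half-width that the fixed point argument asks for.\<close>
    have "c * (x q)\<^sup>2 \<le> R"
      using c(2)[OF q, of x] energy[OF eq f u0] unfolding R_def by linarith
    then have "(x q)\<^sup>2 \<le> R / c" using c(1) by (simp add: field_simps)
    then show "\<bar>x q\<bar> \<le> sqrt (R / c)" by (rule real_le_rsqrt[of "\<bar>x q\<bar>", simplified])
  next
    fix a :: "nat \<Rightarrow> nat \<Rightarrow> real" and l p q
    assume a: "\<And>j. j < m \<Longrightarrow> (\<lambda>k. a k j) \<longlonglongrightarrow> l j" and pq: "p < m" "q < m"
    \<comment> \<open>The mass and viscous parts are constant in \<open>a\<close>, so continuity
      concerns the convective form alone.\<close>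
    obtain S where S: "seq_cont S" "\<forall>w\<in>Z_ht D. c_form D w (b q) (b p) = S w"
      using c_form_seq_cont[OF b[OF pq(2)] b[OF pq(1)]] by blast
    have "(\<lambda>k. S (w (a k))) \<longlonglongrightarrow> S (w l)"
      by (rule seq_contD[OF S(1) _ w a]) (use b tilde_Z_ht in auto)
    then have "(\<lambda>k. c_form D (w (a k)) (b q) (b p)) \<longlonglongrightarrow> c_form D (w l) (b q) (b p)"
      using S(2) w(1) by simp
    then show "(\<lambda>k. M (a k) p q) \<longlonglongrightarrow> M l p q"
      unfolding M_def full_form_def by (intro tendsto_add tendsto_const)
  qed
  then obtain a where a: "\<And>p. p < m \<Longrightarrow> (\<Sum>q<m. M a p q * a q) = rhs_form D f u0 (b p)"
    by blast
  have "full_form \<nu> (w a) (U a) z = rhs_form D f u0 z" if "z \<in> Z_ht D" for z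
    by (rule test[OF _ U(1) that f u0]) (use a M_sum in simp)
  then show ?thesis
    using U(1) unfolding w_def by blast
qed

end

theorem theorem5p2:
  fixes k :: nat and \<rho> :: real
  assumes "CARD('d::finite) = 2 \<or> CARD('d) = 3"
  shows "\<exists>\<sigma>0>0. \<forall>(C::real) (D :: 'd discretization) \<nu> f u0.
    valid_discretization \<rho> D \<and> space_degree D = k \<and> \<sigma>0 \<le> penalty D \<and> 0 < \<nu> \<and>
    linear_stability_constant D \<nu> C \<and>
    f \<in> L1L2_space (final_time D) (domain_of D) \<and> u0 \<in> Z_space (domain_of D) \<longrightarrow>
    (\<exists>u\<in>Z_ht D.
       (\<forall>z\<in>Z_ht D. m_form D u z + \<nu> * a_form D u z + c_form D (tilde D u) u z = rhs_form D f u0 z) \<and>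
       (energy_norm D \<nu> (tilde D u) u)\<^sup>2 \<le>
         C * ((L1L2_norm (final_time D) (domain_of D) f)\<^sup>2 + (L2_norm (vol D) u0)\<^sup>2))"
proof (intro exI[of _ 1] conjI allI impI)
  fix C \<nu> :: real and D :: "'d discretization" and f u0
  assume *: "valid_discretization \<rho> D \<and> space_degree D = k \<and> 1 \<le> penalty D \<and> 0 < \<nu> \<and>
    linear_stability_constant D \<nu> C \<and>
    f \<in> L1L2_space (final_time D) (domain_of D) \<and> u0 \<in> Z_space (domain_of D)"
  then interpret valid_mesh D \<rho> by unfold_locales simp
  obtain u where u: "u \<in> Z_ht D"
    "\<forall>z\<in>Z_ht D. m_form D u z + \<nu> * a_form D u z + c_form D (tilde D u) u z = rhs_form D f u0 z"
    using solution_exists[of \<nu> C f u0] * unfolding full_form_def by blast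
  moreover have "(energy_norm D \<nu> (tilde D u) u)\<^sup>2 \<le>
      C * ((L1L2_norm (final_time D) (domain_of D) f)\<^sup>2 + (L2_norm (vol D) u0)\<^sup>2)"
    using * u tilde_Z_ht[OF u(1)] unfolding linear_stability_constant_def by blast
  ultimately show "\<exists>u\<in>Z_ht D.
       (\<forall>z\<in>Z_ht D. m_form D u z + \<nu> * a_form D u z + c_form D (tilde D u) u z = rhs_form D f u0 z) \<and>
       (energy_norm D \<nu> (tilde D u) u)\<^sup>2 \<le>
         C * ((L1L2_norm (final_time D) (domain_of D) f)\<^sup>2 + (L2_norm (vol D) u0)\<^sup>2)"
    by blast
qed simp

end
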